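(* Let $k$ be a field of characteristic not $2$. Let $C_1,C_2,C_3\subset\mathbb{P}^2_k$ be three circles whose centers do not lie on a shared line, and let $\mathcal{A}$ be the set of all circles that are tangent to all of $C_1,C_2,C_3$. Each $C_i$ determines a quadric cone $Q_i=\mathbb{V}(q_i)\subset\mathbb{P}^3_k$ (the cone of circles tangent to $C_i$). Each $S\in\mathcal{A}$ corresponds to an intersection point $s\in Q_1\cap Q_2\cap Q_3$ with residue field $k(s)$. Let $\mathrm{Vol}(s):=\det(\nabla q_i)|_s\in k(s)$ be the oriented volume of the parallelepiped spanned by the gradient vectors of $Q_1,Q_2,Q_3$ at $s$. If no two of $C_1,C_2,C_3$ are tangent and $k(s)/k$ is separable, then $$\beta_S=\mathrm{Tr}_{k(s)/k}\langle\mathrm{Vol}(s)\rangle\quad\text{in }\mathrm{GW}(k),$$ where $\beta_S\in\mathrm{GW}(k)$ is the local index at $S$ defined in the context.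
   Context: $\mathrm{GW}(k)$ is the Grothendieck--Witt group of isomorphism classes of symmetric non-degenerate bilinear forms over $k$; $\langle a\rangle$ is the class of $(x,y)\mapsto axy$. For a finite separable extension $L/k$, $\mathrm{Tr}_{L/k}:\mathrm{GW}(L)\to\mathrm{GW}(k)$ is post-composition with the field trace. Circles. A circle in $\mathbb{P}^2_k$ (coordinates $[x:y:z]$) is a conic of the form $C(p)=\mathbb{V}(p_0(x^2+y^2)+z(p_1x+p_2y+p_3z))$ with $p=[p_0:p_1:p_2:p_3]\in\mathbb{P}^3$. Thus the moduli space of circles is identified with $\mathbb{P}^3_k$ (coordinates $[c_0:c_1:c_2:c_3]$). The circle is degenerate if $p_0=0$. A non-degenerate circle has center $[a:b:1]$ and radius squared $r^2$, where $p_1/p_0=-2a$, $p_2/p_0=-2b$, $p_3/p_0=a^2+b^2-r^2$. The given circles $C_i$ are non-degenerate and defined over $k$ (so $a_i,b_i,r_i^2\in k$). Tangency. The space of circles tangent to the non-degenerate circle $C_i$ with center $[a_i:b_i:1]$ and radius squared $r_i^2$ is the quadric cone $Q_i=\mathbb{V}(q_i)\subset\mathbb{P}^3_k$, where $$q_i=(a_iX_i+b_iY_i+Z_i)^2-r_i^2(X_i^2+Y_i^2),$$ $X_i=c_1+2a_ic_0$, $Y_i=c_2+2b_ic_0$, $Z_i=c_3-(a_i^2+b_i^2-r_i^2)c_0$. A circle $C(s)$ is tangent to $C_i$ iff $s\in Q_i$. Coordinates, volume and local index. Choose $j$ with $c_j(s)\neq 0$ and let $f^{(j)}=(q_1/c_j^2,q_2/c_j^2,q_3/c_j^2)$,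 viewed as a map $\mathbb{A}^3_k\to\mathbb{A}^3_k$ in the coordinates $c_l/c_j$, $l\neq j$, in increasing order of $l$. Then $\mathrm{Vol}(s)$ means $(-1)^j\det(\mathrm{Jac} f^{(j)})(s)$; for a non-degenerate $S$ one may take $j=0$, so that $\mathrm{Vol}(s)$ is the determinant of the gradients $\nabla=(\partial/\partial c_1,\partial/\partial c_2,\partial/\partial c_3)$ of the $q_i|_{c_0=1}$ at $s$. Its class up to squares does not depend on $j$. The class $\beta_S$ is the local index at $s$ of the section $\sigma=(q_1,q_2,q_3)$ of the relatively oriented bundle $\mathcal{O}(2)^{\oplus 3}\to\mathbb{P}^3_k$: $\beta_S=\mathrm{ind}_s\sigma=\langle(-1)^j\rangle\cdot\deg^{\mathbb{A}^1}_s(f^{(j)})\in\mathrm{GW}(k)$, independent of $j$. Local $\mathbb{A}^1$-degree. For $f=(f_1,\ldots,f_n):\mathbb{A}^n_k\to\mathbb{A}^n_k$ with isolated zero at a closed point $p$ with maximal ideal $\mathfrak m$, $\deg^{\mathbb{A}^1}_p(f)$ is the class of the Scheja--Storch form on $A=k[x_1,\ldots,x_n]_{\mathfrak{m}}/(f_1,\ldots,f_n)$: write $f_j(X)-f_j(Y)=\sum_i\Delta_{ij}(X_i-Y_i)$ with $\Delta_{ij}\in k[X,Y]$, let $\sum_l a_l\otimes b_l\in A\otimes_kA$ be the image of $\det(\Delta_{ij})$, let $\eta:A\to k$ be the unique $k$-linear map with $\sum_l\eta(a_l)b_l=1$; the form is $(x,y)\mapsto\eta(xy)$.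
   Formalization: Adds that each given circle has nonzero radius squared and that the tangent circle S is not a circle of radius zero; in the excluded cases (e.g. S the common point of three circles) Vol(s) = 0, so the class of Vol(s) is undefined. *)

theory Defs
  imports
    "Jordan_Normal_Form.Determinant"
    "HOL-Library.Poly_Mapping"
    "HOL-Library.FuncSet"
    "HOL-Computational_Algebra.Fraction_Field"
    "HOL-Algebra.QuotRing"
begin

section \<open>The Grothendieck--Witt ring\<close>

text \<open>
  A symmetric non-degenerate bilinear form on a finite-dimensional \<open>k\<close>-space is represented by its
  Gram matrix, so that isometry is congruence of matrices.
\<close>

definition nondeg_sym_form :: "'k::field mat \<Rightarrow> bool" where
  "nondeg_sym_form M \<longleftrightarrow>
     M \<in> carrier_mat (dim_row M) (dim_row M) \<and> M\<^sup>T = M \<and> det M \<noteq> 0"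

definition isometric :: "'k::field mat \<Rightarrow> 'k mat \<Rightarrow> bool" where
  "isometric M N \<longleftrightarrow> nondeg_sym_form M \<and> nondeg_sym_form N \<and> dim_row M = dim_row N \<and>
     (\<exists>P \<in> carrier_mat (dim_row M) (dim_row M). det P \<noteq> 0 \<and> N = P\<^sup>T * M * P)"

lemma right_inverse_det_nonzero:
  fixes P :: "'k::field mat"
  assumes "P \<in> carrier_mat n n" "Q \<in> carrier_mat n n" "P * Q = 1\<^sub>m n"
  shows "det P \<noteq> 0"
  using det_mult[OF assms(1,2)] assms(3) by auto

lemma det_nonzero_right_inverse:
  fixes P :: "'k::field mat"
  assumes "P \<in> carrier_mat n n" "det P \<noteq> 0"
  obtains Q where "Q \<in> carrier_mat n n" "P * Q = 1\<^sub>m n" "Q * P = 1\<^sub>m n"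
proof -
  from det_non_zero_imp_unit[OF assms, of "()"]
  obtain Q where "Q \<in> carrier_mat n n" "P * Q = 1\<^sub>m n" "Q * P = 1\<^sub>m n"
    unfolding Units_def ring_mat_simps by blast
  thus thesis by (rule that)
qed

lemma congruence_nondeg:
  fixes M :: "'k::field mat"
  assumes "nondeg_sym_form M" "P \<in> carrier_mat (dim_row M) (dim_row M)" "det P \<noteq> 0"
  shows "nondeg_sym_form (P\<^sup>T * M * P)"
proof -
  define n where "n = dim_row M"
  have M: "M \<in> carrier_mat n n" "M\<^sup>T = M" "det M \<noteq> 0" and P: "P \<in> carrier_mat n n"
    using assms unfolding nondeg_sym_form_def n_def by blast+
  have PT: "P\<^sup>T \<in> carrier_mat n n" using P by simp
  have PM: "P\<^sup>T * M \<in> carrier_mat n n" using PT M by simp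
  have "(P\<^sup>T * M * P)\<^sup>T = P\<^sup>T * (P\<^sup>T * M)\<^sup>T" by (rule transpose_mult[OF PM P])
  also have "(P\<^sup>T * M)\<^sup>T = M * P" using transpose_mult[OF PT M(1)] M(2) by simp
  also have "P\<^sup>T * (M * P) = P\<^sup>T * M * P" by (rule assoc_mult_mat[OF PT M(1) P, symmetric])
  finally have 1: "(P\<^sup>T * M * P)\<^sup>T = P\<^sup>T * M * P" .
  have "det (P\<^sup>T * M * P) = det P * det M * det P"
    using det_mult[OF PM P] det_mult[OF PT M(1)] det_transpose[OF P] by simp
  with M assms(3) have 2: "det (P\<^sup>T * M * P) \<noteq> 0" by simp
  have "P\<^sup>T * M * P \<in> carrier_mat n n" using PM P by simp
  with 1 2 show ?thesis unfolding nondeg_sym_form_def by (metis carrier_matD(1))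
qed

lemma isometricI:
  fixes M :: "'k::field mat"
  assumes "nondeg_sym_form M" "P \<in> carrier_mat (dim_row M) (dim_row M)"
    "Q \<in> carrier_mat (dim_row M) (dim_row M)" "P * Q = 1\<^sub>m (dim_row M)" "N = P\<^sup>T * M * P"
  shows "isometric M N"
proof -
  have d: "det P \<noteq> 0" by (rule right_inverse_det_nonzero[OF assms(2,3,4)])
  have N: "nondeg_sym_form N" unfolding assms(5) by (rule congruence_nondeg[OF assms(1,2) d])
  have dim: "dim_row M = dim_row N" using assms(2,5) by simp
  show ?thesis unfolding isometric_def using assms(1,2,5) N dim d by blast
qed

lemma nondeg_carrier: "nondeg_sym_form M \<Longrightarrow> M \<in> carrier_mat (dim_row M) (dim_row M)"
  unfolding nondeg_sym_form_def by blast

lemma isometricE: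
  assumes "isometric M N"
  obtains n P where "P \<in> carrier_mat n n" "det P \<noteq> 0" "N = P\<^sup>T * M * P"
    "nondeg_sym_form M" "nondeg_sym_form N" "M \<in> carrier_mat n n" "N \<in> carrier_mat n n"
    "dim_row M = n" "dim_row N = n"
proof -
  from assms have M: "nondeg_sym_form M" and N: "nondeg_sym_form N" and d: "dim_row M = dim_row N"
    unfolding isometric_def by blast+
  from assms obtain P where P: "P \<in> carrier_mat (dim_row M) (dim_row M)" "det P \<noteq> 0" "N = P\<^sup>T * M * P"
    unfolding isometric_def by blast
  show thesis
    by (rule that[OF P M N nondeg_carrier[OF M] nondeg_carrier[OF N, folded d] refl d[symmetric]])
qed

lemma isometric_refl:
  assumes "nondeg_sym_form M" shows "isometric M M"
proof -
  note c = nondeg_carrier[OF assms]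
  have eq: "M = (1\<^sub>m (dim_row M))\<^sup>T * M * 1\<^sub>m (dim_row M)"
    unfolding transpose_one left_mult_one_mat[OF c] right_mult_one_mat[OF c] ..
  show ?thesis
    by (rule isometricI[OF assms one_carrier_mat one_carrier_mat _ eq])
       (rule left_mult_one_mat[OF one_carrier_mat])
qed

lemma isometric_sym:
  assumes "isometric M N" shows "isometric N M"
proof -
  obtain n P where P: "P \<in> carrier_mat n n" "det P \<noteq> 0" "N = P\<^sup>T * M * P"
    and N: "nondeg_sym_form N" "dim_row N = n" and Mc: "M \<in> carrier_mat n n" and Nc: "N \<in> carrier_mat n n"
    using assms by (rule isometricE)
  obtain Q where Q: "Q \<in> carrier_mat n n" "P * Q = 1\<^sub>m n" "Q * P = 1\<^sub>m n"
    using det_nonzero_right_inverse[OF P(1,2)] .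
  have QP: "Q\<^sup>T * P\<^sup>T = 1\<^sub>m n" using transpose_mult[OF P(1) Q(1)] Q(2) by simp
  have PT: "P\<^sup>T \<in> carrier_mat n n" and QT: "Q\<^sup>T \<in> carrier_mat n n" using P Q by simp_all
  have MP: "M * P \<in> carrier_mat n n" using Mc P(1) by simp
  have "N * Q = P\<^sup>T * (M * P) * Q"
    unfolding P(3) assoc_mult_mat[OF PT Mc P(1)] ..
  also have "\<dots> = P\<^sup>T * (M * P * Q)" by (rule assoc_mult_mat[OF PT MP Q(1)])
  also have "M * P * Q = M * (P * Q)" by (rule assoc_mult_mat[OF Mc P(1) Q(1)])
  also have "\<dots> = M" using Q(2) right_mult_one_mat[OF Mc] by simp
  finally have NQ: "N * Q = P\<^sup>T * M" .
  have "Q\<^sup>T * N * Q = Q\<^sup>T * (P\<^sup>T * M)" unfolding assoc_mult_mat[OF QT Nc Q(1)] NQ ..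
  also have "\<dots> = Q\<^sup>T * P\<^sup>T * M" by (rule assoc_mult_mat[OF QT PT Mc, symmetric])
  also have "\<dots> = M" unfolding QP by (rule left_mult_one_mat[OF Mc])
  finally have eq: "M = Q\<^sup>T * N * Q" by (rule sym)
  show ?thesis by (rule isometricI[of N Q P]) (simp_all only: N P(1) Q eq[symmetric])
qed

lemma isometric_trans [trans]:
  assumes "isometric L M" "isometric M N" shows "isometric L N"
proof -
  obtain n P where P: "P \<in> carrier_mat n n" "det P \<noteq> 0" "M = P\<^sup>T * L * P"
    and L: "nondeg_sym_form L" and Lc: "L \<in> carrier_mat n n" and dL: "dim_row L = n" and dM: "dim_row M = n"
    using assms(1) by (rule isometricE)
  obtain n' R where R': "R \<in> carrier_mat n' n'" "det R \<noteq> 0" "N = R\<^sup>T * M * R"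
    and N: "nondeg_sym_form N" and dM': "dim_row M = n'" and dN: "dim_row N = n'"
    using assms(2) by (rule isometricE)
  have "n' = n" using dM dM' by simp
  note R = R'[unfolded this]
  have PT: "P\<^sup>T \<in> carrier_mat n n" and RT: "R\<^sup>T \<in> carrier_mat n n" using P R by simp_all
  have PL: "P\<^sup>T * L \<in> carrier_mat n n" and PR: "P * R \<in> carrier_mat n n" using PT Lc P(1) R(1) by simp_all
  have "N = R\<^sup>T * (P\<^sup>T * L * P * R)"
    unfolding R(3) P(3) by (rule assoc_mult_mat[OF RT _ R(1)]) (use PL P(1) in simp)
  also have "P\<^sup>T * L * P * R = P\<^sup>T * L * (P * R)" by (rule assoc_mult_mat[OF PL P(1) R(1)])
  also have "R\<^sup>T * \<dots> = R\<^sup>T * (P\<^sup>T * L) * (P * R)" by (rule assoc_mult_mat[OF RT PL PR, symmetric])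
  also have "R\<^sup>T * (P\<^sup>T * L) = R\<^sup>T * P\<^sup>T * L" by (rule assoc_mult_mat[OF RT PT Lc, symmetric])
  also have "R\<^sup>T * P\<^sup>T = (P * R)\<^sup>T" by (rule transpose_mult[OF P(1) R(1), symmetric])
  finally have eq: "N = (P * R)\<^sup>T * L * (P * R)" .
  have d: "det (P * R) \<noteq> 0" using det_mult[OF P(1) R(1)] P R by simp
  show ?thesis
    unfolding isometric_def
    by (intro conjI bexI[where x = "P * R"]) (fact L N d eq | simp only: dL dN PR \<open>n' = n\<close>)+
qed

lemma part_equivp_isometric: "part_equivp (isometric :: 'k::field mat \<Rightarrow> 'k mat \<Rightarrow> bool)"
proof (rule part_equivpI)
  show "\<exists>x :: 'k mat. isometric x x"
    by (rule exI[of _ "1\<^sub>m 0"], rule isometric_refl) (auto simp: nondeg_sym_form_def)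
  show "symp (isometric :: 'k::field mat \<Rightarrow> 'k mat \<Rightarrow> bool)"
    by (rule sympI) (rule isometric_sym)
  show "transp (isometric :: 'k::field mat \<Rightarrow> 'k mat \<Rightarrow> bool)"
    by (rule transpI) (rule isometric_trans)
qed

lemma isometric_reindex:
  fixes M :: "'k::field mat"
  assumes M: "nondeg_sym_form M" "dim_row M = n" and s: "bij_betw s {..<n} {..<n}"
  shows "isometric M (mat n n (\<lambda>(i, j). M $$ (s i, s j)))"
proof -
  have Mc: "M \<in> carrier_mat n n" using M by (auto simp: nondeg_sym_form_def)
  define P :: "'k mat" where "P = mat n n (\<lambda>(i, j). if i = s j then 1 else 0)"
  have P: "P \<in> carrier_mat n n" by (simp add: P_def)
  have sn: "s i < n" if "i < n" for i using s that by (auto simp: bij_betw_def)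
  have sinj: "s i = s j \<longleftrightarrow> i = j" if "i < n" "j < n" for i j
    using s that by (auto simp: bij_betw_def inj_on_def)
  have MP: "(X * P) $$ (i, j) = X $$ (i, s j)" if "i < n" "j < n" "X \<in> carrier_mat n n" for i j X
  proof -
    have "(X * P) $$ (i, j) = (\<Sum>k = 0..<n. X $$ (i, k) * P $$ (k, j))"
      using that P by (simp add: scalar_prod_def)
    also have "\<dots> = (\<Sum>k = 0..<n. if k = s j then X $$ (i, k) else 0)"
      by (rule sum.cong) (use that in \<open>auto simp: P_def\<close>)
    also have "\<dots> = X $$ (i, s j)" using sn[OF that(2)] by simp
    finally show ?thesis .
  qed
  have PM: "(P\<^sup>T * X) $$ (i, j) = X $$ (s i, j)" if "i < n" "j < n" "X \<in> carrier_mat n n" for i j X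
  proof -
    have "(P\<^sup>T * X) $$ (i, j) = (\<Sum>k = 0..<n. P $$ (k, i) * X $$ (k, j))"
      using that P by (simp add: scalar_prod_def)
    also have "\<dots> = (\<Sum>k = 0..<n. if k = s i then X $$ (k, j) else 0)"
      by (rule sum.cong) (use that in \<open>auto simp: P_def\<close>)
    also have "\<dots> = X $$ (s i, j)" using sn[OF that(1)] by simp
    finally show ?thesis .
  qed
  have "P\<^sup>T * P = 1\<^sub>m n"
    by (rule eq_matI) (use P PM[OF _ _ P] sn sinj in \<open>auto simp: P_def\<close>)
  hence inv: "P * P\<^sup>T = 1\<^sub>m n"
    using mat_mult_left_right_inverse[of "P\<^sup>T" n P] P by simp
  have "mat n n (\<lambda>(i, j). M $$ (s i, s j)) = P\<^sup>T * M * P"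
  proof (rule eq_matI)
    fix i j assume "i < dim_row (P\<^sup>T * M * P)" "j < dim_col (P\<^sup>T * M * P)"
    hence ij: "i < n" "j < n" using P by auto
    have PTM: "P\<^sup>T * M \<in> carrier_mat n n" using P Mc by simp
    show "mat n n (\<lambda>(i, j). M $$ (s i, s j)) $$ (i, j) = (P\<^sup>T * M * P) $$ (i, j)"
      using ij MP[OF ij PTM] PM[OF ij(1) sn[OF ij(2)] Mc] by simp
  qed (use P in auto)
  thus ?thesis
    by (intro isometricI[where P = P and Q = "P\<^sup>T"]) (use M P inv in auto)
qed

definition orth_sum :: "'k::field mat \<Rightarrow> 'k mat \<Rightarrow> 'k mat" where
  "orth_sum M N = four_block_mat M (0\<^sub>m (dim_row M) (dim_col N)) (0\<^sub>m (dim_row N) (dim_col M)) N"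

definition kronecker :: "'k::field mat \<Rightarrow> 'k mat \<Rightarrow> 'k mat" where
  "kronecker M N = mat (dim_row M * dim_row N) (dim_col M * dim_col N)
     (\<lambda>(i, j). M $$ (i div dim_row N, j div dim_col N) * N $$ (i mod dim_row N, j mod dim_col N))"

lemma dim_orth_sum [simp]: "dim_row (orth_sum M N) = dim_row M + dim_row N"
  "dim_col (orth_sum M N) = dim_col M + dim_col N"
  by (simp_all add: orth_sum_def)

lemma dim_kronecker [simp]: "dim_row (kronecker M N) = dim_row M * dim_row N"
  "dim_col (kronecker M N) = dim_col M * dim_col N"
  by (simp_all add: kronecker_def)

lemma orth_sum_carrier [simp]:
  "M \<in> carrier_mat m m \<Longrightarrow> N \<in> carrier_mat n n \<Longrightarrow> orth_sum M N \<in> carrier_mat (m + n) (m + n)"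
  by (simp add: orth_sum_def)

lemma kronecker_carrier [simp]:
  "M \<in> carrier_mat m m \<Longrightarrow> N \<in> carrier_mat n n \<Longrightarrow> kronecker M N \<in> carrier_mat (m * n) (m * n)"
  by (simp add: kronecker_def)

lemma orth_sum_mult:
  assumes "A \<in> carrier_mat m m" "B \<in> carrier_mat n n" "C \<in> carrier_mat m m" "D \<in> carrier_mat n n"
  shows "orth_sum A B * orth_sum C D = orth_sum (A * C) (B * D)"
proof -
  have d: "dim_row A = m" "dim_col A = m" "dim_row B = n" "dim_col B = n"
    "dim_row C = m" "dim_col C = m" "dim_row D = n" "dim_col D = n"
    using assms by auto
  show ?thesis
    unfolding orth_sum_def index_mult_mat d
    using assms
    by (subst mult_four_block_mat[OF assms(1) zero_carrier_mat zero_carrier_mat assms(2,3)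
          zero_carrier_mat zero_carrier_mat assms(4)]) simp
qed

lemma orth_sum_transpose:
  assumes "A \<in> carrier_mat m m" "B \<in> carrier_mat n n"
  shows "(orth_sum A B)\<^sup>T = orth_sum A\<^sup>T B\<^sup>T"
  unfolding orth_sum_def using assms
  by (subst transpose_four_block_mat[of A m m _ n _ n]) auto

lemma orth_sum_one: "orth_sum (1\<^sub>m m) (1\<^sub>m n) = (1\<^sub>m (m + n) :: 'k::field mat)"
  unfolding orth_sum_def by simp

lemma divmod_bound:
  assumes "(i::nat) < m * n" shows "i div n < m" "i mod n < n" 
proof -
  have "n > 0" using assms by (cases n) auto
  thus "i mod n < n" by simp
  show "i div n < m" using assms by (simp add: less_mult_imp_div_less)
qed

lemma kronecker_index:
  assumes "M \<in> carrier_mat m m" "N \<in> carrier_mat n n" "i < m * n" "j < m * n"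
  shows "kronecker M N $$ (i, j) = M $$ (i div n, j div n) * N $$ (i mod n, j mod n)"
  using assms by (auto simp: kronecker_def)

lemma sum_divmod:
  fixes m n :: nat
  shows "(\<Sum>k = 0..<m * n. f (k div n) * g (k mod n)) = (\<Sum>a = 0..<m. f a) * (\<Sum>b = 0..<n. g b :: 'a::comm_semiring_0)"
proof -
  have "(\<Sum>k = 0..<m * n. f (k div n) * g (k mod n)) = (\<Sum>(a, b)\<in>{0..<m} \<times> {0..<n}. f a * g b)"
  proof (rule sum.reindex_bij_witness[where i = "\<lambda>(a, b). a * n + b" and j = "\<lambda>k. (k div n, k mod n)"], goal_cases)
    case (4 b)
    then obtain x y where b: "b = (x, y)" "x < m" "y < n" by auto
    have "x * n + y < (x + 1) * n" using b by simp
    also have "\<dots> \<le> m * n" using b by (intro mult_right_mono) auto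
    finally show ?case using b by simp
  qed (auto dest: divmod_bound)
  thus ?thesis by (simp add: sum_product sum.cartesian_product)
qed

lemma kronecker_mult:
  assumes A: "A \<in> carrier_mat m m" and B: "B \<in> carrier_mat n n"
    and C: "C \<in> carrier_mat m m" and D: "D \<in> carrier_mat n n"
  shows "kronecker A B * kronecker C D = kronecker (A * C) (B * D)"
proof (rule eq_matI)
  fix i j assume "i < dim_row (kronecker (A * C) (B * D))" "j < dim_col (kronecker (A * C) (B * D))"
  hence ij: "i < m * n" "j < m * n" using A B C D by auto
  note bi = divmod_bound[OF ij(1)] and bj = divmod_bound[OF ij(2)]
  have "(kronecker A B * kronecker C D) $$ (i, j)
      = (\<Sum>k = 0..<m * n. kronecker A B $$ (i, k) * kronecker C D $$ (k, j))"
    using ij A B C D by (simp add: scalar_prod_def)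
  also have "\<dots> = (\<Sum>k = 0..<m * n. (A $$ (i div n, k div n) * C $$ (k div n, j div n)) *
      (B $$ (i mod n, k mod n) * D $$ (k mod n, j mod n)))"
    by (rule sum.cong) (use ij in \<open>auto simp: kronecker_index[OF A B] kronecker_index[OF C D] mult_ac\<close>)
  also have "\<dots> = (\<Sum>a = 0..<m. A $$ (i div n, a) * C $$ (a, j div n)) *
      (\<Sum>b = 0..<n. B $$ (i mod n, b) * D $$ (b, j mod n))"
    by (rule sum_divmod)
  also have "\<dots> = (A * C) $$ (i div n, j div n) * (B * D) $$ (i mod n, j mod n)"
    using bi bj A B C D by (simp add: scalar_prod_def)
  also have "\<dots> = kronecker (A * C) (B * D) $$ (i, j)"
    by (rule kronecker_index[symmetric, where m = m]) (use A B C D ij in auto)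
  finally show "(kronecker A B * kronecker C D) $$ (i, j) = kronecker (A * C) (B * D) $$ (i, j)" .
qed (use A B C D in auto)

lemma kronecker_transpose:
  assumes A: "A \<in> carrier_mat m m" and B: "B \<in> carrier_mat n n"
  shows "(kronecker A B)\<^sup>T = kronecker A\<^sup>T B\<^sup>T"
  by (rule eq_matI) (use A B in \<open>auto simp: kronecker_def divmod_bound\<close>)

lemma kronecker_one: "kronecker (1\<^sub>m m) (1\<^sub>m n) = (1\<^sub>m (m * n) :: 'k::field mat)"
proof (rule eq_matI)
  fix i j assume "i < dim_row (1\<^sub>m (m * n) :: 'k mat)" "j < dim_col (1\<^sub>m (m * n) :: 'k mat)"
  hence ij: "i < m * n" "j < m * n" by auto
  have "i = j \<longleftrightarrow> i div n = j div n \<and> i mod n = j mod n"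
    by (metis div_mult_mod_eq)
  thus "kronecker (1\<^sub>m m) (1\<^sub>m n) $$ (i, j) = (1\<^sub>m (m * n) :: 'k mat) $$ (i, j)"
    using ij divmod_bound[OF ij(1)] divmod_bound[OF ij(2)] by (auto simp: kronecker_def)
qed auto

lemma nondeg_orth_sum:
  assumes "nondeg_sym_form M" "nondeg_sym_form N" shows "nondeg_sym_form (orth_sum M N)"
proof -
  define m n where "m = dim_row M" "n = dim_row N"
  have M: "M \<in> carrier_mat m m" "M\<^sup>T = M" "det M \<noteq> 0" and N: "N \<in> carrier_mat n n" "N\<^sup>T = N" "det N \<noteq> 0"
    using assms unfolding nondeg_sym_form_def m_n_def by blast+
  obtain P Q where P: "P \<in> carrier_mat m m" "M * P = 1\<^sub>m m" and Q: "Q \<in> carrier_mat n n" "N * Q = 1\<^sub>m n"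
    using det_nonzero_right_inverse M N by metis
  have "orth_sum M N * orth_sum P Q = 1\<^sub>m (m + n)"
    using orth_sum_mult[OF M(1) N(1) P(1) Q(1)] P Q by (simp add: orth_sum_one)
  hence "det (orth_sum M N) \<noteq> 0"
    by (intro right_inverse_det_nonzero[of _ "m + n"]) (use M N P Q in auto)
  thus ?thesis using orth_sum_transpose[OF M(1) N(1)] M(1,2) N(1,2) by (simp add: nondeg_sym_form_def)
qed

lemma nondeg_kronecker:
  assumes "nondeg_sym_form M" "nondeg_sym_form N" shows "nondeg_sym_form (kronecker M N)"
proof -
  define m n where "m = dim_row M" "n = dim_row N"
  have M: "M \<in> carrier_mat m m" "M\<^sup>T = M" "det M \<noteq> 0" and N: "N \<in> carrier_mat n n" "N\<^sup>T = N" "det N \<noteq> 0"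
    using assms unfolding nondeg_sym_form_def m_n_def by blast+
  obtain P Q where P: "P \<in> carrier_mat m m" "M * P = 1\<^sub>m m" and Q: "Q \<in> carrier_mat n n" "N * Q = 1\<^sub>m n"
    using det_nonzero_right_inverse M N by metis
  have "kronecker M N * kronecker P Q = 1\<^sub>m (m * n)"
    using kronecker_mult[OF M(1) N(1) P(1) Q(1)] P Q by (simp add: kronecker_one)
  hence "det (kronecker M N) \<noteq> 0"
    by (intro right_inverse_det_nonzero[of _ "m * n"]) (use M N P Q in auto)
  thus ?thesis using kronecker_transpose[OF M(1) N(1)] M(1,2) N(1,2) by (simp add: nondeg_sym_form_def)
qed

lemma isometric_orth_sum:
  assumes "isometric M M'" "isometric N N'"
  shows "isometric (orth_sum M N) (orth_sum M' N')"
proof -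
  obtain m P where P: "P \<in> carrier_mat m m" "det P \<noteq> 0" "M' = P\<^sup>T * M * P"
    and M: "nondeg_sym_form M" and Mc: "M \<in> carrier_mat m m"
    using assms(1) by (rule isometricE)
  obtain n Q where Q: "Q \<in> carrier_mat n n" "det Q \<noteq> 0" "N' = Q\<^sup>T * N * Q"
    and N: "nondeg_sym_form N" and Nc: "N \<in> carrier_mat n n"
    using assms(2) by (rule isometricE)
  obtain P' Q' where P': "P' \<in> carrier_mat m m" "P * P' = 1\<^sub>m m" and Q': "Q' \<in> carrier_mat n n" "Q * Q' = 1\<^sub>m n"
    using det_nonzero_right_inverse P Q by metis
  have PT: "P\<^sup>T \<in> carrier_mat m m" and QT: "Q\<^sup>T \<in> carrier_mat n n" using P Q by simp_all
  have PM: "P\<^sup>T * M \<in> carrier_mat m m" and QN: "Q\<^sup>T * N \<in> carrier_mat n n" using PT QT Mc Nc by simp_all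
  have "(orth_sum P Q)\<^sup>T * orth_sum M N * orth_sum P Q = orth_sum M' N'"
    unfolding orth_sum_transpose[OF P(1) Q(1)] orth_sum_mult[OF PT QT Mc Nc] orth_sum_mult[OF PM QN P(1) Q(1)] P(3) Q(3) ..
  note eq = this[symmetric]
  have inv: "orth_sum P Q * orth_sum P' Q' = 1\<^sub>m (m + n)"
    using orth_sum_mult[OF P(1) Q(1) P'(1) Q'(1)] P' Q' by (simp add: orth_sum_one)
  have dim: "dim_row (orth_sum M N) = m + n" using Mc Nc by simp
  show ?thesis
    by (rule isometricI[OF nondeg_orth_sum[OF M N] _ _ _ eq, of "orth_sum P' Q'"])
       (simp_all only: dim inv orth_sum_carrier P(1) Q(1) P'(1) Q'(1))
qed

lemma isometric_kronecker:
  assumes "isometric M M'" "isometric N N'"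
  shows "isometric (kronecker M N) (kronecker M' N')"
proof -
  obtain m P where P: "P \<in> carrier_mat m m" "det P \<noteq> 0" "M' = P\<^sup>T * M * P"
    and M: "nondeg_sym_form M" and Mc: "M \<in> carrier_mat m m"
    using assms(1) by (rule isometricE)
  obtain n Q where Q: "Q \<in> carrier_mat n n" "det Q \<noteq> 0" "N' = Q\<^sup>T * N * Q"
    and N: "nondeg_sym_form N" and Nc: "N \<in> carrier_mat n n"
    using assms(2) by (rule isometricE)
  obtain P' Q' where P': "P' \<in> carrier_mat m m" "P * P' = 1\<^sub>m m" and Q': "Q' \<in> carrier_mat n n" "Q * Q' = 1\<^sub>m n"
    using det_nonzero_right_inverse P Q by metis
  have PT: "P\<^sup>T \<in> carrier_mat m m" and QT: "Q\<^sup>T \<in> carrier_mat n n" using P Q by simp_all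
  have PM: "P\<^sup>T * M \<in> carrier_mat m m" and QN: "Q\<^sup>T * N \<in> carrier_mat n n" using PT QT Mc Nc by simp_all
  have "(kronecker P Q)\<^sup>T * kronecker M N * kronecker P Q = kronecker M' N'"
    unfolding kronecker_transpose[OF P(1) Q(1)] kronecker_mult[OF PT QT Mc Nc] kronecker_mult[OF PM QN P(1) Q(1)] P(3) Q(3) ..
  note eq = this[symmetric]
  have inv: "kronecker P Q * kronecker P' Q' = 1\<^sub>m (m * n)"
    using kronecker_mult[OF P(1) Q(1) P'(1) Q'(1)] P' Q' by (simp add: kronecker_one)
  have dim: "dim_row (kronecker M N) = m * n" using Mc Nc by simp
  show ?thesis
    by (rule isometricI[OF nondeg_kronecker[OF M N] _ _ _ eq, of "kronecker P' Q'"])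
       (simp_all only: dim inv kronecker_carrier P(1) Q(1) P'(1) Q'(1))
qed

lemma orth_sum_commute:
  assumes "nondeg_sym_form M" "nondeg_sym_form N"
  shows "isometric (orth_sum M N) (orth_sum N M)"
proof -
  define m n where "m = dim_row M" "n = dim_row N"
  have c: "M \<in> carrier_mat m m" "N \<in> carrier_mat n n"
    using assms unfolding nondeg_sym_form_def m_n_def by blast+
  define s where "s i = (if i < n then i + m else i - n)" for i
  have s: "bij_betw s {..<m + n} {..<m + n}"
    by (rule bij_betwI[where g = "\<lambda>i. if i < m then i + n else i - m"]) (auto simp: s_def)
  have "orth_sum N M = mat (m + n) (m + n) (\<lambda>(i, j). orth_sum M N $$ (s i, s j))"
    by (rule eq_matI) (use c in \<open>auto simp: s_def orth_sum_def\<close>)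
  thus ?thesis
    using isometric_reindex[OF nondeg_orth_sum[OF assms], of "m + n" s] s by (simp add: m_n_def)
qed

lemma kronecker_commute:
  assumes "nondeg_sym_form M" "nondeg_sym_form N"
  shows "isometric (kronecker M N) (kronecker N M)"
proof -
  define m n where "m = dim_row M" "n = dim_row N"
  have c: "M \<in> carrier_mat m m" "N \<in> carrier_mat n n"
    using assms unfolding nondeg_sym_form_def m_n_def by blast+
  have bd: "b * q + a < p * q" if "a < q" "b < p" for a b p q :: nat
  proof -
    have "b * q + a < (b + 1) * q" using that by simp
    also have "\<dots> \<le> p * q" using that by (intro mult_right_mono) auto
    finally show ?thesis .
  qed
  define s where "s i = (i mod m) * n + i div m" for i
  have s1: "s i < m * n" "s i div n = i mod m" "s i mod n = i div m" if "i < m * n" for i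
  proof -
    have "i div m < n" "i mod m < m" using that divmod_bound[of i n m] by (auto simp: mult.commute)
    thus "s i < m * n" "s i div n = i mod m" "s i mod n = i div m"
      by (auto simp: s_def intro: bd)
  qed
  define t where "t i = (i mod n) * m + i div n" for i
  have t: "t i < m * n" "s (t i) = i" if "i < m * n" for i
  proof -
    have "i div n < m" "i mod n < n" using that divmod_bound[of i m n] by auto
    thus "t i < m * n" "s (t i) = i"
      using bd[of "i div n" m "i mod n" n] by (simp_all add: s_def t_def mult.commute)
  qed
  have "t (s i) = i" if "i < m * n" for i using s1[OF that] by (simp add: t_def)
  with s1 t have s: "bij_betw s {..<m * n} {..<m * n}"
    by (intro bij_betwI[where g = t]) auto
  have "kronecker N M = mat (m * n) (m * n) (\<lambda>(i, j). kronecker M N $$ (s i, s j))"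
  proof (rule eq_matI)
    fix i j assume "i < dim_row (mat (m * n) (m * n) (\<lambda>(i, j). kronecker M N $$ (s i, s j)))"
      "j < dim_col (mat (m * n) (m * n) (\<lambda>(i, j). kronecker M N $$ (s i, s j)))"
    hence ij: "i < m * n" "j < m * n" by auto
    thus "kronecker N M $$ (i, j) = mat (m * n) (m * n) (\<lambda>(i, j). kronecker M N $$ (s i, s j)) $$ (i, j)"
      using kronecker_index[OF c(2,1), of i j] kronecker_index[OF c, of "s i" "s j"] s1
      by (simp add: mult.commute)
  qed (use c in \<open>auto simp: mult.commute\<close>)
  thus ?thesis
    using isometric_reindex[OF nondeg_kronecker[OF assms], of "m * n" s] s by (simp add: m_n_def)
qed

lemma orth_sum_assoc:
  assumes "A \<in> carrier_mat a a" "B \<in> carrier_mat b b" "C \<in> carrier_mat c c"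
  shows "orth_sum (orth_sum A B) C = orth_sum A (orth_sum B C)"
  by (rule eq_matI) (use assms in \<open>auto simp: orth_sum_def\<close>)

lemma kronecker_assoc:
  assumes "A \<in> carrier_mat a a" "B \<in> carrier_mat b b" "C \<in> carrier_mat c c"
  shows "kronecker (kronecker A B) C = kronecker A (kronecker B C)"
proof (rule eq_matI)
  fix i j assume "i < dim_row (kronecker A (kronecker B C))" "j < dim_col (kronecker A (kronecker B C))"
  hence ij: "i < (a * b) * c" "j < (a * b) * c" and ij': "i < a * (b * c)" "j < a * (b * c)" 
    using assms by (auto simp: mult.assoc)
  note d = divmod_bound[OF ij(1)] divmod_bound[OF ij(2)]
    and d' = divmod_bound[OF ij'(1)] divmod_bound[OF ij'(2)]
  have e1: "x div (b * c) = x div c div b" "x mod (b * c) mod c = x mod c" for x :: nat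
    by (simp add: div_mult2_eq mult.commute[of b], simp add: mod_mod_cancel)
  have e2: "x mod (b * c) div c = x div c mod b" if "c > 0" for x :: nat
    using that by (simp add: mult.commute[of b] mod_mult2_eq)
  have c0: "c > 0" using ij' by (cases c) auto
  show "kronecker (kronecker A B) C $$ (i, j) = kronecker A (kronecker B C) $$ (i, j)"
    using ij d d' c0
    by (simp add: kronecker_index[where m = "a * b"] kronecker_index[OF assms(1) kronecker_carrier[OF assms(2,3)]]
        kronecker_index[OF assms(1,2)] kronecker_index[OF assms(2,3)] kronecker_index[OF kronecker_carrier[OF assms(1,2)] assms(3)] e1 e2 mult.assoc)
qed (use assms in \<open>auto simp: mult.assoc\<close>)

text \<open>
  Isometry classes of forms. As \<^const>\<open>isometric\<close> relates only symmetric non-degenerate matrices,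
  the class of any other matrix is an unspecified value.
\<close>

quotient_type (overloaded) 'k form_class = "'k::field mat" / partial: isometric
  by (rule part_equivp_isometric)

lemma isometric_eq:
  assumes "nondeg_sym_form M" "M = N" shows "isometric M N"
  using isometric_refl[OF assms(1)] assms(2) by simp

lemma isometric_nondeg: "isometric M N \<Longrightarrow> nondeg_sym_form M"
  by (simp add: isometric_def)

lemma nondeg_one: "nondeg_sym_form (1\<^sub>m n)"
  by (simp add: nondeg_sym_form_def)

lemma orth_sum_empty:
  assumes "M \<in> carrier_mat m m"
  shows "orth_sum (1\<^sub>m 0) M = M"
  unfolding orth_sum_def by (rule eq_matI) (simp_all add: carrier_matD[OF assms])

lemma kronecker_unit:
  assumes "M \<in> carrier_mat m m"
  shows "kronecker (1\<^sub>m 1) M = M"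
proof (rule eq_matI)
  fix i j assume "i < dim_row M" "j < dim_col M"
  hence ij: "i < m" "j < m" using assms by (simp_all add: carrier_matD[OF assms])
  hence "i < 1 * m" "j < 1 * m" by simp_all
  from kronecker_index[OF one_carrier_mat assms this]
  show "kronecker (1\<^sub>m 1) M $$ (i, j) = M $$ (i, j)" using ij by simp
qed (simp_all add: carrier_matD[OF assms])

lemma kronecker_empty:
  assumes "M \<in> carrier_mat m m"
  shows "kronecker (1\<^sub>m 0) M = 1\<^sub>m 0"
  by (rule eq_matI) (simp_all add: kronecker_def)

lemma kronecker_orth_sum:
  assumes "A \<in> carrier_mat a a" "B \<in> carrier_mat b b" "C \<in> carrier_mat c c"
  shows "kronecker (orth_sum A B) C = orth_sum (kronecker A C) (kronecker B C)"
proof (rule eq_matI)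
  fix i j assume "i < dim_row (orth_sum (kronecker A C) (kronecker B C))"
    "j < dim_col (orth_sum (kronecker A C) (kronecker B C))"
  hence ij: "i < (a + b) * c" "j < (a + b) * c" by (simp_all add: carrier_matD[OF assms(1)] carrier_matD[OF assms(2)] carrier_matD[OF assms(3)] distrib_right)
  have c0: "c > 0" using ij by (cases c) auto
  have *: "x div c < a \<longleftrightarrow> x < a * c" for x using c0 by (simp add: div_less_iff_less_mult)
  have **: "x div c - a = (x - a * c) div c" "(x - a * c) mod c = x mod c" if "\<not> x < a * c" for x
  proof -
    define y where "y = x - a * c"
    with that have y: "x = a * c + y" by simp
    show "x div c - a = (x - a * c) div c" "(x - a * c) mod c = x mod c" using c0 by (simp_all add: y)
  qed
  have ***: "x - a * c < b * c" if "x < (a + b) * c" "\<not> x < a * c" for x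
    using that by (simp add: distrib_right)
  have d: "dim_row A = a" "dim_col A = a" "dim_row B = b" "dim_col B = b" "dim_row C = c" "dim_col C = c"
    using assms by auto
  have lt: "x div c < a + b" if "x < (a + b) * c" for x using divmod_bound(1)[OF that] .
  have L: "kronecker (orth_sum A B) C $$ (i, j) = orth_sum A B $$ (i div c, j div c) * C $$ (i mod c, j mod c)"
    by (rule kronecker_index[OF orth_sum_carrier[OF assms(1,2)] assms(3) ij])
  have O: "orth_sum A B $$ (x, y) = (if x < a then if y < a then A $$ (x, y) else 0
      else if y < a then 0 else B $$ (x - a, y - a))" if "x < a + b" "y < a + b" for x y
    using that unfolding orth_sum_def by (subst index_mat_four_block) (simp_all add: d)
  have ij': "i < a * c + b * c" "j < a * c + b * c" using ij by (simp_all add: distrib_right)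
  have R: "orth_sum (kronecker A C) (kronecker B C) $$ (i, j) =
      (if i < a * c then if j < a * c then kronecker A C $$ (i, j) else 0
      else if j < a * c then 0 else kronecker B C $$ (i - a * c, j - a * c))"
    using ij' unfolding orth_sum_def by (subst index_mat_four_block) (simp_all add: d)
  note LO = L[unfolded O[OF lt[OF ij(1)] lt[OF ij(2)]] *]
  show "kronecker (orth_sum A B) C $$ (i, j) = orth_sum (kronecker A C) (kronecker B C) $$ (i, j)"
  proof (cases "i < a * c"; cases "j < a * c")
    assume "i < a * c" "j < a * c"
    thus ?thesis unfolding LO R by (simp add: kronecker_index[OF assms(1,3)])
  next
    assume h: "\<not> i < a * c" "\<not> j < a * c"
    show ?thesis unfolding LO R if_not_P[OF h(1)] if_not_P[OF h(2)] 
      kronecker_index[OF assms(2,3) ***[OF ij(1) h(1)] ***[OF ij(2) h(2)]]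
      **[OF h(1)] **[OF h(2)] ..
  qed (simp_all add: LO R)
qed (simp_all add: carrier_matD[OF assms(1)] carrier_matD[OF assms(2)] carrier_matD[OF assms(3)] distrib_right)

text \<open>Addition is orthogonal sum, multiplication is tensor product.\<close>

instantiation form_class :: (field) comm_semiring_1
begin

lift_definition zero_form_class :: "'a form_class" is "1\<^sub>m 0"
  by (rule isometric_refl[OF nondeg_one])

lift_definition one_form_class :: "'a form_class" is "1\<^sub>m 1"
  by (rule isometric_refl[OF nondeg_one])

lift_definition plus_form_class :: "'a form_class \<Rightarrow> 'a form_class \<Rightarrow> 'a form_class" is orth_sum
  by (rule isometric_orth_sum)

lift_definition times_form_class :: "'a form_class \<Rightarrow> 'a form_class \<Rightarrow> 'a form_class" is kronecker
  by (rule isometric_kronecker)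

instance
proof
  fix a b c :: "'a form_class"
  show "a + b + c = a + (b + c)"
    by transfer (rule isometric_eq, (intro nondeg_orth_sum isometric_nondeg; assumption),
      rule orth_sum_assoc; (rule nondeg_carrier, erule isometric_nondeg))
  show "a + b = b + a"
    by transfer (rule orth_sum_commute; erule isometric_nondeg)
  show "0 + a = a"
    by transfer (subst orth_sum_empty, (rule nondeg_carrier, erule isometric_nondeg), assumption)
  show "a * b * c = a * (b * c)"
    by transfer (rule isometric_eq, (intro nondeg_kronecker isometric_nondeg; assumption),
      rule kronecker_assoc; (rule nondeg_carrier, erule isometric_nondeg))
  show comm: "a * b = b * a" for a b :: "'a form_class"
    by transfer (rule kronecker_commute; erule isometric_nondeg)
  show "1 * a = a"
    by transfer (subst kronecker_unit, (rule nondeg_carrier, erule isometric_nondeg), assumption)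
  show z: "0 * a = 0"
    by transfer (subst kronecker_empty, (rule nondeg_carrier, erule isometric_nondeg),
      rule isometric_refl[OF nondeg_one])
  show "a * 0 = 0" unfolding comm[of a 0] by (rule z)
  show "(a + b) * c = a * c + b * c"
    by transfer (rule isometric_eq, (intro nondeg_kronecker nondeg_orth_sum isometric_nondeg; assumption),
      rule kronecker_orth_sum; (rule nondeg_carrier, erule isometric_nondeg))
  show "(0 :: 'a form_class) \<noteq> 1"
    by transfer (simp add: isometric_def)
qed

end

lift_definition form_rank :: "'k::field form_class \<Rightarrow> nat" is dim_row
  by (simp add: isometric_def)

lemma form_rank_simps [simp]:
  "form_rank 0 = 0" "form_rank 1 = 1" "form_rank (a + b) = form_rank a + form_rank b"
  by (transfer; simp)+

text \<open>
  The Grothendieck ring of the semiring of isometry classes: \<open>(a, b)\<close> stands for \<open>a - b\<close>.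
\<close>

definition gw_rel :: "'k::field form_class \<times> 'k form_class \<Rightarrow> 'k form_class \<times> 'k form_class \<Rightarrow> bool" where
  "gw_rel x y \<longleftrightarrow> (\<exists>u. fst x + snd y + u = fst y + snd x + u)"

lemma equivp_gw_rel: "equivp (gw_rel :: 'k::field form_class \<times> 'k form_class \<Rightarrow> _)"
proof (rule equivpI)
  show "reflp (gw_rel :: 'k form_class \<times> 'k form_class \<Rightarrow> _)"
    by (rule reflpI) (simp add: gw_rel_def)
  show "symp (gw_rel :: 'k form_class \<times> 'k form_class \<Rightarrow> _)"
    by (rule sympI) (auto simp: gw_rel_def dest: sym)
  show "transp (gw_rel :: 'k form_class \<times> 'k form_class \<Rightarrow> _)"
  proof (rule transpI)
    fix x y z :: "'k form_class \<times> 'k form_class"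
    assume "gw_rel x y" "gw_rel y z"
    then obtain u v where "fst x + snd y + u = fst y + snd x + u" "fst y + snd z + v = fst z + snd y + v"
      by (auto simp: gw_rel_def)
    hence "(fst x + snd y + u) + (fst y + snd z + v) = (fst y + snd x + u) + (fst z + snd y + v)" by simp
    hence "fst x + snd z + (fst y + snd y + u + v) = fst z + snd x + (fst y + snd y + u + v)"
      by (simp only: add_ac)
    thus "gw_rel x z" unfolding gw_rel_def by blast
  qed
qed

quotient_type (overloaded) 'k gw = "'k::field form_class \<times> 'k form_class" / gw_rel
  by (rule equivp_gw_rel)

instantiation gw :: (field) comm_ring_1
begin

lift_definition zero_gw :: "'a gw" is "(0, 0)" .
lift_definition one_gw :: "'a gw" is "(1, 0)" .

lift_definition plus_gw :: "'a gw \<Rightarrow> 'a gw \<Rightarrow> 'a gw" is "\<lambda>(a, b) (c, d). (a + c, b + d)"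
proof (clarsimp simp: gw_rel_def)
  fix a b a' b' c d c' d' u v :: "'a form_class"
  assume "a + b' + u = a' + b + u" "c + d' + v = c' + d + v"
  hence "(a + b' + u) + (c + d' + v) = (a' + b + u) + (c' + d + v)" by simp
  hence "a + c + (b' + d') + (u + v) = a' + c' + (b + d) + (u + v)" by (simp only: add_ac)
  thus "\<exists>u. a + c + (b' + d') + u = a' + c' + (b + d) + u" by blast
qed

lift_definition uminus_gw :: "'a gw \<Rightarrow> 'a gw" is "\<lambda>(a, b). (b, a)"
  by (clarsimp simp: gw_rel_def add_ac) (metis add.commute)

definition minus_gw :: "'a gw \<Rightarrow> 'a gw \<Rightarrow> 'a gw" where "minus_gw x y = x + - y"

lift_definition times_gw :: "'a gw \<Rightarrow> 'a gw \<Rightarrow> 'a gw"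
  is "\<lambda>(a, b) (c, d). (a * c + b * d, a * d + b * c)"
proof (clarsimp simp: gw_rel_def)
  fix a b a' b' c d c' d' u v :: "'a form_class"
  assume 1: "a + b' + u = a' + b + u" and 2: "c + d' + v = c' + d + v"
  have "(a + b' + u) * c + (a' + b + u) * d + a' * (c + d' + v) + b' * (c' + d + v)
      = (a' + b + u) * c + (a + b' + u) * d + a' * (c' + d + v) + b' * (c + d' + v)"
    using 1 2 by simp
  hence "a * c + b * d + (a' * d' + b' * c') + (b' * c + u * c + a' * d + u * d + a' * c + a' * v + b' * d + b' * v)
      = a' * c' + b' * d' + (a * d + b * c) + (b' * c + u * c + a' * d + u * d + a' * c + a' * v + b' * d + b' * v)"
    by (simp only: distrib_left distrib_right add_ac)
  thus "\<exists>u. a * c + b * d + (a' * d' + b' * c') + u = a' * c' + b' * d' + (a * d + b * c) + u" by blast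
qed

instance
proof
  fix a b c :: "'a gw"
  show "a + b + c = a + (b + c)" by transfer (auto simp: gw_rel_def add_ac)
  show "a + b = b + a" by transfer (auto simp: gw_rel_def add_ac)
  show "0 + a = a" by transfer (auto simp: gw_rel_def add_ac)
  show "- a + a = 0" by transfer (auto simp: gw_rel_def add_ac)
  show "a - b = a + - b" by (simp add: minus_gw_def)
  show "a * b * c = a * (b * c)" by transfer (auto simp: gw_rel_def algebra_simps)
  show "a * b = b * a" by transfer (auto simp: gw_rel_def algebra_simps)
  show "1 * a = a" by transfer (auto simp: gw_rel_def algebra_simps)
  show "(a + b) * c = a * c + b * c" by transfer (auto simp: gw_rel_def algebra_simps)
  show "(0 :: 'a gw) \<noteq> 1"
  proof transfer
    show "\<not> gw_rel ((0, 0) :: 'a form_class \<times> 'a form_class) (1, 0)"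
    proof
      assume "gw_rel ((0, 0) :: 'a form_class \<times> 'a form_class) (1, 0)"
      then obtain u :: "'a form_class" where "0 + 0 + u = 1 + 0 + u" by (auto simp: gw_rel_def)
      hence "form_rank (0 + 0 + u) = form_rank (1 + 0 + u)" by (rule arg_cong)
      thus False by simp
    qed
  qed
qed

end

definition gw_of_gram :: "'k::field mat \<Rightarrow> 'k gw" where
  "gw_of_gram M = abs_gw (abs_form_class M, 0)"

text \<open>The class \<open>\<langle>a\<rangle>\<close>, for \<open>a \<noteq> 0\<close>.\<close>

definition gw_unit :: "'k::field \<Rightarrow> 'k gw" where
  "gw_unit a = gw_of_gram (mat 1 1 (\<lambda>_. a))"


section \<open>Finite algebras, traces and classes of bilinear forms\<close>

text \<open>
  A \<open>k\<close>-algebra is a commutative ring \<open>A\<close> (as a record) together with its structure map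
  \<open>\<kappa> :: k \<Rightarrow> A\<close>; scalar multiplication by \<open>c\<close> is multiplication by \<open>\<kappa> c\<close>.
\<close>

definition alg_lincomb ::
    "('a, 'b) ring_scheme \<Rightarrow> ('k::field \<Rightarrow> 'a) \<Rightarrow> 'a list \<Rightarrow> 'k vec \<Rightarrow> 'a" where
  "alg_lincomb A \<kappa> bs c = finsum A (\<lambda>i. \<kappa> (c $ i) \<otimes>\<^bsub>A\<^esub> bs ! i) {..<length bs}"

definition alg_basis :: "('a, 'b) ring_scheme \<Rightarrow> ('k::field \<Rightarrow> 'a) \<Rightarrow> 'a list \<Rightarrow> bool" where
  "alg_basis A \<kappa> bs \<longleftrightarrow> set bs \<subseteq> carrier A \<and>
     (\<forall>x \<in> carrier A. \<exists>!c. c \<in> carrier_vec (length bs) \<and> x = alg_lincomb A \<kappa> bs c)"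

definition alg_coords ::
    "('a, 'b) ring_scheme \<Rightarrow> ('k::field \<Rightarrow> 'a) \<Rightarrow> 'a list \<Rightarrow> 'a \<Rightarrow> 'k vec" where
  "alg_coords A \<kappa> bs x =
     (THE c. c \<in> carrier_vec (length bs) \<and> x = alg_lincomb A \<kappa> bs c)"

definition some_alg_basis :: "('a, 'b) ring_scheme \<Rightarrow> ('k::field \<Rightarrow> 'a) \<Rightarrow> 'a list" where
  "some_alg_basis A \<kappa> = (SOME bs. alg_basis A \<kappa> bs)"

text \<open>The trace of the \<open>k\<close>-linear endomorphism \<open>y \<mapsto> x y\<close> of \<open>A\<close>.\<close>

definition alg_trace :: "('a, 'b) ring_scheme \<Rightarrow> ('k::field \<Rightarrow> 'a) \<Rightarrow> 'a \<Rightarrow> 'k" where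
  "alg_trace A \<kappa> x = (let bs = some_alg_basis A \<kappa> in
     \<Sum>i<length bs. alg_coords A \<kappa> bs (x \<otimes>\<^bsub>A\<^esub> bs ! i) $ i)"

text \<open>
  The class in \<open>GW(k)\<close> of a symmetric non-degenerate bilinear form \<open>B\<close> on the
  finite-dimensional \<open>k\<close>-space \<open>A\<close>. The isometry class of the Gram matrix does not depend on the basis.
\<close>

definition gw_of_form ::
    "('a, 'b) ring_scheme \<Rightarrow> ('k::field \<Rightarrow> 'a) \<Rightarrow> ('a \<Rightarrow> 'a \<Rightarrow> 'k) \<Rightarrow> 'k gw" where
  "gw_of_form A \<kappa> B = (let bs = some_alg_basis A \<kappa>; n = length bs in
     gw_of_gram (mat n n (\<lambda>(i, j). B (bs ! i) (bs ! j))))"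

text \<open>
  \<open>Tr\<^bsub>L/k\<^esub>\<langle>a\<rangle>\<close>: the form \<open>(x, y) \<mapsto> a x y\<close> over \<open>L\<close>, post-composed with the field trace.
\<close>

definition trace_gw_unit :: "('a, 'b) ring_scheme \<Rightarrow> ('k::field \<Rightarrow> 'a) \<Rightarrow> 'a \<Rightarrow> 'k gw" where
  "trace_gw_unit L \<kappa> a =
     gw_of_form L \<kappa> (\<lambda>x y. alg_trace L \<kappa> (a \<otimes>\<^bsub>L\<^esub> x \<otimes>\<^bsub>L\<^esub> y))"

text \<open>
  \<open>L/k\<close> is algebraic and the minimal polynomial \<open>p\<close> of every element has distinct roots in an
  algebraic closure.
\<close>

definition separable_extension :: "('a, 'b) ring_scheme \<Rightarrow> ('k::field \<Rightarrow> 'a) \<Rightarrow> bool" where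
  "separable_extension L \<kappa> \<longleftrightarrow>
     (\<forall>x \<in> carrier L. \<exists>p :: 'k poly.
        irreducible p \<and> coprime p (pderiv p) \<and>
        finsum L (\<lambda>i. \<kappa> (Polynomial.coeff p i) \<otimes>\<^bsub>L\<^esub> x [^]\<^bsub>L\<^esub> i) {..Polynomial.degree p} = \<zero>\<^bsub>L\<^esub>)"


section \<open>Polynomial rings, closed points and charts\<close>

text \<open>
  Polynomials in the variables \<open>x\<^sub>0, x\<^sub>1, \<dots>\<close>; the ring \<open>k[x\<^sub>0, \<dots>, x\<^bsub>n-1\<^esub>]\<close> is cut out by its carrier.
\<close>

type_synonym 'k mpoly = "(nat \<Rightarrow>\<^sub>0 nat) \<Rightarrow>\<^sub>0 'k"

definition Var :: "nat \<Rightarrow> 'k::comm_ring_1 mpoly" where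
  "Var i = Poly_Mapping.single (Poly_Mapping.single i 1) 1"

definition Const :: "'k::comm_ring_1 \<Rightarrow> 'k mpoly" where
  "Const c = Poly_Mapping.single 0 c"

definition mpoly_ring :: "nat \<Rightarrow> 'k::comm_ring_1 mpoly ring" where
  "mpoly_ring n = \<lparr>carrier = {p. \<forall>m \<in> Poly_Mapping.keys p. Poly_Mapping.keys m \<subseteq> {..<n}},
     mult = (*), one = 1, zero = 0, add = (+)\<rparr>"

definition mpoly_subst ::
    "('k::comm_ring_1 \<Rightarrow> 'a::comm_ring_1) \<Rightarrow> (nat \<Rightarrow> 'a) \<Rightarrow> 'k mpoly \<Rightarrow> 'a" where
  "mpoly_subst \<phi> \<sigma> p = (\<Sum>m \<in> Poly_Mapping.keys p. \<phi> (Poly_Mapping.lookup p m) *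
     (\<Prod>i \<in> Poly_Mapping.keys m. \<sigma> i ^ Poly_Mapping.lookup m i))"

definition partial_deriv :: "nat \<Rightarrow> 'k::comm_ring_1 mpoly \<Rightarrow> 'k mpoly" where
  "partial_deriv l p = (\<Sum>m \<in> Poly_Mapping.keys p.
     Poly_Mapping.single (m - Poly_Mapping.single l 1)
       (of_nat (Poly_Mapping.lookup m l) * Poly_Mapping.lookup p m))"

definition jacobian_det :: "nat \<Rightarrow> (nat \<Rightarrow> 'k::comm_ring_1 mpoly) \<Rightarrow> 'k mpoly" where
  "jacobian_det n f = det (mat n n (\<lambda>(i, l). partial_deriv l (f i)))"

definition hom_component :: "nat \<Rightarrow> 'k::comm_ring_1 mpoly \<Rightarrow> 'k mpoly" where
  "hom_component d p =
     (\<Sum>m \<in> {m \<in> Poly_Mapping.keys p. (\<Sum>i \<in> Poly_Mapping.keys m. Poly_Mapping.lookup m i) = d}.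
        Poly_Mapping.single m (Poly_Mapping.lookup p m))"

text \<open>
  The points of \<open>\<P>\<^sup>n\<close> over \<open>k\<close> are the homogeneous primes of \<open>k[c\<^sub>0, \<dots>, c\<^sub>n]\<close> not containing the
  irrelevant ideal; the closed points are the maximal ones.
\<close>

definition proj_point :: "nat \<Rightarrow> 'k::field mpoly set \<Rightarrow> bool" where
  "proj_point n s \<longleftrightarrow> primeideal s (mpoly_ring (Suc n)) \<and>
     (\<forall>p \<in> s. \<forall>d. hom_component d p \<in> s) \<and> (\<exists>l \<le> n. Var l \<notin> s)"

definition proj_closed_point :: "nat \<Rightarrow> 'k::field mpoly set \<Rightarrow> bool" where
  "proj_closed_point n s \<longleftrightarrow> proj_point n s \<and> (\<forall>t. proj_point n t \<and> s \<subseteq> t \<longrightarrow> t = s)"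

text \<open>
  Restriction to the chart \<open>c\<^sub>j \<noteq> 0\<close>, whose coordinates \<open>x\<^sub>0, x\<^sub>1, \<dots>\<close> are the \<open>c\<^sub>l / c\<^sub>j\<close>, \<open>l \<noteq> j\<close>,
  in increasing order of \<open>l\<close>. A form \<open>q\<close> of degree \<open>d\<close> becomes \<open>q / c\<^sub>j\<^sup>d\<close>; the homogeneous prime of
  a closed point of the chart becomes its maximal ideal.
\<close>

definition dehom :: "nat \<Rightarrow> 'k::field mpoly \<Rightarrow> 'k mpoly" where
  "dehom j = mpoly_subst Const (\<lambda>l. if l < j then Var l else if l = j then 1 else Var (l - 1))"

definition chart_ideal :: "nat \<Rightarrow> 'k::field mpoly set \<Rightarrow> 'k mpoly set" where
  "chart_ideal j s = dehom j ` s"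

definition residue_field :: "nat \<Rightarrow> 'k::field mpoly set \<Rightarrow> 'k mpoly set ring" where
  "residue_field n \<mm> = mpoly_ring n Quot \<mm>"

definition residue_class :: "nat \<Rightarrow> 'k::field mpoly set \<Rightarrow> 'k mpoly \<Rightarrow> 'k mpoly set" where
  "residue_class n \<mm> p = \<mm> +>\<^bsub>mpoly_ring n\<^esub> p"


section \<open>The local degree\<close>

text \<open>\<open>k[x\<^sub>0, \<dots>, x\<^bsub>n-1\<^esub>]\<close> localised at the prime \<open>\<mm>\<close>, inside the fraction field.\<close>

definition localization :: "nat \<Rightarrow> 'k::field mpoly set \<Rightarrow> 'k mpoly fract ring" where
  "localization n \<mm> =
     \<lparr>carrier = {Fract a b | a b. a \<in> carrier (mpoly_ring n) \<and> b \<in> carrier (mpoly_ring n) - \<mm>},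
      mult = (*), one = 1, zero = 0, add = (+)\<rparr>"

definition local_ideal ::
    "nat \<Rightarrow> 'k::field mpoly set \<Rightarrow> (nat \<Rightarrow> 'k mpoly) \<Rightarrow> 'k mpoly fract set" where
  "local_ideal n \<mm> f = Idl\<^bsub>localization n \<mm>\<^esub> ((\<lambda>i. Fract (f i) 1) ` {..<n})"

definition local_algebra ::
    "nat \<Rightarrow> 'k::field mpoly set \<Rightarrow> (nat \<Rightarrow> 'k mpoly) \<Rightarrow> 'k mpoly fract set ring" where
  "local_algebra n \<mm> f = localization n \<mm> Quot local_ideal n \<mm> f"

definition local_class ::
    "nat \<Rightarrow> 'k::field mpoly set \<Rightarrow> (nat \<Rightarrow> 'k mpoly) \<Rightarrow> 'k mpoly \<Rightarrow> 'k mpoly fract set" where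
  "local_class n \<mm> f p = local_ideal n \<mm> f +>\<^bsub>localization n \<mm>\<^esub> Fract p 1"

text \<open>
  \<open>k[X, Y]\<close> is represented as \<open>k[X][Y]\<close>, i.e. as \<open>'k mpoly mpoly\<close>: thus \<open>f(X)\<close> is \<open>Const f\<close>,
  \<open>f(Y)\<close> is \<open>Poly_Mapping.map Const f\<close>, \<open>X\<^sub>i\<close> is \<open>Const (Var i)\<close> and \<open>Y\<^sub>i\<close> is \<open>Var i\<close>.
\<close>

definition difference_matrix ::
    "nat \<Rightarrow> (nat \<Rightarrow> 'k::field mpoly) \<Rightarrow> (nat \<Rightarrow> nat \<Rightarrow> 'k mpoly mpoly) \<Rightarrow> bool" where
  "difference_matrix n f \<Delta> \<longleftrightarrow>
     (\<forall>i<n. \<forall>j<n. \<Delta> i j \<in> carrier (mpoly_ring n) \<and>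
        (\<forall>m. Poly_Mapping.lookup (\<Delta> i j) m \<in> carrier (mpoly_ring n))) \<and>
     (\<forall>j<n. Const (f j) - Poly_Mapping.map Const (f j)
        = (\<Sum>i<n. \<Delta> i j * (Const (Var i) - Var i)))"

definition bezoutian :: "nat \<Rightarrow> (nat \<Rightarrow> 'k::field mpoly) \<Rightarrow> 'k mpoly mpoly" where
  "bezoutian n f =
     (let \<Delta> = (SOME \<Delta>. difference_matrix n f \<Delta>) in det (mat n n (\<lambda>(i, j). \<Delta> i j)))"

text \<open>
  Writing the Bezoutian as the sum of the products of its coefficients \<open>D\<^sub>m(X)\<close> with the monomials
  \<open>Y\<^sup>m\<close>, its image in \<open>A \<otimes> A\<close> is the sum of the \<open>D\<^sub>m \<otimes> x\<^sup>m\<close>. The last clause below is therefore the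
  condition \<open>\<Sum> \<eta>(a\<^sub>l) b\<^sub>l = 1\<close>, whose left-hand side does not depend on how the tensor is written.
\<close>

definition scheja_storch_functional ::
    "nat \<Rightarrow> 'k::field mpoly set \<Rightarrow> (nat \<Rightarrow> 'k mpoly) \<Rightarrow> ('k mpoly fract set \<Rightarrow> 'k) \<Rightarrow> bool" where
  "scheja_storch_functional n \<mm> f \<eta> \<longleftrightarrow>
     (let A = local_algebra n \<mm> f; \<pi> = local_class n \<mm> f; D = bezoutian n f in
      \<eta> \<in> extensional (carrier A) \<and>
      (\<forall>x \<in> carrier A. \<forall>y \<in> carrier A. \<eta> (x \<oplus>\<^bsub>A\<^esub> y) = \<eta> x + \<eta> y) \<and>
      (\<forall>c. \<forall>x \<in> carrier A. \<eta> (\<pi> (Const c) \<otimes>\<^bsub>A\<^esub> x) = c * \<eta> x) \<and>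
      finsum A (\<lambda>m. \<pi> (Const (\<eta> (\<pi> (Poly_Mapping.lookup D m)))) \<otimes>\<^bsub>A\<^esub> \<pi> (Poly_Mapping.single m 1))
        (Poly_Mapping.keys D) = \<one>\<^bsub>A\<^esub>)"

text \<open>
  The local degree at the closed point \<open>\<mm>\<close> of the map \<open>f\<close> from affine \<open>n\<close>-space to itself, as the
  class of the Scheja--Storch form.
\<close>

definition local_degree ::
    "nat \<Rightarrow> 'k::field mpoly set \<Rightarrow> (nat \<Rightarrow> 'k mpoly) \<Rightarrow> 'k gw" where
  "local_degree n \<mm> f =
     (let A = local_algebra n \<mm> f; \<eta> = (THE \<eta>. scheja_storch_functional n \<mm> f \<eta>) in
      gw_of_form A (\<lambda>c. local_class n \<mm> f (Const c)) (\<lambda>x y. \<eta> (x \<otimes>\<^bsub>A\<^esub> y)))"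


section \<open>Circles and their tangency cones\<close>

text \<open>
  A circle defined over \<open>k\<close> is given by homogeneous coordinates \<open>p 0, \<dots>, p 3\<close>, standing for the
  conic \<open>p\<^sub>0 (x\<^sup>2 + y\<^sup>2) + z (p\<^sub>1 x + p\<^sub>2 y + p\<^sub>3 z) = 0\<close>. The following three are meaningful if
  \<open>p 0 \<noteq> 0\<close>; the center is \<open>[center_x p : center_y p : 1]\<close>.
\<close>

definition center_x :: "(nat \<Rightarrow> 'k::field) \<Rightarrow> 'k" where
  "center_x p = - (p 1 / p 0) / 2"

definition center_y :: "(nat \<Rightarrow> 'k::field) \<Rightarrow> 'k" where
  "center_y p = - (p 2 / p 0) / 2"

definition radius_sq :: "(nat \<Rightarrow> 'k::field) \<Rightarrow> 'k" where
  "radius_sq p = (center_x p)\<^sup>2 + (center_y p)\<^sup>2 - p 3 / p 0"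

text \<open>The equation, in the coordinates \<open>c\<^sub>0, \<dots>, c\<^sub>3\<close>, of the cone of circles tangent to \<open>p\<close>.\<close>

definition tangency_cone :: "(nat \<Rightarrow> 'k::field) \<Rightarrow> 'k mpoly" where
  "tangency_cone p =
     (let a = center_x p; b = center_y p; r2 = radius_sq p;
          X = Var 1 + Const (2 * a) * Var 0;
          Y = Var 2 + Const (2 * b) * Var 0;
          Z = Var 3 - Const (a\<^sup>2 + b\<^sup>2 - r2) * Var 0
      in (Const a * X + Const b * Y + Z)\<^sup>2 - Const r2 * (X\<^sup>2 + Y\<^sup>2))"

text \<open>\<open>p\<close> lies on the cone of \<open>p'\<close>; this relation is symmetric, and every circle is tangent to itself.\<close>

definition tangent_circles :: "(nat \<Rightarrow> 'k::field) \<Rightarrow> (nat \<Rightarrow> 'k) \<Rightarrow> bool" where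
  "tangent_circles p p' \<longleftrightarrow> mpoly_subst (\<lambda>c. c) p (tangency_cone p') = 0"

definition common_tangent_circles :: "(nat \<Rightarrow> nat \<Rightarrow> 'k::field) \<Rightarrow> 'k mpoly set set" where
  "common_tangent_circles C =
     {s. proj_closed_point 3 s \<and> (\<forall>i<3. tangency_cone (C i) \<in> s)}"

text \<open>
  The circle \<open>s\<close> is non-degenerate with radius squared \<open>0\<close>: its radius squared is
  \<open>(c\<^sub>1\<^sup>2 + c\<^sub>2\<^sup>2 - 4 c\<^sub>0 c\<^sub>3) / (2 c\<^sub>0)\<^sup>2\<close>.
\<close>

definition point_circle :: "'k::field mpoly set \<Rightarrow> bool" where
  "point_circle s \<longleftrightarrow>
     Var 0 \<notin> s \<and> (Var 1)\<^sup>2 + (Var 2)\<^sup>2 - Const 4 * Var 0 * Var 3 \<in> s"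

definition circle_chart_map :: "(nat \<Rightarrow> nat \<Rightarrow> 'k::field) \<Rightarrow> nat \<Rightarrow> nat \<Rightarrow> 'k mpoly" where
  "circle_chart_map C j i = dehom j (tangency_cone (C i))"

text \<open>\<open>k(s)\<close>, computed in a chart \<open>j\<close> containing \<open>s\<close>, with its structure map.\<close>

definition point_field :: "'k::field mpoly set \<Rightarrow> nat \<Rightarrow> 'k mpoly set ring" where
  "point_field s j = residue_field 3 (chart_ideal j s)"

definition point_field_map :: "'k::field mpoly set \<Rightarrow> nat \<Rightarrow> 'k \<Rightarrow> 'k mpoly set" where
  "point_field_map s j c = residue_class 3 (chart_ideal j s) (Const c)"

definition Vol :: "(nat \<Rightarrow> nat \<Rightarrow> 'k::field) \<Rightarrow> 'k mpoly set \<Rightarrow> nat \<Rightarrow> 'k mpoly set" where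
  "Vol C s j =
     residue_class 3 (chart_ideal j s) ((- 1) ^ j * jacobian_det 3 (circle_chart_map C j))"

text \<open>
  The factor \<open>\<langle>(-1)\<^sup>j\<rangle>\<close>, like the sign in \<^const>\<open>Vol\<close>, compares the orientation of the \<open>j\<close>-th chart with
  the relative orientation of \<open>O(2)\<^sup>3\<close>; it makes the index independent of \<open>j\<close>.
\<close>

definition local_index :: "(nat \<Rightarrow> nat \<Rightarrow> 'k::field) \<Rightarrow> 'k mpoly set \<Rightarrow> nat \<Rightarrow> 'k gw" where
  "local_index C s j =
     gw_unit ((- 1) ^ j) * local_degree 3 (chart_ideal j s) (circle_chart_map C j)"

end

theory Submission
  imports Defs
begin

text \<open>
  At a common tangent circle \<open>s\<close> the gradients of the three cones are independent, so the Jacobian \<open>J\<close>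
  is a unit of \<open>k(s)\<close>. The Bezoutian of the system restricts to \<open>J\<close> on the diagonal and is annihilated
  by all \<open>h(X) - h(Y)\<close> modulo the system. Applying to its variables \<open>Y\<close> a linear section of
  \<open>k[x] \<rightarrow> k(s)\<close> shows that the local algebra is \<open>k(s)\<close> itself; applying the trace of \<open>k(s)/k\<close>
  to either set of variables shows that the Scheja--Storch functional is \<open>x \<mapsto> Tr(x / J)\<close>. Its form
  \<open>Tr(x y / J)\<close> is isometric to \<open>Tr(J x y)\<close>, and the signs \<open>(-1)\<^sup>j\<close> agree on both sides.
\<close>

section \<open>Polynomials\<close>

text \<open>The local algebra lives inside a fraction field, the residue field is a quotient of the
  polynomial ring, and the basis of each is an arbitrary choice. The obstacle is to compare them
  without knowing dimensions in advance. Therefore both are presented as quotients of the ring of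
  all polynomials by one ideal \<open>M\<close>, and everything is a congruence modulo
  \<open>M\<close>. Nondegeneracy of the trace form also comes from the Bezoutian: if Tr(x w) = 0
  for all x, then w J = 0. Independence of the gradients is the geometric input. If r_i = 0, then
  q_i is the square of a linear form and its gradient vanishes on the cone. If the three circles
  pass through a common point, the point circle there is tangent to all of them, and the three
  gradients at it are multiples of the gradient of D = c_1^2 + c_2^2 - 4 c_0 c_3. These two
  situations are excluded by \<open>genuine_cones\<close> and \<open>not_point\<close>. A degenerate
  circle with D = 0 cannot be tangent to all three, because the centers are not collinear. All
  charts are handled at once through the four homogeneous partial derivatives.\<close>

lemma poly_mapping_sum_single:
  "(p :: 'a \<Rightarrow>\<^sub>0 'b::comm_monoid_add) =
     (\<Sum>m \<in> Poly_Mapping.keys p. Poly_Mapping.single m (Poly_Mapping.lookup p m))"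
  by (rule poly_mapping_eqI)
     (auto simp: lookup_sum lookup_single when_def sum.delta in_keys_iff)

text \<open>Zero is the single monomial with coefficient 0, so additive statements only have to be
  checked on monomials and sums.\<close>

lemma poly_mapping_single_induct [case_names single add]:
  fixes p :: "'a \<Rightarrow>\<^sub>0 'b::comm_monoid_add"
  assumes "\<And>m c. P (Poly_Mapping.single m c)" and "\<And>p q. P p \<Longrightarrow> P q \<Longrightarrow> P (p + q)"
  shows "P p"
proof -
  have "P (\<Sum>m \<in> S. Poly_Mapping.single m (Poly_Mapping.lookup p m))" if "finite S" for S
    using that
  proof (induction S)
    case empty
    have "P (Poly_Mapping.single undefined 0)" by (rule assms)
    thus ?case by simp
  next
    case (insert x F)
    thus ?case using assms by simp
  qed
  from this[OF finite_keys[of p]] show ?thesis by (simp flip: poly_mapping_sum_single)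
qed

lemma Const_0 [simp]: "Const 0 = 0"
  and Const_1 [simp]: "Const 1 = 1"
  and Const_add: "Const (a + b) = Const a + Const b"
  and Const_mult: "Const (a * b) = Const a * Const b"
  and Const_uminus: "Const (- a) = - Const a"
  and Const_diff: "Const (a - b) = Const a - Const b"
  by (simp_all add: Const_def single_add mult_single single_uminus single_diff)

lemma Const_power: "Const (a ^ i) = Const a ^ i"
  by (induction i) (simp_all add: Const_mult)

lemma Const_numeral: "Const (numeral v) = numeral v"
  by (simp add: Const_def)

lemma Const_sum: "Const (sum f S) = (\<Sum>i\<in>S. Const (f i))"
  by (induction S rule: infinite_finite_induct) (simp_all add: Const_add)

lemma Const_mult_single: "Const c * Poly_Mapping.single m d = Poly_Mapping.single m (c * d)"
  by (simp add: Const_def mult_single)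

lemma single_eq_Const_Var:
  "Poly_Mapping.single m (c :: 'a::comm_ring_1) =
     Const c * (\<Prod>i \<in> Poly_Mapping.keys m. Var i ^ Poly_Mapping.lookup m i)"
proof -
  have pow: "(Var i :: 'a mpoly) ^ e = Poly_Mapping.single (Poly_Mapping.single i e) 1" for i e
    by (induction e) (simp_all add: Var_def mult_single flip: single_add)
  have "(\<Prod>i \<in> S. Poly_Mapping.single (f i) (1::'a)) = Poly_Mapping.single (\<Sum>i\<in>S. f i) 1" if "finite S"
    for S :: "nat set" and f :: "nat \<Rightarrow> nat \<Rightarrow>\<^sub>0 nat"
    using that by (induction S) (simp_all add: mult_single)
  from this[OF finite_keys, of "\<lambda>i. Poly_Mapping.single i (Poly_Mapping.lookup m i)" m]
  have "(\<Prod>i \<in> Poly_Mapping.keys m. Var i ^ Poly_Mapping.lookup m i) = Poly_Mapping.single m (1::'a)"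
    by (simp add: pow flip: poly_mapping_sum_single)
  thus ?thesis by (simp add: Const_mult_single)
qed

subsection \<open>The rings \<open>k[x\<^sub>0, \<dots>, x\<^bsub>n-1\<^esub>]\<close>\<close>

abbreviation polys :: "nat \<Rightarrow> 'k::comm_ring_1 mpoly set" where
  "polys n \<equiv> carrier (mpoly_ring n)"

lemma polys_iff: "p \<in> polys n \<longleftrightarrow> (\<forall>m \<in> Poly_Mapping.keys p. Poly_Mapping.keys m \<subseteq> {..<n})"
  by (simp add: mpoly_ring_def)

lemma mpoly_ring_simps [simp]:
  "p \<otimes>\<^bsub>mpoly_ring n\<^esub> q = p * q" "p \<oplus>\<^bsub>mpoly_ring n\<^esub> q = p + q"
  "\<one>\<^bsub>mpoly_ring n\<^esub> = 1" "\<zero>\<^bsub>mpoly_ring n\<^esub> = 0"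
  by (simp_all add: mpoly_ring_def)

lemma polys_add [intro, simp]: "p \<in> polys n \<Longrightarrow> q \<in> polys n \<Longrightarrow> p + q \<in> polys n"
  using keys_add[of p q] unfolding polys_iff by blast

lemma polys_uminus [intro, simp]: "p \<in> polys n \<Longrightarrow> - p \<in> polys n"
  by (simp add: polys_iff in_keys_iff)

lemma polys_diff [intro, simp]: "p \<in> polys n \<Longrightarrow> q \<in> polys n \<Longrightarrow> p - q \<in> polys n"
  using polys_add[of p n "- q"] by simp

lemma polys_mult [intro, simp]: "p \<in> polys n \<Longrightarrow> q \<in> polys n \<Longrightarrow> p * q \<in> polys n"
proof -
  assume p: "p \<in> polys n" and q: "q \<in> polys n"
  show ?thesis
    unfolding polys_iff
  proof
    fix m assume "m \<in> Poly_Mapping.keys (p * q)"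
    then obtain a b where ab: "a \<in> Poly_Mapping.keys p" "b \<in> Poly_Mapping.keys q" "m = a + b"
      using keys_mult[of p q] by blast
    hence "Poly_Mapping.keys a \<subseteq> {..<n}" "Poly_Mapping.keys b \<subseteq> {..<n}"
      using p q by (auto simp: polys_iff)
    thus "Poly_Mapping.keys m \<subseteq> {..<n}"
      using keys_add[of a b] ab(3) by blast
  qed
qed

lemma polys_Const [intro, simp]: "Const c \<in> polys n"
  by (simp add: polys_iff Const_def)

lemma polys_Var [intro, simp]: "i < n \<Longrightarrow> Var i \<in> polys n"
  by (simp add: polys_iff Var_def)

lemma polys_0 [intro, simp]: "0 \<in> polys n" and polys_1 [intro, simp]: "1 \<in> polys n"
  using polys_Const[of 0 n] polys_Const[of 1 n] by simp_all

lemma polys_numeral [intro, simp]: "numeral v \<in> polys n"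
  using polys_Const[of "numeral v" n] by (simp add: Const_numeral)

lemma polys_power [intro, simp]: "p \<in> polys n \<Longrightarrow> p ^ e \<in> polys n"
  by (induction e) simp_all

lemma polys_sum [intro]: "(\<And>i. i \<in> S \<Longrightarrow> f i \<in> polys n) \<Longrightarrow> sum f S \<in> polys n"
  by (induction S rule: infinite_finite_induct) simp_all

lemma polys_prod [intro]: "(\<And>i. i \<in> S \<Longrightarrow> f i \<in> polys n) \<Longrightarrow> prod f S \<in> polys n"
  by (induction S rule: infinite_finite_induct) simp_all

lemma polys_induct [consumes 1, case_names Const Var add mult]:
  assumes "p \<in> polys n"
    and "\<And>c. P (Const c)" "\<And>i. i < n \<Longrightarrow> P (Var i)"
    and "\<And>p q. p \<in> polys n \<Longrightarrow> q \<in> polys n \<Longrightarrow> P p \<Longrightarrow> P q \<Longrightarrow> P (p + q)"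
    and "\<And>p q. p \<in> polys n \<Longrightarrow> q \<in> polys n \<Longrightarrow> P p \<Longrightarrow> P q \<Longrightarrow> P (p * q)"
  shows "P p"
proof -
  define Q where "Q p \<longleftrightarrow> p \<in> polys n \<and> P p" for p
  have Q: "Q (Const c)" "i < n \<Longrightarrow> Q (Var i)" "Q p \<Longrightarrow> Q q \<Longrightarrow> Q (p + q)" "Q p \<Longrightarrow> Q q \<Longrightarrow> Q (p * q)"
    for c i p q using assms(2-5) polys_Const polys_Var polys_add polys_mult unfolding Q_def by metis+
  have Q01: "Q 0" "Q 1" using Q(1)[of 0] Q(1)[of 1] by simp_all
  have pow: "Q p \<Longrightarrow> Q (p ^ e)" for p e by (induction e) (simp_all add: Q Q01)
  have prd: "(\<And>i. i \<in> S \<Longrightarrow> Q (f i)) \<Longrightarrow> Q (prod f S)" for S :: "nat set" and f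
    by (induction S rule: infinite_finite_induct) (simp_all add: Q Q01)
  have sm: "(\<And>i. i \<in> S \<Longrightarrow> Q (f i)) \<Longrightarrow> Q (sum f S)" for S :: "(nat \<Rightarrow>\<^sub>0 nat) set" and f
    by (induction S rule: infinite_finite_induct) (simp_all add: Q Q01)
  have "Q (\<Sum>m \<in> Poly_Mapping.keys p. Poly_Mapping.single m (Poly_Mapping.lookup p m))"
  proof (rule sm)
    fix m assume m: "m \<in> Poly_Mapping.keys p"
    hence "Poly_Mapping.keys m \<subseteq> {..<n}" using assms(1) by (simp add: polys_iff)
    thus "Q (Poly_Mapping.single m (Poly_Mapping.lookup p m))"
      unfolding single_eq_Const_Var[of m] by (intro Q pow prd) auto
  qed
  thus ?thesis by (simp add: Q_def flip: poly_mapping_sum_single)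
qed

lemma cring_mpoly_ring: "cring (mpoly_ring n)"
proof (rule cringI)
  show "abelian_group (mpoly_ring n)"
  proof (rule abelian_groupI)
    fix x assume "x \<in> polys n"
    thus "\<exists>y\<in>polys n. y \<oplus>\<^bsub>mpoly_ring n\<^esub> x = \<zero>\<^bsub>mpoly_ring n\<^esub>"
      by (intro bexI[of _ "- x"]) auto
  qed (auto simp: add_ac)
  show "Group.comm_monoid (mpoly_ring n)"
    by unfold_locales (auto simp: mult_ac)
qed (auto simp: distrib_right)

subsection \<open>Substitution\<close>

text \<open>The coefficient map is kept abstract to serve three targets: substitution of polynomials
  (\<open>Const_eval\<close>), evaluation in the coefficient ring (\<open>id_eval\<close>), which on
  k[X][Y] includes the restriction to the diagonal, and values in the function field
  (\<open>generic\<close>).\<close>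

locale mpoly_eval =
  fixes \<phi> :: "'k::comm_ring_1 \<Rightarrow> 'a::comm_ring_1" and \<sigma> :: "nat \<Rightarrow> 'a"
  assumes phi_0: "\<phi> 0 = 0" and phi_1: "\<phi> 1 = 1"
    and phi_add: "\<phi> (a + b) = \<phi> a + \<phi> b" and phi_mult: "\<phi> (a * b) = \<phi> a * \<phi> b"
begin

abbreviation "ev \<equiv> mpoly_subst \<phi> \<sigma>"

lemma subst_single:
  "ev (Poly_Mapping.single m c) = \<phi> c * (\<Prod>i \<in> Poly_Mapping.keys m. \<sigma> i ^ Poly_Mapping.lookup m i)"
  by (cases "c = 0") (simp_all add: mpoly_subst_def phi_0)

lemma subst_superset:
  assumes "finite S" "Poly_Mapping.keys p \<subseteq> S"
  shows "ev p = (\<Sum>m \<in> S. \<phi> (Poly_Mapping.lookup p m) * (\<Prod>i \<in> Poly_Mapping.keys m. \<sigma> i ^ Poly_Mapping.lookup m i))"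
  unfolding mpoly_subst_def
  by (rule sum.mono_neutral_left) (use assms in \<open>auto simp: in_keys_iff phi_0\<close>)

lemma subst_add: "ev (p + q) = ev p + ev q"
proof -
  let ?S = "Poly_Mapping.keys p \<union> Poly_Mapping.keys q"
  have "Poly_Mapping.keys (p + q) \<subseteq> ?S" by (rule keys_add)
  thus ?thesis
    by (simp add: subst_superset[of ?S] lookup_add phi_add distrib_right sum.distrib)
qed

lemma prod_keys_superset:
  assumes "finite S" "Poly_Mapping.keys m \<subseteq> S"
  shows "(\<Prod>i \<in> Poly_Mapping.keys m. \<sigma> i ^ Poly_Mapping.lookup m i) = (\<Prod>i \<in> S. \<sigma> i ^ Poly_Mapping.lookup m i)"
  by (rule prod.mono_neutral_left) (use assms in \<open>auto simp: in_keys_iff\<close>)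

lemma subst_mult: "ev (p * q) = ev p * ev q"
proof (induction p rule: poly_mapping_single_induct)
  case (single m c)
  show ?case
  proof (induction q rule: poly_mapping_single_induct)
    case (single m' c')
    let ?S = "Poly_Mapping.keys m \<union> Poly_Mapping.keys m'"
    have "Poly_Mapping.keys (m + m') \<subseteq> ?S" by (rule keys_add)
    hence "(\<Prod>i \<in> Poly_Mapping.keys (m + m'). \<sigma> i ^ Poly_Mapping.lookup (m + m') i) =
        (\<Prod>i \<in> ?S. \<sigma> i ^ Poly_Mapping.lookup m i) * (\<Prod>i \<in> ?S. \<sigma> i ^ Poly_Mapping.lookup m' i)"
      by (subst prod_keys_superset[of ?S]) (simp_all add: lookup_add power_add prod.distrib)
    thus ?case
      unfolding mult_single subst_single
      by (simp add: prod_keys_superset[of ?S m] prod_keys_superset[of ?S m'] phi_mult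
          mult.assoc mult.left_commute)
  qed (simp add: distrib_left subst_add)
qed (simp add: distrib_right subst_add)

lemma subst_Const [simp]: "ev (Const c) = \<phi> c"
  by (simp add: Const_def subst_single)

lemma subst_0 [simp]: "ev 0 = 0" and subst_1 [simp]: "ev 1 = 1"
  using subst_Const[of 0] subst_Const[of 1] by (simp_all add: phi_0 phi_1)

lemma subst_Var [simp]: "ev (Var i) = \<sigma> i"
  by (simp add: Var_def subst_single phi_1)

lemma subst_uminus: "ev (- p) = - ev p"
  using subst_add[of p "- p"] by (simp add: eq_neg_iff_add_eq_0 add.commute)

lemma subst_diff: "ev (p - q) = ev p - ev q"
  using subst_add[of p "- q"] by (simp add: subst_uminus)

lemma subst_power: "ev (p ^ e) = ev p ^ e"
  by (induction e) (simp_all add: subst_mult)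

lemma subst_sum: "ev (sum f S) = (\<Sum>i\<in>S. ev (f i))"
  by (induction S rule: infinite_finite_induct) (simp_all add: subst_add)

lemmas subst_hom = subst_add subst_mult subst_diff subst_power subst_sum subst_uminus

end

interpretation Const_eval: mpoly_eval "Const :: 'k::comm_ring_1 \<Rightarrow> 'k mpoly" \<sigma> for \<sigma>
  by unfold_locales (simp_all add: Const_add Const_mult)

interpretation id_eval: mpoly_eval "\<lambda>c :: 'k::comm_ring_1. c" \<sigma> for \<sigma>
  by unfold_locales simp_all

text \<open>
  Pulling an ideal of \<open>polys n\<close> back along \<open>retract n\<close> gives an ideal of the ring of all polynomials
  with the same quotient, so that congruences need no carrier conditions.
\<close>

definition retract :: "nat \<Rightarrow> 'k::comm_ring_1 mpoly \<Rightarrow> 'k mpoly" where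
  "retract n = mpoly_subst Const (\<lambda>i. if i < n then Var i else 0)"

lemma retract_hom [simp]:
  "retract n (p + q) = retract n p + retract n q" "retract n (p * q) = retract n p * retract n q"
  "retract n (p - q) = retract n p - retract n q" "retract n 0 = 0" "retract n 1 = 1"
  "retract n (Const c) = Const c" "retract n (- p) = - retract n p"
  by (simp_all add: retract_def Const_eval.subst_hom)

lemma retract_sum: "retract n (sum f S) = (\<Sum>i\<in>S. retract n (f i))"
  by (simp add: retract_def Const_eval.subst_hom)

lemma retract_in [simp]: "retract n p \<in> polys n"
  unfolding retract_def mpoly_subst_def
  by (intro polys_sum polys_mult polys_prod polys_power polys_Const) auto

lemma retract_id [simp]: "p \<in> polys n \<Longrightarrow> retract n p = p"
  by (induction p rule: polys_induct)
     (simp_all add: Const_eval.subst_hom, simp add: retract_def)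

subsection \<open>Derivatives\<close>

lemma partial_deriv_single:
  "partial_deriv l (Poly_Mapping.single m c) =
     Poly_Mapping.single (m - Poly_Mapping.single l 1) (of_nat (Poly_Mapping.lookup m l) * c)"
  by (cases "c = 0") (simp_all add: partial_deriv_def)

lemma partial_deriv_superset:
  assumes "finite S" "Poly_Mapping.keys p \<subseteq> S"
  shows "partial_deriv l p = (\<Sum>m \<in> S. Poly_Mapping.single (m - Poly_Mapping.single l 1)
       (of_nat (Poly_Mapping.lookup m l) * Poly_Mapping.lookup p m))"
  unfolding partial_deriv_def
  by (rule sum.mono_neutral_left) (use assms in \<open>auto simp: in_keys_iff\<close>)

lemma partial_deriv_add: "partial_deriv l (p + q) = partial_deriv l p + partial_deriv l q"
proof -
  let ?S = "Poly_Mapping.keys p \<union> Poly_Mapping.keys q"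
  have "Poly_Mapping.keys (p + q) \<subseteq> ?S" by (rule keys_add)
  thus ?thesis
    by (simp add: partial_deriv_superset[of ?S] lookup_add distrib_left single_add sum.distrib)
qed

lemma partial_deriv_mult:
  "partial_deriv l (p * q) = partial_deriv l p * q + p * partial_deriv l q"
proof (induction p rule: poly_mapping_single_induct)
  case (single m c)
  show ?case
  proof (induction q rule: poly_mapping_single_induct)
    case (single m' c')
    \<comment> \<open>Subtraction of exponents is truncated: the two exponents differ if
      \<open>l\<close> does not occur in \<open>a\<close>, but then the coefficient is 0.\<close>
    have *: "Poly_Mapping.single (a - Poly_Mapping.single l 1 + b) (of_nat (Poly_Mapping.lookup a l) * x) =
        Poly_Mapping.single (a + b - Poly_Mapping.single l 1) (of_nat (Poly_Mapping.lookup a l) * x)"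
      for a b and x :: 'a
    proof (cases "Poly_Mapping.lookup a l = 0")
      case False
      hence "a - Poly_Mapping.single l 1 + b = a + b - Poly_Mapping.single l 1"
        by (intro poly_mapping_eqI) (auto simp: lookup_add lookup_minus lookup_single when_def)
      thus ?thesis by simp
    qed simp
    show ?case
      using *[of m m' "c * c'"] *[of m' m "c * c'"]
      by (simp add: mult_single partial_deriv_single lookup_add distrib_left distrib_right single_add add_ac mult_ac)
  qed (simp add: distrib_left partial_deriv_add)
qed (simp add: distrib_right partial_deriv_add)

lemma partial_deriv_Const [simp]: "partial_deriv l (Const c) = 0"
  by (simp add: Const_def partial_deriv_single)

lemma partial_deriv_0 [simp]: "partial_deriv l 0 = 0" and partial_deriv_1 [simp]: "partial_deriv l 1 = 0"
  using partial_deriv_Const[of l 0] partial_deriv_Const[of l 1] by simp_all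

lemma partial_deriv_Var: "partial_deriv l (Var i) = (if i = l then 1 else 0)"
  by (simp add: Var_def partial_deriv_single lookup_single when_def)

lemma partial_deriv_uminus: "partial_deriv l (- p) = - partial_deriv l p"
  using partial_deriv_add[of l p "- p"] by (simp add: eq_neg_iff_add_eq_0 add.commute)

lemma partial_deriv_diff: "partial_deriv l (p - q) = partial_deriv l p - partial_deriv l q"
  using partial_deriv_add[of l p "- q"] by (simp add: partial_deriv_uminus)

section \<open>Difference matrices and the Bezoutian\<close>

subsection \<open>Evaluating balanced biadditive maps on \<open>k[X][Y]\<close>\<close>

text \<open>
  A balanced map is a bilinear map on pairs of polynomials, i.e. a linear map on \<open>k[X, Y]\<close>;
  \<open>contract\<close> is that linear map.
\<close>

definition balanced :: "('k::comm_ring_1 mpoly \<Rightarrow> 'k mpoly \<Rightarrow> 'b::ab_group_add) \<Rightarrow> bool" where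
  "balanced B \<longleftrightarrow> (\<forall>a a' b. B (a + a') b = B a b + B a' b) \<and> (\<forall>a b b'. B a (b + b') = B a b + B a b') \<and>
     (\<forall>c a b. B (Const c * a) b = B a (Const c * b))"

definition contract :: "('k::comm_ring_1 mpoly \<Rightarrow> 'k mpoly \<Rightarrow> 'b::ab_group_add) \<Rightarrow> 'k mpoly mpoly \<Rightarrow> 'b" where
  "contract B E = (\<Sum>m \<in> Poly_Mapping.keys E. B (Poly_Mapping.lookup E m) (Poly_Mapping.single m 1))"

lemma balancedD:
  assumes "balanced B"
  shows "B (a + a') b = B a b + B a' b" "B a (b + b') = B a b + B a b'"
    "B (Const c * a) b = B a (Const c * b)"
    "B 0 b = 0" "B a 0 = 0" "B (- a) b = - B a b" "B a (- b) = - B a b"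
    "B (a - a') b = B a b - B a' b" "B a (b - b') = B a b - B a b'"
proof -
  note B = assms[unfolded balanced_def, THEN conjunct1, rule_format]
    assms[unfolded balanced_def, THEN conjunct2, THEN conjunct1, rule_format]
  show "B (a + a') b = B a b + B a' b" "B a (b + b') = B a b + B a b'"
    "B (Const c * a) b = B a (Const c * b)"
    using assms by (auto simp: balanced_def)
  show z: "B 0 b = 0" "B a 0 = 0" for a b using B(1)[of 0 0 b] B(2)[of a 0 0] by simp_all
  show m: "B (- a) b = - B a b" "B a (- b) = - B a b" for a b
    using B(1)[of a "- a" b] B(2)[of a b "- b"] by (simp_all add: z eq_neg_iff_add_eq_0 add.commute)
  show "B (a - a') b = B a b - B a' b" "B a (b - b') = B a b - B a b'"
    using B(1)[of a "- a'" b] B(2)[of a b "- b'"] by (simp_all add: m)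
qed

lemma balancedI:
  assumes "\<And>a a' b. B (a + a') b = B a b + B a' b" "\<And>a b b'. B a (b + b') = B a b + B a b'"
    "\<And>c a b. B (Const c * a) b = B a (Const c * b)"
  shows "balanced B"
  using assms by (simp add: balanced_def)

lemma balanced_shift:
  assumes "balanced B" shows "balanced (\<lambda>a b. B (a * h) (b * g))"
  by (rule balancedI) (simp_all add: balancedD[OF assms] distrib_right mult.assoc)

lemma contract_single: "balanced B \<Longrightarrow> contract B (Poly_Mapping.single m a) = B a (Poly_Mapping.single m 1)"
  by (cases "a = 0") (simp_all add: contract_def balancedD)

lemma contract_superset:
  assumes "balanced B" "finite S" "Poly_Mapping.keys E \<subseteq> S"
  shows "contract B E = (\<Sum>m \<in> S. B (Poly_Mapping.lookup E m) (Poly_Mapping.single m 1))"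
  unfolding contract_def
  by (rule sum.mono_neutral_left) (use assms in \<open>auto simp: in_keys_iff balancedD\<close>)

lemma contract_add:
  assumes "balanced B" shows "contract B (E + F) = contract B E + contract B F"
proof -
  let ?S = "Poly_Mapping.keys E \<union> Poly_Mapping.keys F"
  have "Poly_Mapping.keys (E + F) \<subseteq> ?S" by (rule keys_add)
  thus ?thesis
    by (simp add: contract_superset[OF assms, of ?S] lookup_add balancedD[OF assms] sum.distrib)
qed

lemma contract_0 [simp]: "contract B 0 = 0"
  by (simp add: contract_def)

lemma contract_sum:
  assumes "balanced B" shows "contract B (sum f S) = (\<Sum>i\<in>S. contract B (f i))"
  by (induction S rule: infinite_finite_induct) (simp_all add: contract_add[OF assms])

lemma contract_diff:
  assumes "balanced B" shows "contract B (E - F) = contract B E - contract B F"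
  using contract_add[OF assms, of "E - F" F] by simp

lemma contract_1: "balanced B \<Longrightarrow> contract B 1 = B 1 1"
  using contract_single[of B 0 1] by simp

lemma map_Const_add: "Poly_Mapping.map Const (p + q) = Poly_Mapping.map Const p + Poly_Mapping.map Const q"
  by (rule poly_mapping_eqI) (auto simp: map.rep_eq lookup_add when_def simp flip: Const_add)

lemma map_Const_mult:
  "Poly_Mapping.map Const (p * q) = Poly_Mapping.map Const p * Poly_Mapping.map Const (q :: 'k::comm_ring_1 mpoly)"
proof (induction p rule: poly_mapping_single_induct)
  case (single m c)
  show ?case
    by (induction q rule: poly_mapping_single_induct)
       (simp_all add: mult_single Const_mult distrib_left map_Const_add)
qed (simp add: distrib_right map_Const_add)

lemma map_Const_Const: "Poly_Mapping.map Const (Const c) = Const (Const c)"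
  by (simp add: Const_def)

lemma map_Const_Var: "Poly_Mapping.map Const (Var i) = Var i"
  by (simp add: Var_def)

lemma contract_mult_Const:
  assumes "balanced B"
  shows "contract B (E * Const h) = contract (\<lambda>a b. B (a * h) b) E"
proof -
  note B' = balanced_shift[OF assms, of h 1, simplified]
  show ?thesis
  proof (induction E rule: poly_mapping_single_induct)
    case (single m c)
    have "Poly_Mapping.single m c * Const h = Poly_Mapping.single m (c * h)"
      by (simp add: Const_def mult_single)
    thus ?case by (simp add: contract_single assms B')
  qed (simp add: distrib_right contract_add assms B')
qed

lemma contract_mult_map:
  assumes "balanced B"
  shows "contract B (E * Poly_Mapping.map Const g) = contract (\<lambda>a b. B a (b * g)) E"
proof -
  note B' = balanced_shift[OF assms, of 1, simplified]
  show ?thesis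
  proof (induction E rule: poly_mapping_single_induct)
    case E: (single m c)
    show ?case
    proof (induction g rule: poly_mapping_single_induct)
      case (single m' d)
      \<comment> \<open>The product in k[X][Y] puts the scalar \<open>d\<close> into the
        X-coefficient; balancedness moves it to the Y-argument, where \<open>g\<close>
        belongs.\<close>
      have "B (c * Const d) (Poly_Mapping.single (m + m') 1) = B c (Poly_Mapping.single (m + m') d)"
        using balancedD(3)[OF assms, of d c "Poly_Mapping.single (m + m') 1"]
        by (simp add: mult.commute Const_mult_single)
      thus ?case by (simp add: contract_single assms B' mult_single)
    next
      case (add p q)
      thus ?case
        unfolding contract_single[OF B'] map_Const_add
        by (simp add: balancedD[OF assms] contract_add[OF assms] distrib_left)
    qed
  qed (simp add: distrib_right contract_add assms B')
qed

text \<open>Multiplication by h(X) - h(Y) measures how far the map is from being balanced over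
  h.\<close>

lemma contract_mult_difference:
  assumes "balanced B"
  shows "contract B (E * (Const h - Poly_Mapping.map Const h)) = contract (\<lambda>a b. B (a * h) b - B a (b * h)) E"
  by (simp add: right_diff_distrib contract_diff assms contract_mult_Const contract_mult_map)
     (simp add: contract_def sum_subtractf)

text \<open>Multiplication, as a balanced map, is the substitution Y = X. This is a ring
  homomorphism, so it commutes with determinants.\<close>

lemma contract_times: "contract (*) = mpoly_subst (\<lambda>c. c) Var"
proof
  fix E :: "'k::comm_ring_1 mpoly mpoly"
  show "contract (*) E = mpoly_subst (\<lambda>c. c) Var E"
    by (simp add: contract_def mpoly_subst_def single_eq_Const_Var[of _ 1])
qed

lemma contract_in:
  assumes "\<And>a b. B a b \<in> N" "0 \<in> N" "\<And>x y. x \<in> N \<Longrightarrow> y \<in> N \<Longrightarrow> x + y \<in> N"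
  shows "contract B E \<in> N"
proof -
  have "finite S \<Longrightarrow> (\<Sum>m \<in> S. B (Poly_Mapping.lookup E m) (Poly_Mapping.single m 1)) \<in> N" for S
    by (induction S rule: finite_induct) (use assms in auto)
  thus ?thesis by (simp add: contract_def)
qed

subsection \<open>Existence of difference matrices\<close>

text \<open>The two carrier conditions of \<open>difference_matrix\<close>, one on the Y-exponents
  and one on the X-coefficients, bundled into a subring.\<close>

definition polys2 :: "nat \<Rightarrow> 'k::comm_ring_1 mpoly mpoly set" where
  "polys2 n = {E \<in> polys n. \<forall>m. Poly_Mapping.lookup E m \<in> polys n}"

lemma polys2_add: "E \<in> polys2 n \<Longrightarrow> F \<in> polys2 n \<Longrightarrow> E + F \<in> polys2 n"
  by (auto simp: polys2_def lookup_add)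

lemma polys2_0: "0 \<in> polys2 n"
  by (auto simp: polys2_def)

lemma polys2_uminus: "E \<in> polys2 n \<Longrightarrow> - E \<in> polys2 n"
  by (auto simp: polys2_def)

lemma polys2_sum: "(\<And>i. i \<in> S \<Longrightarrow> f i \<in> polys2 n) \<Longrightarrow> sum f S \<in> polys2 n"
  by (induction S rule: infinite_finite_induct) (auto simp: polys2_0 polys2_add)

lemma polys2_single:
  "a \<in> polys n \<Longrightarrow> Poly_Mapping.keys m \<subseteq> {..<n} \<Longrightarrow> Poly_Mapping.single m a \<in> polys2 n"
  by (auto simp: polys2_def polys_iff lookup_single when_def split: if_splits)

lemma polys2_mult:
  assumes "E \<in> polys2 n" "F \<in> polys2 n" shows "E * F \<in> polys2 n"
proof -
  have "(\<Sum>m \<in> Poly_Mapping.keys E. Poly_Mapping.single m (Poly_Mapping.lookup E m)) *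
        (\<Sum>m \<in> Poly_Mapping.keys F. Poly_Mapping.single m (Poly_Mapping.lookup F m)) = (\<Sum>m \<in> Poly_Mapping.keys E. \<Sum>m' \<in> Poly_Mapping.keys F.
      Poly_Mapping.single (m + m') (Poly_Mapping.lookup E m * Poly_Mapping.lookup F m'))"
    by (simp only: sum_product mult_single)
  also have "\<dots> \<in> polys2 n"
  proof (intro polys2_sum polys2_single)
    fix m m' assume "m \<in> Poly_Mapping.keys E" "m' \<in> Poly_Mapping.keys F"
    hence "Poly_Mapping.keys m \<subseteq> {..<n}" "Poly_Mapping.keys m' \<subseteq> {..<n}"
      using assms by (auto simp: polys2_def polys_iff)
    thus "Poly_Mapping.keys (m + m') \<subseteq> {..<n}" using keys_add[of m m'] by blast
  qed (use assms in \<open>auto simp: polys2_def\<close>)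
  finally show ?thesis by (simp only: poly_mapping_sum_single[symmetric])
qed

lemma polys2_Const: "p \<in> polys n \<Longrightarrow> Const p \<in> polys2 n"
  by (simp add: Const_def polys2_single)

lemma polys2_1: "1 \<in> polys2 n"
  using polys2_Const[of 1 n] by simp

lemma polys2_map_Const: "p \<in> polys n \<Longrightarrow> Poly_Mapping.map Const p \<in> polys2 n"
  by (auto simp: polys2_def polys_iff[of "Poly_Mapping.map Const p"] polys_iff[of p] in_keys_iff map.rep_eq when_def)

lemma polys2_prod: "(\<And>i. i \<in> S \<Longrightarrow> f i \<in> polys2 n) \<Longrightarrow> prod f S \<in> polys2 n"
  by (induction S rule: infinite_finite_induct) (auto simp: polys2_1 polys2_mult)

lemma polys2_det:
  assumes "\<And>i j. i < l \<Longrightarrow> j < l \<Longrightarrow> \<Delta> i j \<in> polys2 n"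
  shows "det (mat l l (\<lambda>(i, j). \<Delta> i j)) \<in> polys2 n"
proof -
  have sg: "signof p \<in> (polys2 n :: 'a mpoly mpoly set)" for p :: "nat \<Rightarrow> nat"
    by (auto simp: sign_def polys2_1 polys2_uminus)
  show ?thesis
    unfolding det_def'[OF mat_carrier]
  proof (intro polys2_sum polys2_mult sg polys2_prod)
    fix p i assume p: "p \<in> {p. p permutes {0..<l}}" and i: "i \<in> {0..<l}"
    hence "p i < l" using permutes_in_image[of p "{0..<l}" i] by auto
    thus "mat l l (\<lambda>(i, j). \<Delta> i j) $$ (i, p i) \<in> polys2 n" using i assms by auto
  qed
qed

lemma difference_exists:
  assumes "f \<in> polys n"
  shows "\<exists>\<delta>. (\<forall>i. \<delta> i \<in> polys2 n) \<and>
    Const f - Poly_Mapping.map Const f = (\<Sum>i<n. \<delta> i * (Const (Var i) - Var i))"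
  using assms
proof (induction f rule: polys_induct)
  case (Const c)
  show ?case by (intro exI[of _ "\<lambda>_. 0"]) (simp add: polys2_0 map_Const_Const)
next
  case (Var l)
  have "(\<Sum>i<n. (if i = l then 1 else 0) * (Const (Var i) - Var i)) =
      (\<Sum>i<n. if i = l then Const (Var i) - (Var i :: 'a mpoly mpoly) else 0)"
    by (rule sum.cong) auto
  also have "\<dots> = Const (Var l) - Var l" using Var by simp
  finally show ?case
    by (intro exI[of _ "\<lambda>i. if i = l then 1 else 0"]) (auto simp: polys2_0 polys2_1 map_Const_Var)
next
  case (add p q)
  then obtain \<delta> \<epsilon> where d: "\<forall>i. \<delta> i \<in> polys2 n" "\<forall>i. \<epsilon> i \<in> polys2 n"
    "Const p - Poly_Mapping.map Const p = (\<Sum>i<n. \<delta> i * (Const (Var i) - Var i))"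
    "Const q - Poly_Mapping.map Const q = (\<Sum>i<n. \<epsilon> i * (Const (Var i) - Var i))" by blast
  have "Const (p + q) - Poly_Mapping.map Const (p + q) =
      (Const p - Poly_Mapping.map Const p) + (Const q - Poly_Mapping.map Const q)"
    by (simp add: Const_add map_Const_add)
  also have "\<dots> = (\<Sum>i<n. (\<delta> i + \<epsilon> i) * (Const (Var i) - Var i))"
    unfolding d by (simp add: distrib_right sum.distrib)
  finally show ?case using d(1,2) by (intro exI[of _ "\<lambda>i. \<delta> i + \<epsilon> i"]) (auto simp: polys2_add)
next
  case (mult p q)
  then obtain \<delta> \<epsilon> where d: "\<forall>i. \<delta> i \<in> polys2 n" "\<forall>i. \<epsilon> i \<in> polys2 n"
    "Const p - Poly_Mapping.map Const p = (\<Sum>i<n. \<delta> i * (Const (Var i) - Var i))"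
    "Const q - Poly_Mapping.map Const q = (\<Sum>i<n. \<epsilon> i * (Const (Var i) - Var i))" by blast
  \<comment> \<open>The product rule for differences: q(X) stays in front of the first difference,
    p(Y) in front of the second.\<close>
  have "Const (p * q) - Poly_Mapping.map Const (p * q) =
      Const q * (Const p - Poly_Mapping.map Const p) + Poly_Mapping.map Const p * (Const q - Poly_Mapping.map Const q)"
    by (simp add: Const_mult map_Const_mult algebra_simps)
  also have "\<dots> = (\<Sum>i<n. (Const q * \<delta> i + Poly_Mapping.map Const p * \<epsilon> i) * (Const (Var i) - Var i))"
    unfolding d by (simp add: distrib_right sum.distrib sum_distrib_left mult.assoc)
  finally show ?case using d(1,2) mult(1,2)
    by (intro exI[of _ "\<lambda>i. Const q * \<delta> i + Poly_Mapping.map Const p * \<epsilon> i"])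
       (auto simp: polys2_add polys2_mult polys2_Const polys2_map_Const)
qed

lemma difference_matrix_exists:
  assumes "\<And>j. j < n \<Longrightarrow> f j \<in> polys n"
  shows "\<exists>\<Delta>. difference_matrix n f \<Delta>"
proof -
  have "\<forall>j\<in>{..<n}. \<exists>\<delta>. (\<forall>i. \<delta> i \<in> polys2 n) \<and>
    Const (f j) - Poly_Mapping.map Const (f j) = (\<Sum>i<n. \<delta> i * (Const (Var i) - Var i))"
    using difference_exists[OF assms] by simp
  from bchoice[OF this] obtain \<delta> where "\<forall>j\<in>{..<n}. (\<forall>i. \<delta> j i \<in> polys2 n) \<and>
    Const (f j) - Poly_Mapping.map Const (f j) = (\<Sum>i<n. \<delta> j i * (Const (Var i) - Var i))" ..
  hence \<delta>: "\<delta> j i \<in> polys2 n"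
    "Const (f j) - Poly_Mapping.map Const (f j) = (\<Sum>i<n. \<delta> j i * (Const (Var i) - Var i))"
    if "j < n" for i j using that by blast+
  have "difference_matrix n f (\<lambda>i j. \<delta> j i)"
    unfolding difference_matrix_def
    by (intro conjI allI impI \<delta>(2)) (use \<delta>(1) in \<open>simp_all add: polys2_def\<close>)
  thus ?thesis by blast
qed

text \<open>Cramer's rule for the row vector v A, obtained by multiplying with the adjugate on the
  right. It is valid over any commutative ring, also where A is not invertible.\<close>

lemma mat_adjugate_solve:
  fixes A :: "'a::comm_ring_1 mat" and v :: "nat \<Rightarrow> 'a"
  assumes A: "A \<in> carrier_mat n n" and i: "i < n"
  shows "det A * v i = (\<Sum>j<n. (\<Sum>l<n. A $$ (l, j) * v l) * adj_mat A $$ (j, i))"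
proof -
  have adj: "adj_mat A \<in> carrier_mat n n" by (rule adj_mat(1)[OF A])
  have e: "(\<Sum>j<n. A $$ (l, j) * adj_mat A $$ (j, i)) = (if l = i then det A else 0)" if "l < n" for l
  proof -
    have "(A * adj_mat A) $$ (l, i) = (\<Sum>j<n. A $$ (l, j) * adj_mat A $$ (j, i))"
      using A adj i that by (auto simp: scalar_prod_def lessThan_atLeast0)
    thus ?thesis using i that unfolding adj_mat(2)[OF A] by (auto split: if_splits)
  qed
  have "(\<Sum>j<n. (\<Sum>l<n. A $$ (l, j) * v l) * adj_mat A $$ (j, i)) =
      (\<Sum>l<n. v l * (\<Sum>j<n. A $$ (l, j) * adj_mat A $$ (j, i)))"
    by (simp add: sum_distrib_left sum_distrib_right mult_ac)
       (rule sum.swap)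
  also have "\<dots> = (\<Sum>l<n. if l = i then v l * det A else 0)"
    by (rule sum.cong) (auto simp: e)
  also have "\<dots> = det A * v i" using i by (simp add: mult.commute)
  finally show ?thesis by simp
qed

text \<open>
  By Cramer's rule the Bezoutian multiplies every \<open>h(X) - h(Y)\<close> into the ideal generated by the
  \<open>f\<^sub>j(X) - f\<^sub>j(Y)\<close>.
\<close>

lemma difference_matrix_det:
  assumes "difference_matrix n f \<Delta>" and "h \<in> polys n"
  shows "\<exists>E. det (mat n n (\<lambda>(i, j). \<Delta> i j)) * (Const h - Poly_Mapping.map Const h) =
    (\<Sum>j<n. E j * (Const (f j) - Poly_Mapping.map Const (f j)))"
proof -
  let ?A = "mat n n (\<lambda>(i, j). \<Delta> i j)"
  have A: "?A \<in> carrier_mat n n" by simp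
  obtain \<delta> where \<delta>: "Const h - Poly_Mapping.map Const h = (\<Sum>i<n. \<delta> i * (Const (Var i) - Var i))"
    using difference_exists[OF assms(2)] by blast
  have f: "Const (f j) - Poly_Mapping.map Const (f j) = (\<Sum>l<n. ?A $$ (l, j) * (Const (Var l) - Var l))"
    if "j < n" for j
    using assms(1) that by (auto simp: difference_matrix_def intro!: sum.cong)
  have "det ?A * (Const h - Poly_Mapping.map Const h) =
      (\<Sum>i<n. \<delta> i * (det ?A * (Const (Var i) - Var i)))"
    unfolding \<delta> by (simp add: sum_distrib_left mult_ac)
  also have "\<dots> = (\<Sum>i<n. \<delta> i * (\<Sum>j<n. (Const (f j) - Poly_Mapping.map Const (f j)) * adj_mat ?A $$ (j, i)))"
  proof (rule sum.cong[OF refl])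
    fix i assume "i \<in> {..<n}"
    hence i: "i < n" by simp
    have "det ?A * (Const (Var i) - Var i) =
        (\<Sum>j<n. (Const (f j) - Poly_Mapping.map Const (f j)) * adj_mat ?A $$ (j, i))"
      unfolding mat_adjugate_solve[OF A i, of "\<lambda>i. Const (Var i) - Var i"]
      by (rule sum.cong) (simp_all only: f lessThan_iff)
    thus "\<delta> i * (det ?A * (Const (Var i) - Var i)) =
        \<delta> i * (\<Sum>j<n. (Const (f j) - Poly_Mapping.map Const (f j)) * adj_mat ?A $$ (j, i))" by (rule arg_cong)
  qed
  also have "\<dots> = (\<Sum>j<n. (\<Sum>i<n. \<delta> i * adj_mat ?A $$ (j, i)) * (Const (f j) - Poly_Mapping.map Const (f j)))"
    by (simp only: sum_distrib_left sum_distrib_right) (subst sum.swap, simp only: mult_ac)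
  finally show ?thesis by (intro exI[of _ "\<lambda>j. \<Sum>i<n. \<delta> i * adj_mat ?A $$ (j, i)"])
qed

text \<open>The arbitrary choice in \<open>bezoutian\<close> is opened only here; the later
  arguments work for every difference matrix.\<close>

lemma bezoutian_eq:
  assumes "\<And>j. j < n \<Longrightarrow> f j \<in> polys n"
  obtains \<Delta> where "difference_matrix n f \<Delta>" "bezoutian n f = det (mat n n (\<lambda>(i, j). \<Delta> i j))"
proof
  show "difference_matrix n f (SOME \<Delta>. difference_matrix n f \<Delta>)"
    using difference_matrix_exists[OF assms] by (rule someI_ex)
  show "bezoutian n f = det (mat n n (\<lambda>(i, j). (SOME \<Delta>. difference_matrix n f \<Delta>) i j))"
    by (simp add: bezoutian_def)
qed

lemma bezoutian_in: 
  assumes "\<And>j. j < n \<Longrightarrow> f j \<in> polys n" shows "bezoutian n f \<in> polys2 n"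
proof -
  obtain \<Delta> where "difference_matrix n f \<Delta>" "bezoutian n f = det (mat n n (\<lambda>(i, j). \<Delta> i j))"
    using bezoutian_eq[OF assms] .
  moreover from this(1) have "\<Delta> i j \<in> polys2 n" if "i < n" "j < n" for i j
    using that by (simp add: difference_matrix_def polys2_def)
  ultimately show ?thesis using polys2_det[of n \<Delta> n] by simp
qed

text \<open>The form in which Cramer's rule is applied: a factor h may pass from X to Y across the
  Bezoutian, provided the balanced map sends multiples of every f_j, in either variable, into
  \<open>N\<close>. Only an additive subgroup is required of \<open>N\<close>; it will be
  \<open>M\<close> for the trace identities and the ideal generated by the f_j for the local
  algebra.\<close>

lemma bezoutian_shift:
  assumes f: "\<And>j. j < n \<Longrightarrow> f j \<in> polys n" and h: "h \<in> polys n"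
    and B: "balanced B"
    and N: "0 \<in> N" "\<And>x y. x \<in> N \<Longrightarrow> y \<in> N \<Longrightarrow> x + y \<in> N" "\<And>x y. x \<in> N \<Longrightarrow> y \<in> N \<Longrightarrow> x - y \<in> N"
    and fN: "\<And>j a b. j < n \<Longrightarrow> B (a * f j) b \<in> N" "\<And>j a b. j < n \<Longrightarrow> B a (b * f j) \<in> N"
  shows "contract (\<lambda>a b. B (a * h) b) (bezoutian n f) - contract (\<lambda>a b. B a (b * h)) (bezoutian n f) \<in> N"
proof -
  obtain \<Delta> where \<Delta>: "difference_matrix n f \<Delta>" "bezoutian n f = det (mat n n (\<lambda>(i, j). \<Delta> i j))"
    using bezoutian_eq[OF f] .
  obtain E where E: "bezoutian n f * (Const h - Poly_Mapping.map Const h) =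
    (\<Sum>j<n. E j * (Const (f j) - Poly_Mapping.map Const (f j)))"
    using difference_matrix_det[OF \<Delta>(1) h] unfolding \<Delta>(2)[symmetric] ..
  have "contract (\<lambda>a b. B (a * h) b) (bezoutian n f) - contract (\<lambda>a b. B a (b * h)) (bezoutian n f) =
      contract B (bezoutian n f * (Const h - Poly_Mapping.map Const h))"
    unfolding contract_mult_difference[OF B] by (simp add: contract_def sum_subtractf)
  also have "\<dots> = (\<Sum>j<n. contract (\<lambda>a b. B (a * f j) b - B a (b * f j)) (E j))"
    unfolding E contract_sum[OF B] contract_mult_difference[OF B] ..
  also have "\<dots> \<in> N"
  proof -
    have c: "contract (\<lambda>a b. B (a * f j) b - B a (b * f j)) (E j) \<in> N" if "j < n" for j
      by (rule contract_in[OF N(3)[OF fN(1)[OF that] fN(2)[OF that]] N(1) N(2)])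
    have "(\<Sum>j\<in>S. contract (\<lambda>a b. B (a * f j) b - B a (b * f j)) (E j)) \<in> N"
      if "finite S" "S \<subseteq> {..<n}" for S
      using that
    proof (induction S rule: finite_induct)
      case (insert j S)
      thus ?case using N(2)[OF c[of j]] by simp
    qed (simp add: N(1))
    thus ?thesis by simp
  qed
  finally show ?thesis .
qed

text \<open>Differentiate with respect to X_l and then put Y = X. The factors X_i - Y_i vanish on
  the diagonal, so each product contributes only through the derivative of its factor X_i - Y_i,
  which is 1 for i = l and 0 otherwise.\<close>

lemma difference_diagonal:
  assumes "Const f - Poly_Mapping.map Const f = (\<Sum>i<n. \<delta> i * (Const (Var i) - Var i))" and "l < n"
  shows "contract (*) (\<delta> l) = partial_deriv l f"
proof -
  define B :: "'a mpoly \<Rightarrow> 'a mpoly \<Rightarrow> 'a mpoly" where "B a b = partial_deriv l a * b" for a b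
  have B: "balanced B"
    by (rule balancedI) (simp_all add: B_def partial_deriv_add partial_deriv_mult algebra_simps)
  have 1: "contract B (E * (Const (Var i) - Var i)) = (if i = l then contract (*) E else 0)" for E i
  proof -
    have "(\<lambda>a b. B (a * Var i) b - B a (b * Var i)) = (\<lambda>a b. if i = l then a * b else 0)"
      by (intro ext) (simp add: B_def partial_deriv_mult partial_deriv_Var algebra_simps)
    hence "contract B (E * (Const (Var i) - Poly_Mapping.map Const (Var i))) =
        contract (\<lambda>a b. if i = l then a * b else 0) E"
      unfolding contract_mult_difference[OF B] by (rule arg_cong)
    thus ?thesis by (simp add: map_Const_Var contract_def)
  qed
  have bB: "balanced (\<lambda>a b. B (a * f) b - B a (b * f))"
    by (rule balancedI) (simp_all add: B_def partial_deriv_add partial_deriv_mult algebra_simps)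
  have "partial_deriv l f = contract B (1 * (Const f - Poly_Mapping.map Const f))"
    unfolding contract_mult_difference[OF B] contract_1[OF bB] by (simp add: B_def)
  also have "\<dots> = (\<Sum>i<n. if i = l then contract (*) (\<delta> i) else 0)"
    unfolding assms(1) mult_1 contract_sum[OF B] 1 ..
  also have "\<dots> = contract (*) (\<delta> l)" using assms(2) by simp
  finally show ?thesis by simp
qed

lemma bezoutian_diagonal:
  assumes f: "\<And>j. j < n \<Longrightarrow> f j \<in> polys n"
  shows "contract (*) (bezoutian n f) = jacobian_det n f"
proof -
  interpret ev: comm_ring_hom "contract (*) :: 'a mpoly mpoly \<Rightarrow> 'a mpoly"
    by unfold_locales (simp_all add: contract_times id_eval.subst_hom)
  obtain \<Delta> where \<Delta>: "difference_matrix n f \<Delta>" "bezoutian n f = det (mat n n (\<lambda>(i, j). \<Delta> i j))"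
    using bezoutian_eq[OF f] .
  have "contract (*) (bezoutian n f) = det (map_mat (contract (*)) (mat n n (\<lambda>(i, j). \<Delta> i j)))"
    unfolding \<Delta>(2) ev.hom_det ..
  also have "map_mat (contract (*)) (mat n n (\<lambda>(i, j). \<Delta> i j)) = mat n n (\<lambda>(i, j). partial_deriv i (f j))"
    by (rule eq_matI) (use \<Delta>(1) in \<open>auto simp: difference_matrix_def intro!: difference_diagonal\<close>)
  \<comment> \<open>A difference matrix has the variable as its row index, the Jacobian matrix the
    function.\<close>
  also have "\<dots> = (mat n n (\<lambda>(i, l). partial_deriv l (f i)))\<^sup>T"
    by (rule eq_matI) auto
  also have "det \<dots> = jacobian_det n f"
    unfolding jacobian_det_def by (rule det_transpose[OF mat_carrier])
  finally show ?thesis .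
qed

section \<open>Trace identities for the Bezoutian\<close>

text \<open>Padding both factors with zeros to square matrices keeps the product, but column
  \<open>n'\<close> of the first one becomes zero and kills its determinant. Applied in both
  directions, this shows that two bases of the same quotient have equal length.\<close>

lemma right_inverse_dim_le:
  fixes P :: "'a::idom mat"
  assumes P: "P \<in> carrier_mat n n'" and Q: "Q \<in> carrier_mat n' n" and PQ: "P * Q = 1\<^sub>m n"
  shows "n \<le> n'"
proof (rule ccontr)
  assume "\<not> n \<le> n'"
  hence lt: "n' < n" by simp
  define P' where "P' = mat n n (\<lambda>(i, j). if j < n' then P $$ (i, j) else 0)"
  define Q' where "Q' = mat n n (\<lambda>(i, j). if i < n' then Q $$ (i, j) else 0)"
  have c: "P' \<in> carrier_mat n n" "Q' \<in> carrier_mat n n" by (simp_all add: P'_def Q'_def)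
  have "P' * Q' = P * Q"
  proof (rule eq_matI)
    fix i j assume "i < dim_row (P * Q)" "j < dim_col (P * Q)"
    hence ij: "i < n" "j < n" using P Q by auto
    have "(P' * Q') $$ (i, j) = (\<Sum>l = 0..<n. P' $$ (i, l) * Q' $$ (l, j))"
      using c ij by (simp add: scalar_prod_def)
    also have "\<dots> = (\<Sum>l = 0..<n'. P' $$ (i, l) * Q' $$ (l, j))"
      by (rule sum.mono_neutral_right) (use lt ij in \<open>auto simp: P'_def\<close>)
    also have "\<dots> = (\<Sum>l = 0..<n'. P $$ (i, l) * Q $$ (l, j))"
      by (rule sum.cong) (use lt ij in \<open>auto simp: P'_def Q'_def\<close>)
    also have "\<dots> = (P * Q) $$ (i, j)" using P Q ij by (simp add: scalar_prod_def)
    finally show "(P' * Q') $$ (i, j) = (P * Q) $$ (i, j)" .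
  qed (use P Q c in auto)
  hence "det P' * det Q' = 1" using det_mult[OF c] PQ by simp
  moreover have "det P' = 0"
    unfolding det_0_iff_vec_prod_zero[OF c(1)]
  proof (intro exI conjI)
    show "P' *\<^sub>v unit_vec n n' = 0\<^sub>v n"
      by (rule eq_vecI) (use lt in \<open>auto simp: P'_def\<close>)
    show "unit_vec n n' \<noteq> (0\<^sub>v n :: 'a vec)"
      using lt by (metis index_unit_vec(2) index_zero_vec(1) zero_neq_one)
  qed simp
  ultimately show False by simp
qed

text \<open>
  A finite-dimensional quotient by the ideal \<open>M\<close>, given by representatives \<open>bas\<close> of a basis and the
  coordinate functionals.
\<close>

locale quotient_coords =
  fixes M :: "'k::field mpoly set" and n :: nat and bas :: "nat \<Rightarrow> 'k mpoly"
    and coord :: "nat \<Rightarrow> 'k mpoly \<Rightarrow> 'k"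
  assumes M_0: "0 \<in> M" and M_add: "p \<in> M \<Longrightarrow> q \<in> M \<Longrightarrow> p + q \<in> M"
    and M_mult: "p \<in> M \<Longrightarrow> r * p \<in> M"
    and coord_add: "coord i (p + q) = coord i p + coord i q"
    and coord_Const: "coord i (Const c * p) = c * coord i p"
    and coord_M: "p \<in> M \<Longrightarrow> coord i p = 0"
    and expansion: "p - (\<Sum>i<n. Const (coord i p) * bas i) \<in> M"
    and coord_bas: "i < n \<Longrightarrow> l < n \<Longrightarrow> coord i (bas l) = (if i = l then 1 else 0)"
begin

text \<open>The trace of multiplication by \<open>p\<close> on the quotient.\<close>

definition tr :: "'k mpoly \<Rightarrow> 'k" where "tr p = (\<Sum>i<n. coord i (p * bas i))"

text \<open>The representative of the class of \<open>p\<close> in the span of the basis, i.e. a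
  linear section of the quotient map, seen as a projection of the polynomial ring with kernel
  \<open>M\<close>.\<close>

definition expand :: "'k mpoly \<Rightarrow> 'k mpoly" where "expand p = (\<Sum>i<n. Const (coord i p) * bas i)"

lemma M_mult': "p \<in> M \<Longrightarrow> p * r \<in> M"
  using M_mult[of p r] by (simp add: mult.commute)

lemma M_uminus: "p \<in> M \<Longrightarrow> - p \<in> M"
  using M_mult[of p "- 1"] by simp

lemma M_diff: "p \<in> M \<Longrightarrow> q \<in> M \<Longrightarrow> p - q \<in> M"
  using M_add[of p "- q"] M_uminus[of q] by simp

lemma M_sum: "(\<And>i. i \<in> S \<Longrightarrow> f i \<in> M) \<Longrightarrow> sum f S \<in> M"
  by (induction S rule: infinite_finite_induct) (auto simp: M_0 M_add)

lemma coord_0 [simp]: "coord i 0 = 0"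
  by (rule coord_M[OF M_0])

lemma coord_uminus: "coord i (- p) = - coord i p"
  using coord_add[of i p "- p"] by (simp add: eq_neg_iff_add_eq_0 add.commute)

lemma coord_diff: "coord i (p - q) = coord i p - coord i q"
  using coord_add[of i p "- q"] by (simp add: coord_uminus)

lemma coord_sum: "coord i (sum f S) = (\<Sum>j\<in>S. coord i (f j))"
  by (induction S rule: infinite_finite_induct) (auto simp: coord_add)

lemma coord_cong: "p - q \<in> M \<Longrightarrow> coord i p = coord i q"
  using coord_M[of "p - q" i] by (simp add: coord_diff)

lemma tr_add: "tr (p + q) = tr p + tr q"
  by (simp add: tr_def distrib_right coord_add sum.distrib)

lemma tr_Const: "tr (Const c * p) = c * tr p"
  by (simp add: tr_def mult.assoc coord_Const sum_distrib_left)

lemma tr_M: "p \<in> M \<Longrightarrow> tr p = 0"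
  by (simp add: tr_def coord_M M_mult')

lemma tr_0 [simp]: "tr 0 = 0"
  by (rule tr_M[OF M_0])

lemma tr_sum: "tr (sum f S) = (\<Sum>j\<in>S. tr (f j))"
  by (induction S rule: infinite_finite_induct) (auto simp: tr_add)

lemma tr_cong: "p - q \<in> M \<Longrightarrow> tr p = tr q"
  using tr_M[of "p - q"] tr_add[of "p - q" q] by simp

lemma expand_add: "expand (p + q) = expand p + expand q"
  by (simp add: expand_def coord_add Const_add distrib_right sum.distrib)

lemma expand_Const: "expand (Const c * p) = Const c * expand p"
  by (simp add: expand_def coord_Const Const_mult sum_distrib_left mult.assoc)

lemma coord_Const': "coord i (p * Const c) = c * coord i p"
  by (metis coord_Const mult.commute)

lemma expand_Const': "expand (p * Const c) = Const c * expand p"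
  by (metis expand_Const mult.commute)

lemma expand_M: "p \<in> M \<Longrightarrow> expand p = 0"
  by (simp add: expand_def coord_M)

lemma expand_diff_in_M: "p - expand p \<in> M"
  unfolding expand_def by (rule expansion)

end

text \<open>The quotient by \<open>M\<close> is a closed subscheme of the zero scheme of
  \<open>f\<close>. That J is a unit on it enters later, through an explicit inverse
  \<open>y\<close>.\<close>

locale quotient_zero = quotient_coords +
  fixes N :: nat and f :: "nat \<Rightarrow> 'a mpoly"
  assumes f_in: "j < N \<Longrightarrow> f j \<in> polys N" and f_M: "j < N \<Longrightarrow> f j \<in> M"
    and bas_in: "i < n \<Longrightarrow> bas i \<in> polys N"
begin

abbreviation "D \<equiv> bezoutian N f"
abbreviation "J \<equiv> jacobian_det N f"

text \<open>A coordinate functional on the X-side turns the Bezoutian into an element of the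
  quotient. After moving \<open>h\<close> to the Y-side it is an ordinary factor there. Coordinates
  and congruence modulo \<open>M\<close> both kill the f_j, so the shift is permitted.\<close>

lemma coord_shift_left:
  assumes "h \<in> polys N"
  shows "contract (\<lambda>a b. Const (coord i (a * h)) * b) D - h * contract (\<lambda>a b. Const (coord i a) * b) D \<in> M"
proof -
  define B where "B a b = Const (coord i a) * b" for a b
  have B: "balanced B"
    by (rule balancedI) (simp_all add: B_def coord_add coord_Const coord_Const' Const_add Const_mult algebra_simps)
  have "contract (\<lambda>a b. B (a * h) b) D - contract (\<lambda>a b. B a (b * h)) D \<in> M"
    by (rule bezoutian_shift[OF f_in assms B M_0 M_add M_diff])
       (auto simp: B_def coord_M M_mult f_M M_0)
  also have "contract (\<lambda>a b. B a (b * h)) D = h * contract B D"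
    by (simp add: contract_def B_def sum_distrib_left mult_ac)
  finally show ?thesis by (simp add: B_def[abs_def])
qed

text \<open>The mirror image, proved separately instead of through a symmetry of the Bezoutian. The
  left version shows that the trace gives a Scheja-Storch functional, the right one gives its
  uniqueness and the nondegeneracy.\<close>

lemma coord_shift_right:
  assumes "h \<in> polys N"
  shows "contract (\<lambda>a b. a * Const (coord i (b * h))) D - h * contract (\<lambda>a b. a * Const (coord i b)) D \<in> M"
proof -
  define B where "B a b = a * Const (coord i b)" for a b
  have B: "balanced B"
    by (rule balancedI) (simp_all add: B_def coord_add coord_Const coord_Const' Const_add Const_mult algebra_simps)
  have "contract (\<lambda>a b. B (a * h) b) D - contract (\<lambda>a b. B a (b * h)) D \<in> M"
    by (rule bezoutian_shift[OF f_in assms B M_0 M_add M_diff])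
       (auto simp: B_def coord_M M_mult M_mult' f_M M_0)
  hence "- (contract (\<lambda>a b. B (a * h) b) D - contract (\<lambda>a b. B a (b * h)) D) \<in> M" by (rule M_uminus)
  also have "contract (\<lambda>a b. B (a * h) b) D = h * contract B D"
    by (simp add: contract_def B_def sum_distrib_left mult_ac)
  finally show ?thesis by (simp add: B_def[abs_def])
qed

text \<open>
  Writing the trace as the sum of the functionals \<open>x \<mapsto> coord\<^sub>i (x bas\<^sub>i)\<close>, the factor \<open>bas\<^sub>i\<close> can be
  moved across the Bezoutian, which turns the trace into multiplication, i.e. restriction to the
  diagonal.
\<close>

lemma trace_left:
  assumes y: "y \<in> polys N"
  shows "contract (\<lambda>a b. Const (tr (a * y)) * b) D - y * J \<in> M"
proof -
  let ?c = "\<lambda>i. contract (\<lambda>a b. Const (coord i a) * b) D"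
  have "contract (\<lambda>a b. Const (tr (a * y)) * b) D = (\<Sum>i<n. contract (\<lambda>a b. Const (coord i (a * (y * bas i))) * b) D)"
    unfolding contract_def tr_def
    by (subst sum.swap) (simp add: Const_sum sum_distrib_right mult.assoc)
  hence 1: "contract (\<lambda>a b. Const (tr (a * y)) * b) D - (\<Sum>i<n. y * bas i * ?c i) \<in> M"
    by (simp only: sum_subtractf[symmetric])
       (intro M_sum coord_shift_left polys_mult y bas_in, simp)
  \<comment> \<open>The sum over the basis reassembles the representative of \<open>a\<close>;
    replacing it by \<open>a\<close> itself changes the result by an element of \<open>M\<close> and
    leaves the diagonal restriction J.\<close>
  have 2: "(\<Sum>i<n. y * bas i * ?c i) = y * contract (\<lambda>a b. expand a * b) D"
    unfolding contract_def expand_def sum_distrib_left sum_distrib_right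
    by (subst sum.swap) (simp add: mult_ac)
  have "contract (\<lambda>a b. (a - expand a) * b) D \<in> M"
    by (rule contract_in) (simp_all add: M_mult' expand_diff_in_M M_0 M_add)
  hence "contract (\<lambda>a b. a * b) D - contract (\<lambda>a b. expand a * b) D \<in> M"
    by (simp add: contract_def left_diff_distrib sum_subtractf)
  hence "y * contract (\<lambda>a b. expand a * b) D - y * J \<in> M"
    using M_mult[of "J - contract (\<lambda>a b. expand a * b) D" "- y"]
    by (simp add: bezoutian_diagonal f_in algebra_simps)
  from M_add[OF 1[unfolded 2] this] show ?thesis by simp
qed

lemma trace_right:
  assumes y: "y \<in> polys N"
  shows "contract (\<lambda>a b. a * Const (tr (b * y))) D - y * J \<in> M"
proof -
  let ?c = "\<lambda>i. contract (\<lambda>a b. a * Const (coord i b)) D"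
  have "contract (\<lambda>a b. a * Const (tr (b * y))) D = (\<Sum>i<n. contract (\<lambda>a b. a * Const (coord i (b * (y * bas i)))) D)"
    unfolding contract_def tr_def
    by (subst sum.swap) (simp add: Const_sum sum_distrib_left mult.assoc)
  hence 1: "contract (\<lambda>a b. a * Const (tr (b * y))) D - (\<Sum>i<n. y * bas i * ?c i) \<in> M"
    by (simp only: sum_subtractf[symmetric])
       (intro M_sum coord_shift_right polys_mult y bas_in, simp)
  have 2: "(\<Sum>i<n. y * bas i * ?c i) = y * contract (\<lambda>a b. a * expand b) D"
    unfolding contract_def expand_def sum_distrib_left sum_distrib_right
    by (subst sum.swap) (simp add: mult_ac)
  have "contract (\<lambda>a b. a * (b - expand b)) D \<in> M"
    by (rule contract_in) (simp_all add: M_mult expand_diff_in_M M_0 M_add)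
  hence "contract (\<lambda>a b. a * b) D - contract (\<lambda>a b. a * expand b) D \<in> M"
    by (simp add: contract_def right_diff_distrib sum_subtractf)
  hence "y * contract (\<lambda>a b. a * expand b) D - y * J \<in> M"
    using M_mult[of "J - contract (\<lambda>a b. a * expand b) D" "- y"]
    by (simp add: bezoutian_diagonal f_in algebra_simps)
  from M_add[OF 1[unfolded 2] this] show ?thesis by simp
qed

text \<open>
  If the Jacobian is a unit modulo \<open>M\<close>, then \<open>f\<close> generates \<open>M\<close> after localisation: the witness \<open>u\<close>
  arises from the Bezoutian by a linear section of the quotient map in the variables \<open>Y\<close>.
\<close>

lemma zero_scheme_reduced:
  obtains u where "u \<in> polys N" "u - J \<in> M"
    "\<forall>h \<in> polys N \<inter> M. \<exists>g. (\<forall>j<N. g j \<in> polys N) \<and> u * h = (\<Sum>j<N. g j * f j)"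
proof -
  define B where "B a b = a * expand b" for a b
  have B: "balanced B"
    by (rule balancedI) (simp_all add: B_def expand_add expand_Const expand_Const' algebra_simps)
  define u where "u = contract B D"
  have D: "D \<in> polys2 N" by (rule bezoutian_in[OF f_in])
  have e: "expand b \<in> polys N" for b unfolding expand_def by (auto intro!: polys_sum bas_in)
  have u: "u \<in> polys N"
    unfolding u_def contract_def B_def
    by (intro polys_sum polys_mult e) (use D in \<open>auto simp: polys2_def\<close>)
  have "contract (\<lambda>a b. - (a * (b - expand b))) D \<in> M"
    by (rule contract_in) (simp_all only: M_uminus M_mult expand_diff_in_M M_0 M_add)
  hence uJ: "u - J \<in> M"
    by (simp add: u_def B_def contract_def algebra_simps sum_subtractf flip: bezoutian_diagonal[OF f_in])
  have "\<exists>g. (\<forall>j<N. g j \<in> polys N) \<and> u * h = (\<Sum>j<N. g j * f j)"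
    if h: "h \<in> polys N" "h \<in> M" for h
  proof -
    \<comment> \<open>The ideal generated by the f_j in the ring of all polynomials. Its
      coefficients may contain further variables, which \<open>retract\<close> removes at the
      end.\<close>
    define I where "I = {p. \<exists>g. p = (\<Sum>j<N. g j * f j)}"
    have I0: "0 \<in> I" unfolding I_def by (auto intro!: exI[of _ "\<lambda>_. 0"])
    have Iadd: "x + y \<in> I" if "x \<in> I" "y \<in> I" for x y
    proof -
      from that obtain g g' where "x = (\<Sum>j<N. g j * f j)" "y = (\<Sum>j<N. g' j * f j)" by (auto simp: I_def)
      thus ?thesis unfolding I_def
        by (auto intro!: exI[of _ "\<lambda>j. g j + g' j"] simp: distrib_right sum.distrib)
    qed
    have Idiff: "x - y \<in> I" if "x \<in> I" "y \<in> I" for x y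
    proof -
      from that obtain g g' where "x = (\<Sum>j<N. g j * f j)" "y = (\<Sum>j<N. g' j * f j)" by (auto simp: I_def)
      thus ?thesis unfolding I_def
        by (auto intro!: exI[of _ "\<lambda>j. g j - g' j"] simp: left_diff_distrib sum_subtractf)
    qed
    have If: "a * f j * b \<in> I" if "j < N" for a b j
    proof -
      have "(\<Sum>l<N. (if l = j then a * b else 0) * f l) = (\<Sum>l<N. if l = j then a * b * f l else 0)"
        by (rule sum.cong) auto
      also have "\<dots> = a * f j * b" using that by (simp add: mult_ac)
      finally show ?thesis unfolding I_def by (auto intro!: exI[of _ "\<lambda>l. if l = j then a * b else 0"])
    qed
    have "contract (\<lambda>a b. B (a * h) b) D - contract (\<lambda>a b. B a (b * h)) D \<in> I"
      by (rule bezoutian_shift[OF f_in h(1) B I0 Iadd Idiff])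
         (auto simp: B_def If expand_M M_mult f_M I0)
    moreover have "contract (\<lambda>a b. B (a * h) b) D = u * h"
      by (simp add: contract_def u_def B_def sum_distrib_left mult_ac)
    \<comment> \<open>On the Y-side \<open>h\<close> meets the section, which kills \<open>M\<close>
      exactly and not only modulo \<open>M\<close>. Hence u h itself lies in
      \<open>I\<close>.\<close>
    moreover have "contract (\<lambda>a b. B a (b * h)) D = 0"
      by (simp add: contract_def B_def expand_M M_mult h(2))
    ultimately obtain g where g: "u * h = (\<Sum>j<N. g j * f j)" unfolding I_def by auto
    have "u * h = retract N (u * h)" using u h(1) by simp
    also have "\<dots> = (\<Sum>j<N. retract N (g j) * f j)"
      unfolding g retract_sum by (rule sum.cong) (simp_all add: f_in)
    finally show "\<exists>g. (\<forall>j<N. g j \<in> polys N) \<and> u * h = (\<Sum>j<N. g j * f j)"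
      by (intro exI[of _ "\<lambda>j. retract N (g j)"]) auto
  qed
  thus thesis using that u uJ by blast
qed

section \<open>The trace form when the Jacobian is a unit modulo \<open>M\<close>\<close>

context
  fixes y assumes y_in: "y \<in> polys N" and y: "y * J - 1 \<in> M"
begin

lemma trace_functional:
  "contract (\<lambda>a b. Const (tr (a * y)) * b) D - 1 \<in> M"
  using M_add[OF trace_left[OF y_in] y] by simp

text \<open>Apply \<open>\<eta>\<close> to X and b -> Tr(b x y) to Y in the Bezoutian, and evaluate
  in both orders. Taking the trace first reproduces x and leaves \<open>\<eta> x\<close>; taking
  \<open>\<eta>\<close> first reproduces 1 and leaves Tr(x y).\<close>

lemma trace_functional_unique:
  assumes add: "\<And>p q. \<eta> (p + q) = \<eta> p + \<eta> q" and Const: "\<And>c p. \<eta> (Const c * p) = c * \<eta> p"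
    and M: "\<And>p. p \<in> M \<Longrightarrow> \<eta> p = 0"
    and one: "contract (\<lambda>a b. Const (\<eta> a) * b) D - 1 \<in> M" and x: "x \<in> polys N"
  shows "\<eta> x = tr (x * y)"
proof -
  have sum: "\<eta> (sum g S) = (\<Sum>j\<in>S. \<eta> (g j))" for g :: "(nat \<Rightarrow>\<^sub>0 nat) \<Rightarrow> 'a mpoly" and S
    by (induction S rule: infinite_finite_induct) (auto simp: add M M_0)
  have "x * (y * J - 1) \<in> M" by (rule M_mult[OF y])
  from M_add[OF trace_right[OF polys_mult[OF x y_in]] this]
  have "contract (\<lambda>a b. a * Const (tr (b * (x * y)))) D - x \<in> M" by (simp add: algebra_simps)
  hence "\<eta> x = \<eta> (contract (\<lambda>a b. a * Const (tr (b * (x * y)))) D)"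
    using M add[of "contract (\<lambda>a b. a * Const (tr (b * (x * y)))) D - x" x] by simp
  also have "\<dots> = tr (contract (\<lambda>a b. Const (\<eta> a) * b) D * (x * y))"
    unfolding contract_def sum sum_distrib_right tr_sum
    by (rule sum.cong) (simp_all add: Const tr_Const mult.assoc mult.commute[of _ "Const _"])
  also have "\<dots> = tr (1 * (x * y))"
    by (rule tr_cong) (use M_mult'[OF one, of "x * y"] in \<open>simp add: left_diff_distrib\<close>)
  finally show ?thesis by simp
qed

text \<open>If all traces against w vanish, the contraction in \<open>trace_right\<close> is 0, so w
  J lies in \<open>M\<close>; multiplying by the inverse of J gives w.\<close>

lemma trace_nondegenerate:
  assumes w: "w \<in> polys N" "\<And>x. tr (x * w) = 0"
  shows "w \<in> M"
proof -
  have "w * J \<in> M" using M_uminus[OF trace_right[OF w(1)]] by (simp add: w(2) contract_def)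
  from M_diff[OF M_mult[OF this, of y] M_mult[OF y, of w]] show ?thesis by (simp add: algebra_simps)
qed

text \<open>A kernel vector of the Gram matrix is the coordinate vector of some w with e w
  orthogonal to the whole quotient. Then e w lies in \<open>M\<close>, and so does w, as e is a
  unit.\<close>

lemma trace_gram_nondeg:
  assumes e: "e \<in> polys N" and e': "e' * e - 1 \<in> M"
  shows "nondeg_sym_form (mat n n (\<lambda>(i, j). tr (e * bas i * bas j)))"
proof -
  let ?G = "mat n n (\<lambda>(i, j). tr (e * bas i * bas j))"
  have "det ?G \<noteq> 0"
  proof
    assume "det ?G = 0"
    then obtain v where v: "v \<in> carrier_vec n" "v \<noteq> 0\<^sub>v n" "?G *\<^sub>v v = 0\<^sub>v n"
      using det_0_iff_vec_prod_zero[of ?G n] by auto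
    define w where "w = (\<Sum>j<n. Const (v $ j) * bas j)"
    have w_in: "w \<in> polys N" unfolding w_def by (auto intro!: polys_sum bas_in)
    have tb: "tr (bas i * (e * w)) = 0" if "i < n" for i
    proof -
      have "tr (bas i * (e * w)) = (\<Sum>j<n. tr (e * bas i * bas j) * v $ j)"
        unfolding w_def sum_distrib_left tr_sum
        by (rule sum.cong) (simp_all add: tr_Const mult_ac flip: tr_Const)
      also have "\<dots> = (?G *\<^sub>v v) $ i"
        using that v(1) by (auto simp: scalar_prod_def lessThan_atLeast0 intro!: sum.cong)
      finally show ?thesis using v(3) that by simp
    qed
    have "tr (x * (e * w)) = 0" for x
    proof -
      have "tr (x * (e * w)) = tr (expand x * (e * w))"
        by (rule tr_cong) (use M_mult'[OF expand_diff_in_M, of x "e * w"] in \<open>simp add: left_diff_distrib\<close>)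
      also have "\<dots> = (\<Sum>i<n. coord i x * tr (bas i * (e * w)))"
        by (simp add: expand_def sum_distrib_right tr_sum mult.assoc tr_Const)
      finally show ?thesis by (simp add: tb)
    qed
    hence "e * w \<in> M" by (intro trace_nondegenerate polys_mult e w_in)
    from M_diff[OF M_mult[OF this, of e'] M_mult[OF e', of w]] have "w \<in> M"
      by (simp add: algebra_simps)
    have "v = 0\<^sub>v n"
    proof (rule eq_vecI)
      fix i assume "i < dim_vec (0\<^sub>v n :: 'a vec)"
      hence i: "i < n" by simp
      have "0 = coord i w" using coord_M[OF \<open>w \<in> M\<close>] by simp
      also have "\<dots> = (\<Sum>j<n. if j = i then v $ j else 0)"
        unfolding w_def coord_sum by (rule sum.cong) (auto simp: coord_Const coord_bas i)
      finally show "v $ i = 0\<^sub>v n $ i" using i by simp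
    qed (use v in auto)
    with v(2) show False by contradiction
  qed
  moreover have "?G\<^sup>T = ?G" by (rule eq_matI) (auto simp: mult_ac)
  ultimately show ?thesis by (simp add: nondeg_sym_form_def)
qed

end

end

text \<open>The Jacobian is the diagonal restriction of the Bezoutian, whose coefficients and
  exponents are already known to involve only the first \<open>n\<close> variables.\<close>

lemma jacobian_det_in:
  fixes f :: "nat \<Rightarrow> 'k::field mpoly"
  assumes f: "\<And>j. j < n \<Longrightarrow> f j \<in> polys n"
  shows "jacobian_det n f \<in> polys n"
proof -
  have "Poly_Mapping.single m 1 \<in> polys n" if "m \<in> Poly_Mapping.keys (bezoutian n f)" for m
    using that bezoutian_in[of n f] f by (auto simp: polys2_def polys_iff)
  moreover have "Poly_Mapping.lookup (bezoutian n f) m \<in> polys n" for m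
    using bezoutian_in[of n f] f by (auto simp: polys2_def)
  ultimately have "contract (*) (bezoutian n f) \<in> polys n"
    unfolding contract_def by (intro polys_sum polys_mult) auto
  thus ?thesis by (simp only: bezoutian_diagonal[of n f] f)
qed

text \<open>
  The substitution \<open>x \<mapsto> J x\<close> turns the form \<open>Tr(x y / J)\<close> into \<open>Tr(J x y)\<close>; the two bases are those of
  two models of the same quotient.
\<close>

lemma trace_gram_isometric:
  assumes 1: "quotient_zero M n b c N f" and 2: "quotient_coords M n' b' c'"
    and b'_in: "\<And>i. i < n' \<Longrightarrow> b' i \<in> polys N"
    and y_in: "y \<in> polys N" and y: "y * jacobian_det N f - 1 \<in> M" and \<epsilon>: "\<epsilon> * \<epsilon> = 1"
  shows "isometric (mat n n (\<lambda>(i, j). quotient_coords.tr n b c (Const \<epsilon> * jacobian_det N f * b i * b j)))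
    (mat n' n' (\<lambda>(i, j). \<epsilon> * quotient_coords.tr n b c (b' i * b' j * y)))"
proof -
  interpret A: quotient_zero M n b c N f by (rule 1)
  interpret B: quotient_coords M n' b' c' by (rule 2)
  let ?J = "jacobian_det N f"
  \<comment> \<open>\<open>P\<close> and \<open>Q\<close> are the matrices of multiplication by y =
    1/J and by J between the two bases, hence inverse to each other.\<close>
  define P where "P = mat n n' (\<lambda>(i, j). c i (y * b' j))"
  define Q where "Q = mat n' n (\<lambda>(i, j). c' i (?J * b j))"
  have PQ: "P * Q = 1\<^sub>m n"
  proof (rule eq_matI)
    fix i j assume "i < dim_row (1\<^sub>m n :: 'a mat)" "j < dim_col (1\<^sub>m n :: 'a mat)"
    hence ij: "i < n" "j < n" by auto
    have "(P * Q) $$ (i, j) = (\<Sum>l<n'. c i (y * b' l) * c' l (?J * b j))"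
      using ij by (simp add: P_def Q_def scalar_prod_def lessThan_atLeast0)
    also have "\<dots> = c i (y * B.expand (?J * b j))"
      unfolding B.expand_def sum_distrib_left A.coord_sum
      by (rule sum.cong) (simp_all add: mult.left_commute[of y] A.coord_Const)
    also have "\<dots> = c i (y * (?J * b j))"
      by (rule A.coord_cong)
         (use A.M_uminus[OF A.M_mult[OF B.expand_diff_in_M, of y "?J * b j"]] in \<open>simp add: algebra_simps\<close>)
    also have "\<dots> = c i (b j)"
      by (rule A.coord_cong) (use A.M_mult'[OF y, of "b j"] in \<open>simp add: algebra_simps\<close>)
    finally show "(P * Q) $$ (i, j) = 1\<^sub>m n $$ (i, j)" using ij by (simp add: A.coord_bas)
  qed (simp_all add: P_def Q_def)
  have QP: "Q * P = 1\<^sub>m n'"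
  proof (rule eq_matI)
    fix i j assume "i < dim_row (1\<^sub>m n' :: 'a mat)" "j < dim_col (1\<^sub>m n' :: 'a mat)"
    hence ij: "i < n'" "j < n'" by auto
    have "(Q * P) $$ (i, j) = (\<Sum>l<n. c' i (?J * b l) * c l (y * b' j))"
      using ij by (simp add: P_def Q_def scalar_prod_def lessThan_atLeast0)
    also have "\<dots> = c' i (?J * A.expand (y * b' j))"
      unfolding A.expand_def sum_distrib_left B.coord_sum
      by (rule sum.cong) (simp_all add: mult.left_commute[of ?J] B.coord_Const)
    also have "\<dots> = c' i (?J * (y * b' j))"
      by (rule B.coord_cong)
         (use A.M_uminus[OF A.M_mult[OF A.expand_diff_in_M, of ?J "y * b' j"]] in \<open>simp add: algebra_simps\<close>)
    also have "\<dots> = c' i (b' j)"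
      by (rule B.coord_cong) (use A.M_mult'[OF y, of "b' j"] in \<open>simp add: algebra_simps\<close>)
    finally show "(Q * P) $$ (i, j) = 1\<^sub>m n' $$ (i, j)" using ij by (simp add: B.coord_bas)
  qed (simp_all add: P_def Q_def)
  have cP: "P \<in> carrier_mat n n'" "Q \<in> carrier_mat n' n" by (simp_all add: P_def Q_def)
  have n: "n' = n"
    using right_inverse_dim_le[OF cP PQ] right_inverse_dim_le[OF cP(2,1) QP] by simp
  let ?G = "mat n n (\<lambda>(i, j). A.tr (Const \<epsilon> * ?J * b i * b j))"
  have J: "?J \<in> polys N" by (rule jacobian_det_in[OF A.f_in])
  \<comment> \<open>Since \<open>\<epsilon>\<close> is its own inverse, the inverse of
    \<open>\<epsilon>\<close> J is \<open>\<epsilon>\<close> y.\<close>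
  have "Const \<epsilon> * Const \<epsilon> = (1 :: 'a mpoly)" using \<epsilon> by (simp flip: Const_mult)
  moreover have "Const \<epsilon> * y * (Const \<epsilon> * ?J) = (Const \<epsilon> * Const \<epsilon>) * (y * ?J)"
    by (simp only: mult_ac)
  ultimately have "Const \<epsilon> * y * (Const \<epsilon> * ?J) - 1 \<in> M" using y by (simp only: mult_1)
  hence G: "nondeg_sym_form ?G"
    by (intro A.trace_gram_nondeg[OF y_in y, of _ "Const \<epsilon> * y"]) (simp_all add: J)
  have "mat n' n' (\<lambda>(i, j). \<epsilon> * A.tr (b' i * b' j * y)) = P\<^sup>T * ?G * P"
  proof (rule eq_matI)
    fix i j assume "i < dim_row (P\<^sup>T * ?G * P)" "j < dim_col (P\<^sup>T * ?G * P)"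
    hence ij: "i < n" "j < n" using cP n by auto
    have "(P\<^sup>T * ?G * P) $$ (i, j) =
        (\<Sum>m<n. (\<Sum>l<n. c l (y * b' i) * A.tr (Const \<epsilon> * ?J * b l * b m)) * c m (y * b' j))"
      using ij n by (simp add: P_def scalar_prod_def lessThan_atLeast0)
    also have "\<dots> = A.tr (Const \<epsilon> * ?J * A.expand (y * b' i) * A.expand (y * b' j))"
      unfolding A.expand_def sum_distrib_left sum_distrib_right A.tr_sum
      by (simp add: mult_ac flip: A.tr_Const)
    also have "\<dots> = A.tr (Const \<epsilon> * ?J * (y * b' i) * A.expand (y * b' j))"
      by (rule A.tr_cong)
         (use A.M_uminus[OF A.M_mult[OF A.expand_diff_in_M, of "Const \<epsilon> * ?J * A.expand (y * b' j)" "y * b' i"]]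
          in \<open>simp add: algebra_simps\<close>)
    also have "\<dots> = A.tr (Const \<epsilon> * ?J * (y * b' i) * (y * b' j))"
      by (rule A.tr_cong)
         (use A.M_uminus[OF A.M_mult[OF A.expand_diff_in_M, of "Const \<epsilon> * ?J * (y * b' i)" "y * b' j"]]
          in \<open>simp add: algebra_simps\<close>)
    \<comment> \<open>The substitution contributes y twice; J cancels one of the two.\<close>
    also have "\<dots> = A.tr (Const \<epsilon> * (b' i * b' j * y))"
      by (rule A.tr_cong)
         (use A.M_mult[OF y, of "Const \<epsilon> * (b' i * b' j * y)"] in \<open>simp add: algebra_simps\<close>)
    finally show "mat n' n' (\<lambda>(i, j). \<epsilon> * A.tr (b' i * b' j * y)) $$ (i, j) = (P\<^sup>T * ?G * P) $$ (i, j)"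
      using ij n by (simp add: A.tr_Const)
  qed (use cP n in auto)
  thus ?thesis
    by (intro isometricI[OF G, of P Q]) (use cP PQ n in auto)
qed

section \<open>Quotients of the polynomial ring and their bases\<close>

text \<open>Instantiated for the residue field and for the local algebra with the same
  \<open>M\<close>. The condition \<open>M_retract\<close> says that the variables from
  \<open>N\<close> on are zero in the quotient.\<close>

locale mpoly_quotient = cring A for A :: "('a, 'b) ring_scheme" (structure) +
  fixes M :: "'k::field mpoly set" and \<pi> :: "'k mpoly \<Rightarrow> 'a" and N :: nat
  assumes M_0: "0 \<in> M" and M_add: "p \<in> M \<Longrightarrow> q \<in> M \<Longrightarrow> p + q \<in> M"
    and M_mult: "p \<in> M \<Longrightarrow> r * p \<in> M"
    and M_retract: "p - retract N p \<in> M"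
    and pi_in [simp]: "\<pi> p \<in> carrier A"
    and pi_add: "\<pi> (p + q) = \<pi> p \<oplus> \<pi> q" and pi_mult: "\<pi> (p * q) = \<pi> p \<otimes> \<pi> q"
    and pi_1: "\<pi> 1 = \<one>" and pi_surj: "x \<in> carrier A \<Longrightarrow> \<exists>p. \<pi> p = x"
    and pi_eq_iff: "\<pi> p = \<pi> q \<longleftrightarrow> p - q \<in> M"
begin

abbreviation \<kappa> :: "'k \<Rightarrow> 'a" where "\<kappa> c \<equiv> \<pi> (Const c)"

lemma pi_0: "\<pi> 0 = \<zero>"
proof -
  have "\<pi> 0 \<oplus> \<pi> 0 = \<pi> 0 \<oplus> \<zero>" by (simp flip: pi_add)
  thus ?thesis by (simp del: r_zero)
qed

lemma pi_eq_0_iff: "\<pi> p = \<zero> \<longleftrightarrow> p \<in> M"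
  using pi_eq_iff[of p 0] by (simp add: pi_0)

lemma pi_sum: "finite S \<Longrightarrow> \<pi> (sum f S) = (\<Oplus>i\<in>S. \<pi> (f i))"
  by (induction S rule: finite_induct) (simp_all add: pi_0 pi_add)

lemma pi_power: "\<pi> (p ^ (e::nat)) = \<pi> p [^] e"
  by (induction e) (simp_all add: pi_1 pi_mult mult.commute m_comm)

lemma pi_retract: "\<pi> (retract N p) = \<pi> p"
  using M_mult[OF M_retract, of "- 1" p] by (simp add: pi_eq_iff)

lemma pi_surj_polys: "x \<in> carrier A \<Longrightarrow> \<exists>p \<in> polys N. \<pi> p = x"
  using pi_surj pi_retract retract_in by metis

lemma alg_lincomb_pi:
  assumes "\<And>i. i < length bs \<Longrightarrow> \<pi> (b i) = bs ! i"
  shows "alg_lincomb A \<kappa> bs c = \<pi> (\<Sum>i<length bs. Const (c $ i) * b i)"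
proof -
  have "bs ! i \<in> carrier A" if "i < length bs" for i using assms[OF that] pi_in by metis
  thus ?thesis
    unfolding alg_lincomb_def by (subst pi_sum) (auto intro!: finsum_cong' simp: pi_mult assms)
qed

text \<open>Provides the existence that turns the choice \<open>some_alg_basis\<close> into an
  actual basis.\<close>

lemma alg_basis_of_coords:
  assumes "quotient_coords M n b c"
  shows "alg_basis A \<kappa> (map (\<pi> \<circ> b) [0..<n])"
proof -
  interpret Q: quotient_coords M n b c by (rule assms)
  let ?bs = "map (\<pi> \<circ> b) [0..<n]"
  have lc: "alg_lincomb A \<kappa> ?bs v = \<pi> (\<Sum>i<n. Const (v $ i) * b i)" for v
    using alg_lincomb_pi[of ?bs b v] by simp
  show ?thesis
    unfolding alg_basis_def
  proof (intro conjI ballI)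
    fix x assume "x \<in> carrier A"
    then obtain p where p: "x = \<pi> p" using pi_surj by metis
    show "\<exists>!v. v \<in> carrier_vec (length ?bs) \<and> x = alg_lincomb A \<kappa> ?bs v"
    proof (rule ex1I[of _ "vec n (\<lambda>i. c i p)"], goal_cases)
      case 1
      have "p - (\<Sum>i<n. Const (vec n (\<lambda>i. c i p) $ i) * b i) \<in> M"
        using Q.expansion[of p] by simp
      thus ?case unfolding lc p pi_eq_iff by simp
    next
      case (2 v)
      hence "p - (\<Sum>i<n. Const (v $ i) * b i) \<in> M" unfolding lc p pi_eq_iff by simp
      hence *: "c l p = c l (\<Sum>i<n. Const (v $ i) * b i)" for l by (rule Q.coord_cong)
      show ?case
      proof (rule eq_vecI)
        fix l assume "l < dim_vec (vec n (\<lambda>i. c i p))"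
        hence l: "l < n" by simp
        have "c l p = (\<Sum>i<n. if i = l then v $ i else 0)"
          unfolding * Q.coord_sum by (rule sum.cong) (auto simp: Q.coord_Const Q.coord_bas l)
        thus "v $ l = vec n (\<lambda>i. c i p) $ l" using l by simp
      qed (use 2 in auto)
    qed
  qed auto
qed

text \<open>Transports the arbitrarily chosen basis back to polynomials. The representatives are
  taken in \<open>polys N\<close>, because only such factors may be shifted across the
  Bezoutian.\<close>

lemma coords_of_alg_basis:
  assumes bs: "alg_basis A \<kappa> bs"
  obtains b c where "quotient_coords M (length bs) b c" "\<And>i. b i \<in> polys N"
    "\<And>i. i < length bs \<Longrightarrow> \<pi> (b i) = bs ! i"
    "\<And>i p. i < length bs \<Longrightarrow> c i p = alg_coords A \<kappa> bs (\<pi> p) $ i"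
proof -
  let ?n = "length bs"
  define b where "b i = (if i < ?n then (SOME p. p \<in> polys N \<and> \<pi> p = bs ! i) else 0)" for i
  have b: "b i \<in> polys N \<and> \<pi> (b i) = bs ! i" if "i < ?n" for i
  proof -
    have "bs ! i \<in> carrier A" using bs that by (auto simp: alg_basis_def)
    hence "\<exists>p. p \<in> polys N \<and> \<pi> p = bs ! i" using pi_surj_polys by blast
    from someI_ex[OF this] show ?thesis unfolding b_def using that by simp
  qed
  have b_in: "b i \<in> polys N" for i using b[of i] by (cases "i < ?n") (simp_all add: b_def)
  have lc: "alg_lincomb A \<kappa> bs v = \<pi> (\<Sum>i<?n. Const (v $ i) * b i)" for v
    by (rule alg_lincomb_pi) (simp add: b)
  have ex1: "\<exists>!v. v \<in> carrier_vec ?n \<and> \<pi> p = \<pi> (\<Sum>i<?n. Const (v $ i) * b i)" for p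
    using bs unfolding alg_basis_def lc[symmetric] by simp
  let ?co = "\<lambda>p. alg_coords A \<kappa> bs (\<pi> p)"
  have co: "?co p \<in> carrier_vec ?n" "p - (\<Sum>i<?n. Const (?co p $ i) * b i) \<in> M" for p
    using theI'[OF ex1[of p]] unfolding alg_coords_def lc pi_eq_iff by simp_all
  have couniq: "?co p = vec ?n v" if "p - (\<Sum>i<?n. Const (v i) * b i) \<in> M" for p v
    unfolding alg_coords_def lc using that by (intro the1_equality[OF ex1]) (simp add: pi_eq_iff)
  \<comment> \<open>The value 0 outside the basis makes the coordinates linear at every index, as
    \<open>quotient_coords\<close> demands.\<close>
  define c where "c i p = (if i < ?n then ?co p $ i else 0)" for i p
  have c: "p - (\<Sum>i<?n. Const (c i p) * b i) \<in> M" for p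
    using co(2)[of p] by (simp add: c_def)
  have cu: "c i p = (if i < ?n then v i else 0)" if "p - (\<Sum>i<?n. Const (v i) * b i) \<in> M" for i p v
    using couniq[OF that] by (simp add: c_def)
  have "quotient_coords M ?n b c"
  proof
    fix i and p q :: "'k mpoly" and a
    show "c i (p + q) = c i p + c i q"
      using cu[of "p + q" "\<lambda>i. c i p + c i q" i] M_add[OF c[of p] c[of q]]
      by (auto simp: Const_add algebra_simps sum.distrib c_def)
    show "c i (Const a * p) = a * c i p"
      using cu[of "Const a * p" "\<lambda>i. a * c i p" i] M_mult[OF c[of p], of "Const a"]
      by (auto simp: Const_mult right_diff_distrib sum_distrib_left mult.assoc c_def)
    show "c i p = 0" if "p \<in> M"
      using cu[of p "\<lambda>_. 0" i] that by simp
    show "c i (b l) = (if i = l then 1 else 0)" if "i < ?n" "l < ?n" for l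
    proof -
      have "(\<Sum>j<?n. Const (if j = l then 1 else 0) * b j) = (\<Sum>j<?n. if j = l then b j else 0)"
        by (rule sum.cong) auto
      hence "b l - (\<Sum>j<?n. Const (if j = l then 1 else 0) * b j) \<in> M"
        using that by (simp add: M_0)
      from cu[OF this, of i] show ?thesis using that by simp
    qed
  qed (use M_0 M_add M_mult c in auto)
  thus thesis by (rule that) (use b b_in in \<open>auto simp: c_def\<close>)
qed

lemma alg_trace_eq:
  assumes "quotient_coords M (length bs) b c" "\<And>i. i < length bs \<Longrightarrow> \<pi> (b i) = bs ! i"
    and "\<And>i p. i < length bs \<Longrightarrow> c i p = alg_coords A \<kappa> bs (\<pi> p) $ i" and "some_alg_basis A \<kappa> = bs"
  shows "alg_trace A \<kappa> (\<pi> x) = quotient_coords.tr (length bs) b c x"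
  unfolding alg_trace_def Let_def assms(4) quotient_coords.tr_def[OF assms(1)]
  by (rule sum.cong) (simp_all add: assms(2,3) pi_mult)

lemma algebraic_relation:
  assumes "finsum A (\<lambda>i. \<kappa> (Polynomial.coeff g i) \<otimes> \<pi> p [^] i) {..Polynomial.degree g} = \<zero>"
  shows "(\<Sum>i\<le>Polynomial.degree g. Const (Polynomial.coeff g i) * p ^ i) \<in> M"
proof -
  have "\<pi> (\<Sum>i\<le>Polynomial.degree g. Const (Polynomial.coeff g i) * p ^ i) = \<zero>"
    unfolding assms[symmetric]
    by (subst pi_sum) (auto intro!: finsum_cong' simp: pi_mult pi_power)
  thus ?thesis by (simp add: pi_eq_0_iff)
qed

lemma separable_algebraic:
  assumes "separable_extension A \<kappa>"
  obtains g :: "'k poly" where "irreducible g"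
    "(\<Sum>i\<le>Polynomial.degree g. Const (Polynomial.coeff g i) * p ^ i) \<in> M"
  using assms algebraic_relation unfolding separable_extension_def by (meson pi_in)

text \<open>Write the irreducible relation of p as a + X h(X). If a = 0, then X divides it, so h is
  a unit and the relation puts p into \<open>M\<close>. Otherwise - h(p) / a is an inverse of
  p.\<close>

lemma separable_inverse:
  assumes sep: "separable_extension A \<kappa>" and p: "p \<notin> M" "p \<in> polys N"
  obtains y where "y \<in> polys N" "y * p - 1 \<in> M"
proof -
  obtain g :: "'k poly" where g: "irreducible g"
    "(\<Sum>i\<le>Polynomial.degree g. Const (Polynomial.coeff g i) * p ^ i) \<in> M"
    using separable_algebraic[OF sep] .
  obtain a h where ah: "g = pCons a h" by (cases g) auto
  have h: "h \<noteq> 0"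
  proof
    assume "h = 0"
    hence "g = [:a:]" using ah by simp
    moreover from this have "a \<noteq> 0" using g(1) by auto
    ultimately have "is_unit g" by (simp add: is_unit_pCons_iff)
    thus False using g(1) by (simp add: irreducible_def)
  qed
  hence d: "Polynomial.degree g = Suc (Polynomial.degree h)" by (simp add: ah)
  define H where "H = (\<Sum>i\<le>Polynomial.degree h. Const (Polynomial.coeff h i) * p ^ i)"
  have eq: "(\<Sum>i\<le>Polynomial.degree g. Const (Polynomial.coeff g i) * p ^ i) = Const a + p * H"
    unfolding d sum.atMost_Suc_shift H_def by (simp add: ah sum_distrib_left mult_ac)
  have H_in: "H \<in> polys N" unfolding H_def using p(2) by (auto intro!: polys_sum)
  have a: "a \<noteq> 0"
  proof
    assume "a = 0"
    hence gh: "g = [:0, 1:] * h" using ah by simp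
    have "\<not> is_unit [:0, 1 :: 'k:]" by (simp add: is_unit_pCons_iff)
    hence "is_unit h" using irreducibleD[OF g(1) gh] by simp
    then obtain c where c: "h = [:c:]" "c \<noteq> 0" by (auto simp: is_unit_poly_iff dvd_field_iff)
    have "p * Const c \<in> M" using g(2) unfolding eq H_def by (simp add: c \<open>a = 0\<close>)
    from M_mult[OF this, of "Const (inverse c)"] have "Const (inverse c * c) * p \<in> M"
      by (simp add: Const_mult mult_ac)
    thus False using p(1) c(2) by simp
  qed
  show thesis
  proof
    show "Const (- inverse a) * H \<in> polys N" using H_in by simp
    have "Const (- inverse a) * (Const a + p * H) \<in> M" using M_mult[OF g(2)] unfolding eq .
    also have "Const (- inverse a) * (Const a + p * H) = Const (- inverse a) * H * p - Const (inverse a * a)"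
      by (simp add: Const_uminus Const_mult algebra_simps)
    finally show "Const (- inverse a) * H * p - 1 \<in> M" using a by simp
  qed
qed

subsection \<open>Finite-dimensionality\<close>

definition spanned :: "'k mpoly set \<Rightarrow> 'k mpoly \<Rightarrow> bool" where
  "spanned S p \<longleftrightarrow> (\<exists>c. p - (\<Sum>s\<in>S. Const (c s) * s) \<in> M)"

lemma spanned_add: 
  assumes "spanned S p" "spanned S q" shows "spanned S (p + q)"
proof -
  from assms obtain c d where "p - (\<Sum>s\<in>S. Const (c s) * s) \<in> M" "q - (\<Sum>s\<in>S. Const (d s) * s) \<in> M"
    by (auto simp: spanned_def)
  from M_add[OF this] show ?thesis
    unfolding spanned_def
    by (intro exI[of _ "\<lambda>s. c s + d s"]) (simp add: Const_add algebra_simps sum.distrib)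
qed

lemma spanned_Const: 
  assumes "spanned S p" shows "spanned S (Const a * p)"
proof -
  from assms obtain c where "p - (\<Sum>s\<in>S. Const (c s) * s) \<in> M" by (auto simp: spanned_def)
  from M_mult[OF this, of "Const a"] show ?thesis
    unfolding spanned_def
    by (intro exI[of _ "\<lambda>s. a * c s"]) (simp add: Const_mult right_diff_distrib sum_distrib_left mult.assoc)
qed

lemma spanned_M: "p \<in> M \<Longrightarrow> spanned S p"
  unfolding spanned_def by (intro exI[of _ "\<lambda>_. 0"]) simp

lemma spanned_sum: "(\<And>i. i \<in> T \<Longrightarrow> spanned S (f i)) \<Longrightarrow> spanned S (sum f T)"
  by (induction T rule: infinite_finite_induct) (auto simp: spanned_add spanned_M M_0)

lemma spanned_base:
  assumes "s \<in> S" "finite S" shows "spanned S s"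
proof -
  have "(\<Sum>t\<in>S. Const (if t = s then 1 else 0) * t) = (\<Sum>t\<in>S. if t = s then t else 0)"
    by (rule sum.cong) auto
  hence "s - (\<Sum>t\<in>S. Const (if t = s then 1 else 0) * t) \<in> M" using assms by (simp add: M_0)
  thus ?thesis unfolding spanned_def by (intro exI[of _ "\<lambda>t. if t = s then 1 else 0"])
qed

text \<open>The factor \<open>q\<close> lets one statement cover both uses: stability of a span
  under a variable, and, with \<open>q = 1\<close>, passage to another spanning set.\<close>

lemma spanned_trans:
  assumes "\<And>s. s \<in> S \<Longrightarrow> spanned T (q * s)" "spanned S p" shows "spanned T (q * p)"
proof -
  from assms(2) obtain c where c: "p - (\<Sum>s\<in>S. Const (c s) * s) \<in> M" by (auto simp: spanned_def)
  have "spanned T (\<Sum>s\<in>S. Const (c s) * (q * s))" by (intro spanned_sum spanned_Const assms(1))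
  from spanned_add[OF this spanned_M[OF M_mult[OF c, of q]]] show ?thesis
    by (simp add: algebra_simps sum_distrib_left)
qed

lemma spanned_mod: "spanned S p \<Longrightarrow> q - p \<in> M \<Longrightarrow> spanned S q"
  using spanned_add[of S p "q - p"] spanned_M[of "q - p" S] by simp

text \<open>Each x_l satisfies an irreducible relation of degree d_l. The monomials with all
  exponents below these degrees span: multiplying one by x_l either gives another one or reaches the
  exponent d_l, where the relation lowers it. So the span contains 1 and is stable under the
  polynomial ring.\<close>

lemma finite_spanning_set:
  assumes "separable_extension A \<kappa>"
  obtains S where "finite S" "\<And>p. spanned S p"
proof -
  have "\<exists>g :: 'k poly. irreducible g \<and> (\<Sum>i\<le>Polynomial.degree g. Const (Polynomial.coeff g i) * Var l ^ i) \<in> M" for l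
    using separable_algebraic[OF assms] by metis
  then obtain g :: "nat \<Rightarrow> 'k poly" where g: "\<And>l. irreducible (g l)"
    "\<And>l. (\<Sum>i\<le>Polynomial.degree (g l). Const (Polynomial.coeff (g l) i) * Var l ^ i) \<in> M" by metis
  define d where "d l = Polynomial.degree (g l)" for l
  \<comment> \<open>Positive degrees guarantee that the monomial 1 is among the spanning
    ones.\<close>
  have d: "d l > 0" for l
  proof (rule ccontr)
    assume "\<not> d l > 0"
    then obtain a where a: "g l = [:a:]" unfolding d_def using degree_eq_zeroE by blast
    moreover from this have "a \<noteq> 0" using g(1)[of l] by auto
    ultimately have "is_unit (g l)" by (simp add: is_unit_pCons_iff)
    thus False using g(1)[of l] by (simp add: irreducible_def)
  qed
  define mono :: "(nat \<Rightarrow> nat) \<Rightarrow> 'k mpoly" where "mono e = (\<Prod>i<N. Var i ^ e i)" for e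
  define S where "S = mono ` (PiE {..<N} (\<lambda>i. {..<d i}))"
  have fin: "finite S" unfolding S_def by (intro finite_imageI finite_PiE) auto
  have base: "spanned S (mono e)" if "\<And>i. i < N \<Longrightarrow> e i < d i" for e
  proof -
    have "mono e = mono (restrict e {..<N})" unfolding mono_def by (rule prod.cong) auto
    moreover have "restrict e {..<N} \<in> PiE {..<N} (\<lambda>i. {..<d i})" using that by auto
    ultimately have "mono e \<in> S" unfolding S_def by blast
    thus ?thesis by (rule spanned_base[OF _ fin])
  qed
  have upd: "mono (e(l := a)) = Var l ^ a * (\<Prod>i\<in>{..<N} - {l}. Var i ^ e i)" if "l < N" for e l a
  proof -
    have "(\<Prod>i\<in>{..<N} - {l}. (Var i :: 'k mpoly) ^ (e(l := a)) i) = (\<Prod>i\<in>{..<N} - {l}. Var i ^ e i)"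
      by (rule prod.cong) auto
    thus ?thesis unfolding mono_def using that by (subst prod.remove[of _ l]) auto
  qed
  have step: "spanned S (Var l * s)" if s: "s \<in> S" and l: "l < N" for s l
  proof -
    obtain e where e: "e \<in> PiE {..<N} (\<lambda>i. {..<d i})" "s = mono e" using s by (auto simp: S_def)
    have ed: "e i < d i" if "i < N" for i using e(1) that by (auto simp: PiE_def Pi_def)
    let ?r = "\<Prod>i\<in>{..<N} - {l}. Var i ^ e i"
    have eq: "s = Var l ^ e l * ?r" unfolding e(2) using upd[OF l, of e "e l"] by simp
    show ?thesis
    proof (cases "Suc (e l) < d l")
      case True
      have "spanned S (mono (e(l := Suc (e l))))" by (rule base) (use True ed in auto)
      thus ?thesis unfolding upd[OF l] eq by (simp add: mult.assoc)
    next
      case False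
      hence "d l = Suc (e l)" using ed[OF l] by simp
      hence eq': "Var l * s = Var l ^ d l * ?r" unfolding eq by (simp add: mult.assoc)
      let ?c = "Polynomial.coeff (g l)"
      have lc: "?c (d l) \<noteq> 0" unfolding d_def using g(1)[of l] by auto
      have sp: "spanned S (\<Sum>i<d l. Const (- (?c i / ?c (d l))) * (Var l ^ i * ?r))"
      proof (intro spanned_sum spanned_Const)
        fix i assume "i \<in> {..<d l}"
        hence "spanned S (mono (e(l := i)))" by (intro base) (use ed in auto)
        thus "spanned S (Var l ^ i * ?r)" unfolding upd[OF l] .
      qed
      \<comment> \<open>The relation of x_l, made monic and multiplied by the part of the monomial
        that is free of x_l.\<close>
      have "Const (inverse (?c (d l))) * ?r * (\<Sum>i\<le>d l. Const (?c i) * Var l ^ i) \<in> M"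
        unfolding d_def by (rule M_mult[OF g(2)])
      also have "Const (inverse (?c (d l))) * ?r * (\<Sum>i\<le>d l. Const (?c i) * Var l ^ i) =
          Const (inverse (?c (d l)) * ?c (d l)) * (Var l ^ d l * ?r)
          + (\<Sum>i<d l. Const (inverse (?c (d l)) * ?c i) * (Var l ^ i * ?r))"
        by (simp add: lessThan_Suc_atMost[symmetric] Const_mult distrib_left sum_distrib_left mult_ac)
      also have "\<dots> = Var l * s - (\<Sum>i<d l. Const (- (?c i / ?c (d l))) * (Var l ^ i * ?r))"
        unfolding eq' using lc by (simp add: Const_uminus sum_negf divide_inverse mult.commute[of "inverse _"])
      finally show ?thesis by (rule spanned_mod[OF sp])
    qed
  qed
  have all: "\<forall>w. spanned S w \<longrightarrow> spanned S (p * w)" if "p \<in> polys N" for p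
    using that
  proof (induction p rule: polys_induct)
    case (Var i)
    show ?case using step[OF _ Var] spanned_trans[of S S "Var i"] by blast
  qed (auto simp: distrib_right mult.assoc spanned_Const spanned_add)
  have one: "spanned S 1" using base[of "\<lambda>_. 0"] d by (simp add: mono_def)
  have "spanned S (retract N p * 1)" for p by (rule all[OF retract_in, rule_format, OF one])
  hence "spanned S p" for p using spanned_mod[OF _ M_retract[of p]] by simp
  with fin show thesis by (rule that)
qed

text \<open>A spanning set of least cardinality is independent, since a relation would let one
  element be dropped. Coefficients are then unique modulo \<open>M\<close>, and uniqueness makes
  them linear.\<close>

lemma coords_exist:
  assumes "separable_extension A \<kappa>"
  shows "\<exists>n b c. quotient_coords M n b c"
proof -
  define P where "P k \<longleftrightarrow> (\<exists>S. finite S \<and> card S = k \<and> (\<forall>p. spanned S p))" for k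
  have "\<exists>k. P k" unfolding P_def using finite_spanning_set[OF assms] by metis
  hence PL: "P (LEAST k. P k)" by (rule LeastI_ex)
  define n where "n = (LEAST k. P k)"
  have min: "n \<le> k" if "P k" for k unfolding n_def using that by (rule Least_le)
  obtain S where S: "finite S" "card S = n" "\<And>p. spanned S p"
    using PL unfolding P_def n_def by blast
  have indep: "c s = 0" if c: "(\<Sum>s\<in>S. Const (c s) * s) \<in> M" and s: "s \<in> S" for c s
  proof (rule ccontr)
    assume nz: "c s \<noteq> 0"
    let ?T = "S - {s}"
    have "Const (inverse (c s)) * (\<Sum>s\<in>S. Const (c s) * s) \<in> M" by (rule M_mult[OF c])
    also have "Const (inverse (c s)) * (\<Sum>s\<in>S. Const (c s) * s) =
        Const (inverse (c s) * c s) * s + (\<Sum>t\<in>?T. Const (inverse (c s) * c t) * t)"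
      using S(1) s by (subst sum.remove[of _ s]) (auto simp: Const_mult distrib_left sum_distrib_left mult_ac)
    also have "\<dots> = s - (\<Sum>t\<in>?T. Const (- (inverse (c s) * c t)) * t)"
      using nz by (simp add: Const_uminus sum_negf)
    finally have ss: "spanned ?T s"
      unfolding spanned_def by (intro exI[of _ "\<lambda>t. - (inverse (c s) * c t)"])
    have "spanned ?T (1 * t)" if "t \<in> S" for t
      using ss spanned_base[of t ?T] that S(1) by (cases "t = s") auto
    hence "spanned ?T p" for p using spanned_trans[of S ?T 1 p] S(3) by simp
    hence "P (card ?T)" unfolding P_def using S(1) by blast
    from min[OF this] show False using S(1,2) s by (metis card_Diff1_less not_less)
  qed
  obtain b where b: "bij_betw b {..<n} S"
    using ex_bij_betw_nat_finite[OF S(1)] S(2) by (auto simp: atLeast0LessThan)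
  have re: "(\<Sum>i<n. Const (c (b i)) * b i) = (\<Sum>s\<in>S. Const (c s) * s)" for c :: "'k mpoly \<Rightarrow> 'k"
    by (rule sum.reindex_bij_betw[OF b])
  have "\<forall>p. \<exists>c. p - (\<Sum>s\<in>S. Const (c s) * s) \<in> M" using S(3) by (simp add: spanned_def)
  from choice[OF this] obtain co where co: "p - (\<Sum>s\<in>S. Const (co p s) * s) \<in> M" for p by blast
  have cu: "co p s = c s" if "p - (\<Sum>s\<in>S. Const (c s) * s) \<in> M" "s \<in> S" for p c s
  proof -
    have "(\<Sum>s\<in>S. Const (co p s - c s) * s) =
        (p - (\<Sum>s\<in>S. Const (c s) * s)) + - 1 * (p - (\<Sum>s\<in>S. Const (co p s) * s))"
      by (simp add: Const_diff left_diff_distrib sum_subtractf)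
    also have "\<dots> \<in> M" by (intro M_add that(1) M_mult co)
    finally show ?thesis using indep[of "\<lambda>s. co p s - c s" s] that(2) by simp
  qed
  define c where "c i p = (if i < n then co p (b i) else 0)" for i p
  have bS: "b i \<in> S" if "i < n" for i using b that by (auto simp: bij_betw_def)
  have "quotient_coords M n b c"
  proof
    fix i and p q :: "'k mpoly" and a
    show "c i (p + q) = c i p + c i q"
      using cu[of "p + q" "\<lambda>s. co p s + co q s" "b i"] M_add[OF co[of p] co[of q]] bS[of i]
      by (auto simp: Const_add algebra_simps sum.distrib c_def)
    show "c i (Const a * p) = a * c i p"
      using cu[of "Const a * p" "\<lambda>s. a * co p s" "b i"] M_mult[OF co[of p], of "Const a"] bS[of i]
      by (auto simp: Const_mult right_diff_distrib sum_distrib_left mult.assoc c_def)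
    show "c i p = 0" if "p \<in> M"
      using cu[of p "\<lambda>_. 0" "b i"] that bS[of i] by (simp add: c_def)
    show "p - (\<Sum>i<n. Const (c i p) * b i) \<in> M"
      using co[of p] re[of "co p"] by (simp add: c_def)
    show "c i (b l) = (if i = l then 1 else 0)" if "i < n" "l < n" for l
    proof -
      have "(\<Sum>s\<in>S. Const (if s = b l then 1 else 0) * s) = (\<Sum>s\<in>S. if s = b l then s else 0)"
        by (rule sum.cong) auto
      hence "b l - (\<Sum>s\<in>S. Const (if s = b l then 1 else 0) * s) \<in> M"
        using bS that S(1) by (simp add: M_0)
      from cu[OF this bS[of i]] show ?thesis
        using that b by (auto simp: c_def bij_betw_def inj_on_def)
    qed
  qed (use M_0 M_add M_mult in auto)
  thus ?thesis by blast
qed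

lemma some_alg_basis:
  assumes "quotient_coords M n b c" shows "alg_basis A \<kappa> (some_alg_basis A \<kappa>)"
  unfolding some_alg_basis_def using alg_basis_of_coords[OF assms] by (rule someI)

end

section \<open>The local degree at a simple zero\<close>

lemma gw_of_gram_isometric: "isometric M N \<Longrightarrow> gw_of_gram M = gw_of_gram N"
  using Quotient3_rel[OF Quotient3_form_class, of M N] by (simp add: gw_of_gram_def)

lemma gw_unit_mult_gram:
  assumes "\<epsilon> \<noteq> 0" "nondeg_sym_form G" "G \<in> carrier_mat n n"
  shows "gw_unit \<epsilon> * gw_of_gram G = gw_of_gram (mat n n (\<lambda>(i, j). \<epsilon> * G $$ (i, j)))"
proof -
  have "nondeg_sym_form (mat 1 1 (\<lambda>_. \<epsilon>))"
    using assms(1) by (auto simp: nondeg_sym_form_def det_single)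
  moreover have "kronecker (mat 1 1 (\<lambda>_. \<epsilon>)) G = mat n n (\<lambda>(i, j). \<epsilon> * G $$ (i, j))"
    by (rule eq_matI) (use assms(3) in \<open>auto simp: kronecker_def\<close>)
  ultimately show ?thesis
    using assms(2) unfolding gw_unit_def gw_of_gram_def
    by (simp add: times_gw.abs_eq times_form_class.abs_eq isometric_refl)
qed

text \<open>Used with R the polynomial ring and with R its localization. The map
  \<open>\<rho>\<close> has to be onto only modulo \<open>I\<close>, which is what allows
  polynomials to represent fractions.\<close>

lemma quotient_presentation:
  fixes R (structure) and \<rho> :: "'k::field mpoly \<Rightarrow> 'r"
  assumes R: "cring R" and I: "ideal I R"
    and \<rho>_in: "\<And>p. \<rho> p \<in> carrier R"
    and \<rho>_hom: "\<And>p q. \<rho> (p + q) = \<rho> p \<oplus> \<rho> q" "\<And>p q. \<rho> (p * q) = \<rho> p \<otimes> \<rho> q" "\<rho> 1 = \<one>"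
    and \<rho>_retract: "\<And>p. \<rho> (retract N p) = \<rho> p"
    and surj: "\<And>x. x \<in> carrier R \<Longrightarrow> \<exists>p. x \<ominus> \<rho> p \<in> I"
    and ker: "\<And>p. p \<in> M \<longleftrightarrow> \<rho> p \<in> I"
  shows "mpoly_quotient (R Quot I) M (\<lambda>p. I +> \<rho> p) N"
proof -
  interpret R: cring R by (rule R)
  interpret I: ideal I R by (rule I)
  interpret Q: cring "R Quot I" by (rule I.quotient_is_cring[OF R])
  have \<rho>0: "\<rho> 0 = \<zero>"
  proof -
    have "\<rho> 0 \<oplus> \<rho> 0 = \<rho> 0 \<oplus> \<zero>" by (simp add: \<rho>_in flip: \<rho>_hom(1))
    thus ?thesis by (simp add: \<rho>_in del: R.r_zero)
  qed
  have \<rho>minus: "\<rho> (p - q) = \<rho> p \<ominus> \<rho> q" for p q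
  proof -
    have "\<rho> (p - q) \<oplus> \<rho> q = \<rho> p" by (simp flip: \<rho>_hom(1))
    thus ?thesis using \<rho>_in by (metis R.add.inv_solve_right R.minus_eq)
  qed
  show ?thesis
  proof (unfold_locales, goal_cases)
    case 1 show ?case by (simp add: ker \<rho>0)
  next
    case (2 p q) thus ?case by (simp add: ker \<rho>_hom)
  next
    case (3 p r) thus ?case by (simp add: ker \<rho>_hom I.I_l_closed \<rho>_in)
  next
    case (4 p) show ?case by (simp add: ker \<rho>minus \<rho>_retract \<rho>_in R.minus_eq R.r_neg)
  next
    case (5 p) show ?case using \<rho>_in[of p] ring_hom_closed[OF I.rcos_ring_hom] by blast
  next
    case (6 p q) show ?case by (simp add: \<rho>_hom ring_hom_add[OF I.rcos_ring_hom] \<rho>_in)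
  next
    case (7 p q) show ?case by (simp add: \<rho>_hom ring_hom_mult[OF I.rcos_ring_hom] \<rho>_in)
  next
    case 8 show ?case by (simp add: \<rho>_hom ring_hom_one[OF I.rcos_ring_hom])
  next
    case (9 x)
    then obtain y where y: "y \<in> carrier R" "x = I +> y"
      by (auto simp: FactRing_def A_RCOSETS_def' )
    then obtain p where "y \<ominus> \<rho> p \<in> I" using surj by blast
    thus ?case using R.quotient_eq_iff_same_a_r_cos[OF I y(1) \<rho>_in] y(2) by auto
  next
    case (10 p q)
    show ?case using R.quotient_eq_iff_same_a_r_cos[OF I \<rho>_in \<rho>_in, of p q] by (simp add: ker \<rho>minus)
  qed
qed

lemma a_minus_mpoly_ring:
  assumes "p \<in> polys N" "q \<in> polys N" shows "p \<ominus>\<^bsub>mpoly_ring N\<^esub> q = p - q"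
proof -
  interpret cring "mpoly_ring N" by (rule cring_mpoly_ring)
  have "\<ominus>\<^bsub>mpoly_ring N\<^esub> q = - q" by (rule minus_equality) (use assms in auto)
  thus ?thesis by (simp add: minus_eq)
qed

text \<open>Nonzero residues obtain their inverses from the irreducible relations that
  \<open>sep\<close> provides; of the ideal itself, primality is assumed.\<close>

locale simple_zero =
  fixes \<mm> :: "'k::field mpoly set" and N :: nat and f :: "nat \<Rightarrow> 'k mpoly"
  assumes prime: "primeideal \<mm> (mpoly_ring N)"
    and f_in: "j < N \<Longrightarrow> f j \<in> polys N" and f_zero: "j < N \<Longrightarrow> f j \<in> \<mm>"
    and simple: "jacobian_det N f \<notin> \<mm>"
    and sep: "separable_extension (residue_field N \<mm>) (\<lambda>c. residue_class N \<mm> (Const c))"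
begin

interpretation P: primeideal \<mm> "mpoly_ring N" by (rule prime)

definition "M = {p. retract N p \<in> \<mm>}"

abbreviation "J \<equiv> jacobian_det N f"

lemma mm_polys: "p \<in> \<mm> \<Longrightarrow> p \<in> polys N"
  using P.a_subset by blast

lemma mm_add: "p \<in> \<mm> \<Longrightarrow> q \<in> \<mm> \<Longrightarrow> p + q \<in> \<mm>"
  using additive_subgroup.a_closed[OF P.is_additive_subgroup, of p q] by simp

lemma mm_0: "0 \<in> \<mm>"
  using additive_subgroup.zero_closed[OF P.is_additive_subgroup] by simp

lemma mm_mult: "p \<in> polys N \<Longrightarrow> q \<in> \<mm> \<Longrightarrow> p * q \<in> \<mm>"
  using P.I_l_closed[of q p] by simp

lemma mm_mult': "p \<in> \<mm> \<Longrightarrow> q \<in> polys N \<Longrightarrow> p * q \<in> \<mm>"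
  using P.I_r_closed[of p q] by simp

lemma mm_uminus: "p \<in> \<mm> \<Longrightarrow> - p \<in> \<mm>"
  using mm_mult[of "- 1" p] by simp

lemma mm_diff: "p \<in> \<mm> \<Longrightarrow> q \<in> \<mm> \<Longrightarrow> p - q \<in> \<mm>"
  using mm_add[of p "- q"] mm_uminus by simp

lemma mm_prime: "p \<in> polys N \<Longrightarrow> q \<in> polys N \<Longrightarrow> p * q \<in> \<mm> \<Longrightarrow> p \<in> \<mm> \<or> q \<in> \<mm>"
  using P.I_prime[of p q] by simp

lemma mm_1: "1 \<notin> \<mm>"
proof
  assume 1: "1 \<in> \<mm>"
  have "p \<in> \<mm>" if "p \<in> polys N" for p using mm_mult[OF that 1] by simp
  hence "polys N = \<mm>" using mm_polys by blast
  thus False using P.I_notcarr by blast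
qed

lemma in_M_iff: "p \<in> polys N \<Longrightarrow> p \<in> M \<longleftrightarrow> p \<in> \<mm>"
  by (simp add: M_def)

lemma f_M: "j < N \<Longrightarrow> f j \<in> M"
  by (simp add: in_M_iff f_in f_zero)

definition \<pi>L :: "'k mpoly \<Rightarrow> 'k mpoly set" where "\<pi>L p = residue_class N \<mm> (retract N p)"

sublocale L: mpoly_quotient "residue_field N \<mm>" M \<pi>L N
  unfolding \<pi>L_def residue_field_def residue_class_def
proof (rule quotient_presentation[OF cring_mpoly_ring P.is_ideal])
  show "\<exists>p. x \<ominus>\<^bsub>mpoly_ring N\<^esub> retract N p \<in> \<mm>" if "x \<in> polys N" for x
    using that by (intro exI[of _ x]) (simp add: a_minus_mpoly_ring mm_0)
qed (auto simp: M_def)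

lemma \<pi>L_Const: "\<pi>L (Const c) = residue_class N \<mm> (Const c)"
  by (simp add: \<pi>L_def)

lemma sep_L: "separable_extension (residue_field N \<mm>) L.\<kappa>"
  using sep by (simp add: \<pi>L_Const)

lemma J_in: "J \<in> polys N"
  by (rule jacobian_det_in[OF f_in])

lemma J_inverse: obtains y where "y \<in> polys N" "y * J - 1 \<in> M"
  using L.separable_inverse[OF sep_L _ J_in] simple by (auto simp: in_M_iff J_in)

lemma quotient_zero_axioms':
  assumes "quotient_coords M n b c" "\<And>i. b i \<in> polys N"
  shows "quotient_zero M n b c N f"
  using assms f_in f_M by (simp add: quotient_zero_def quotient_zero_axioms_def)

subsection \<open>The local algebra\<close>

abbreviation "loc \<equiv> localization N \<mm>"

lemma loc_simps [simp]:
  "x \<otimes>\<^bsub>loc\<^esub> z = x * z" "x \<oplus>\<^bsub>loc\<^esub> z = x + z" "\<one>\<^bsub>loc\<^esub> = 1" "\<zero>\<^bsub>loc\<^esub> = 0"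
  by (simp_all add: localization_def)

lemma loc_carrier:
  "x \<in> carrier loc \<longleftrightarrow> (\<exists>a b. x = Fract a b \<and> a \<in> polys N \<and> b \<in> polys N \<and> b \<notin> \<mm>)"
  by (auto simp: localization_def)

lemma not_mm_nonzero: "b \<notin> \<mm> \<Longrightarrow> b \<noteq> 0"
  using mm_0 by blast

lemma not_mm_mult: "b \<in> polys N \<Longrightarrow> b \<notin> \<mm> \<Longrightarrow> d \<in> polys N \<Longrightarrow> d \<notin> \<mm> \<Longrightarrow> b * d \<notin> \<mm>"
  using mm_prime by blast

lemma Fract_in_loc: "a \<in> polys N \<Longrightarrow> b \<in> polys N \<Longrightarrow> b \<notin> \<mm> \<Longrightarrow> Fract a b \<in> carrier loc"
  by (auto simp: loc_carrier)

lemma Fract_1_in_loc: "a \<in> polys N \<Longrightarrow> Fract a 1 \<in> carrier loc"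
  by (rule Fract_in_loc) (auto simp: mm_1)

lemma cring_loc: "cring loc"
proof (rule cringI)
  have add: "x + z \<in> carrier loc" if x: "x \<in> carrier loc" and z: "z \<in> carrier loc" for x z
  proof -
    from x obtain a b where a: "x = Fract a b" "a \<in> polys N" "b \<in> polys N" "b \<notin> \<mm>" unfolding loc_carrier by blast
    from z obtain c d where c: "z = Fract c d" "c \<in> polys N" "d \<in> polys N" "d \<notin> \<mm>" unfolding loc_carrier by blast
    have "x + z = Fract (a * d + c * b) (b * d)"
      unfolding a(1) c(1) by (rule add_fract) (use a c not_mm_nonzero in auto)
    also have "\<dots> \<in> carrier loc" by (rule Fract_in_loc) (use a c not_mm_mult in auto)
    finally show ?thesis .
  qed
  have mult: "x * z \<in> carrier loc" if x: "x \<in> carrier loc" and z: "z \<in> carrier loc" for x z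
  proof -
    from x obtain a b where a: "x = Fract a b" "a \<in> polys N" "b \<in> polys N" "b \<notin> \<mm>" unfolding loc_carrier by blast
    from z obtain c d where c: "z = Fract c d" "c \<in> polys N" "d \<in> polys N" "d \<notin> \<mm>" unfolding loc_carrier by blast
    have "x * z = Fract (a * c) (b * d)" unfolding a(1) c(1) by (rule mult_fract)
    also have "\<dots> \<in> carrier loc" by (rule Fract_in_loc) (use a c not_mm_mult in auto)
    finally show ?thesis .
  qed
  have minus: "- x \<in> carrier loc" if x: "x \<in> carrier loc" for x
  proof -
    from x obtain a b where a: "x = Fract a b" "a \<in> polys N" "b \<in> polys N" "b \<notin> \<mm>" unfolding loc_carrier by blast
    have "- x = Fract (- a) b" unfolding a(1) by (rule minus_fract)
    also have "\<dots> \<in> carrier loc" by (rule Fract_in_loc) (use a in auto)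
    finally show ?thesis .
  qed
  have one: "1 \<in> carrier loc" and zero: "0 \<in> carrier loc"
    using Fract_1_in_loc[OF polys_1] Fract_1_in_loc[OF polys_0]
    by (simp_all add: One_fract_def Zero_fract_def)
  show "abelian_group loc"
  proof (rule abelian_groupI)
    fix x assume "x \<in> carrier loc"
    thus "\<exists>y\<in>carrier loc. y \<oplus>\<^bsub>loc\<^esub> x = \<zero>\<^bsub>loc\<^esub>"
      by (intro bexI[of _ "- x"]) (auto simp: minus)
  qed (auto simp: add zero add_ac)
  show "Group.comm_monoid loc"
    by unfold_locales (auto simp: mult one mult_ac)
qed (auto simp: distrib_right)

lemma a_minus_loc:
  assumes "x \<in> carrier loc" "z \<in> carrier loc" shows "x \<ominus>\<^bsub>loc\<^esub> z = x - z"
proof -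
  interpret cring loc by (rule cring_loc)
  have "z + \<ominus>\<^bsub>loc\<^esub> z = 0" using assms(2) r_neg[of z] by simp
  hence "\<ominus>\<^bsub>loc\<^esub> z = - z" by (simp add: eq_neg_iff_add_eq_0 add.commute)
  thus ?thesis by (simp add: minus_eq)
qed

abbreviation "I \<equiv> local_ideal N \<mm> f"

lemma ideal_I: "ideal I loc"
proof -
  interpret cring loc by (rule cring_loc)
  show ?thesis unfolding local_ideal_def
    by (rule genideal_ideal) (auto intro!: Fract_1_in_loc f_in)
qed

lemma f_in_I: "j < N \<Longrightarrow> Fract (f j) 1 \<in> I"
proof -
  assume j: "j < N"
  interpret cring loc by (rule cring_loc)
  have "(\<lambda>i. Fract (f i) 1) ` {..<N} \<subseteq> I" unfolding local_ideal_def
    by (rule genideal_self) (auto intro!: Fract_1_in_loc f_in)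
  thus ?thesis using j by blast
qed

text \<open>The fractions with numerator in \<open>\<mm>\<close> form an ideal of the local ring,
  and it contains the generators of \<open>I\<close>.\<close>

lemma I_subset: "x \<in> I \<Longrightarrow> \<exists>a b. x = Fract a b \<and> a \<in> \<mm> \<and> b \<in> polys N \<and> b \<notin> \<mm>"
proof -
  assume x: "x \<in> I"
  interpret cring loc by (rule cring_loc)
  let ?K = "{Fract a b | a b. a \<in> \<mm> \<and> b \<in> polys N \<and> b \<notin> \<mm>}"
  have K: "Fract a b \<in> ?K" if "a \<in> \<mm>" "b \<in> polys N" "b \<notin> \<mm>" for a b using that by blast
  have mult: "z * w \<in> ?K" if z: "z \<in> ?K" and w: "w \<in> carrier loc" for z w
  proof -
    from z obtain a b where a: "z = Fract a b" "a \<in> \<mm>" "b \<in> polys N" "b \<notin> \<mm>" by blast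
    from w obtain c d where c: "w = Fract c d" "c \<in> polys N" "d \<in> polys N" "d \<notin> \<mm>" unfolding loc_carrier by blast
    have "z * w = Fract (a * c) (b * d)" unfolding a(1) c(1) by (rule mult_fract)
    also have "\<dots> \<in> ?K" by (rule K) (use a c not_mm_mult mm_mult' in auto)
    finally show ?thesis .
  qed
  have "ideal ?K loc"
  proof (rule idealI)
    show "ring loc" by (rule ring_axioms)
    show "subgroup ?K (add_monoid loc)"
    proof (rule add.subgroupI, goal_cases)
      case 1 show ?case using mm_polys by (auto intro!: Fract_in_loc)
    next
      case 2 show ?case using K[OF mm_0 polys_1 mm_1] by blast
    next
      case (3 z)
      then obtain a b where a: "z = Fract a b" "a \<in> \<mm>" "b \<in> polys N" "b \<notin> \<mm>" by blast
      have z: "z \<in> carrier loc" unfolding a(1) using a mm_polys by (auto intro!: Fract_in_loc)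
      have "\<ominus>\<^bsub>loc\<^esub> z = 0 - z"
        using a_minus_loc[OF _ z, of 0] z zero_closed by (simp add: minus_eq)
      also have "\<dots> = Fract (- a) b" by (simp add: a(1))
      also have "\<dots> \<in> ?K" by (rule K) (use a mm_uminus in auto)
      finally show ?case by (simp add: a_inv_def)
    next
      case (4 z w)
      from 4(1) obtain a b where a: "z = Fract a b" "a \<in> \<mm>" "b \<in> polys N" "b \<notin> \<mm>" by blast
      from 4(2) obtain c d where c: "w = Fract c d" "c \<in> \<mm>" "d \<in> polys N" "d \<notin> \<mm>" by blast
      have "z + w = Fract (a * d + c * b) (b * d)"
        unfolding a(1) c(1) by (rule add_fract) (use a c not_mm_nonzero in auto)
      also have "\<dots> \<in> ?K" by (rule K) (use a c not_mm_mult mm_mult' mm_add in auto)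
      finally show ?case by simp
    qed
  qed (use mult in \<open>simp_all add: mult.commute\<close>)
  moreover have "(\<lambda>i. Fract (f i) 1) ` {..<N} \<subseteq> ?K" using K[OF f_zero polys_1 mm_1] by blast
  ultimately have "I \<subseteq> ?K" unfolding local_ideal_def by (rule genideal_minimal)
  thus ?thesis using x by blast
qed

text \<open>The f_j generate the maximal ideal of the local ring. The witness \<open>u\<close> with
  u p in the ideal of the f_j is congruent to J modulo \<open>\<mm>\<close>, hence a permitted
  denominator, and dividing by it puts p into \<open>I\<close>.\<close>

lemma Fract_in_I_iff:
  assumes p: "p \<in> polys N" shows "Fract p 1 \<in> I \<longleftrightarrow> p \<in> \<mm>"
proof
  assume "Fract p 1 \<in> I"
  from I_subset[OF this] obtain a b
    where a: "Fract p 1 = Fract a b" "a \<in> \<mm>" "b \<in> polys N" "b \<notin> \<mm>" by (elim exE conjE)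
  hence "p * b = a" using not_mm_nonzero by (simp add: eq_fract)
  thus "p \<in> \<mm>" using mm_prime[OF p a(3)] a by blast
next
  assume pm: "p \<in> \<mm>"
  interpret R: cring loc by (rule cring_loc)
  interpret I: ideal I loc by (rule ideal_I)
  obtain n b c where "quotient_coords M n b c" using L.coords_exist[OF sep_L] by blast
  hence basis: "alg_basis (residue_field N \<mm>) L.\<kappa> (some_alg_basis (residue_field N \<mm>) L.\<kappa>)"
    by (rule L.some_alg_basis)
  let ?n = "length (some_alg_basis (residue_field N \<mm>) L.\<kappa>)"
  obtain b c where Q: "quotient_coords M ?n b c" "\<And>i. b i \<in> polys N"
    by (rule L.coords_of_alg_basis[OF basis]) (rule that)
  interpret Z: quotient_zero M ?n b c N f
    by (rule quotient_zero_axioms'[OF Q])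
  obtain u where u: "u \<in> polys N" "u - J \<in> M"
    "\<forall>h \<in> polys N \<inter> M. \<exists>g. (\<forall>j<N. g j \<in> polys N) \<and> u * h = (\<Sum>j<N. g j * f j)"
    using Z.zero_scheme_reduced .
  have um: "u \<notin> \<mm>"
  proof
    assume "u \<in> \<mm>"
    moreover have "u - J \<in> \<mm>" using u(1,2) J_in by (simp add: in_M_iff)
    ultimately have "u - (u - J) \<in> \<mm>" by (rule mm_diff)
    thus False using simple by simp
  qed
  obtain g where g: "\<forall>j<N. g j \<in> polys N" "u * p = (\<Sum>j<N. g j * f j)"
    using bspec[OF u(3), of p] pm p by (auto simp: in_M_iff)
  have sum: "(\<Sum>j\<in>S. Fract (g j) u * Fract (f j) 1) \<in> I" if "S \<subseteq> {..<N}" for S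
    using finite_subset[OF that finite_lessThan] that
  proof (induction S rule: finite_induct)
    case empty
    show ?case using additive_subgroup.zero_closed[OF I.is_additive_subgroup] by simp
  next
    case (insert j S)
    have "Fract (g j) u * Fract (f j) 1 \<in> I"
      using I.I_l_closed[OF f_in_I, of j "Fract (g j) u"] insert.prems g(1) u(1) um
      by (auto intro!: Fract_in_loc)
    thus ?case using additive_subgroup.a_closed[OF I.is_additive_subgroup, of "Fract (g j) u * Fract (f j) 1" "\<Sum>j\<in>S. Fract (g j) u * Fract (f j) 1"] insert by simp
  qed
  have Fsum: "Fract (\<Sum>j\<in>S. h j) u = (\<Sum>j\<in>S. Fract (h j) u)" for S :: "nat set" and h
  proof (induction S rule: infinite_finite_induct)
    case (insert x S)
    have "Fract (h x) u + Fract (sum h S) u = Fract (h x * u + sum h S * u) (u * u)"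
      using not_mm_nonzero[OF um] by (rule add_fract) (rule not_mm_nonzero[OF um])
    also have "\<dots> = Fract (h x + sum h S) u"
      using not_mm_nonzero[OF um] by (subst eq_fract) (auto simp: algebra_simps)
    finally show ?case using insert by simp
  qed (use not_mm_nonzero[OF um] in \<open>auto simp: Zero_fract_def eq_fract\<close>)
  have "Fract p 1 = Fract (u * p) u"
    using not_mm_nonzero[OF um] by (subst eq_fract) (auto simp: mult_ac)
  also have "\<dots> = (\<Sum>j<N. Fract (g j) u * Fract (f j) 1)"
    unfolding g(2) Fsum by simp
  also have "\<dots> \<in> I" by (rule sum) simp
  finally show "Fract p 1 \<in> I" .
qed

abbreviation "A \<equiv> local_algebra N \<mm> f"

definition \<pi>A :: "'k mpoly \<Rightarrow> 'k mpoly fract set" where "\<pi>A p = local_class N \<mm> f (retract N p)"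

text \<open>The ideal is the same \<open>M\<close> as for the residue field: in this sense the local
  algebra is k(s).\<close>

sublocale A: mpoly_quotient A M \<pi>A N
  unfolding \<pi>A_def local_algebra_def local_class_def
proof (rule quotient_presentation[OF cring_loc ideal_I])
  interpret I: ideal I loc by (rule ideal_I)
  show "p \<in> M \<longleftrightarrow> Fract (retract N p) 1 \<in> I" for p
    by (simp add: M_def Fract_in_I_iff)
  show "\<exists>p. x \<ominus>\<^bsub>loc\<^esub> Fract (retract N p) 1 \<in> I" if x: "x \<in> carrier loc" for x
  proof -
    from x obtain a b where a: "x = Fract a b" "a \<in> polys N" "b \<in> polys N" "b \<notin> \<mm>" unfolding loc_carrier by blast
    \<comment> \<open>The fraction a / b is represented by a y with y inverse to b modulo
      \<open>\<mm>\<close>; the difference a (1 - y b) / b has its numerator in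
      \<open>\<mm>\<close>.\<close>
    obtain y where y: "y \<in> polys N" "y * b - 1 \<in> M"
      using L.separable_inverse[OF sep_L _ a(3)] a by (auto simp: in_M_iff)
    have m: "a * (1 - y * b) \<in> \<mm>"
    proof -
      have "y * b - 1 \<in> \<mm>" using y a(3) in_M_iff[of "y * b - 1"] by simp
      from mm_mult[OF a(2) mm_uminus[OF this]] show ?thesis by simp
    qed
    have b0: "b \<noteq> 0" by (rule not_mm_nonzero[OF a(4)])
    have "x - Fract (a * y) 1 = Fract 1 b * Fract (a * (1 - y * b)) 1"
      unfolding a(1) using b0 by (simp add: algebra_simps)
    also have "\<dots> \<in> I"
      using I.I_l_closed[of "Fract (a * (1 - y * b)) 1" "Fract 1 b"] m mm_polys[OF m] a
      by (auto simp: Fract_in_I_iff Fract_in_loc)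
    finally show ?thesis
      using x a y by (intro exI[of _ "a * y"]) (simp add: a_minus_loc Fract_1_in_loc)
  qed
qed (auto simp: Fract_1_in_loc One_fract_def)

lemma \<pi>A_eq: "p \<in> polys N \<Longrightarrow> local_class N \<mm> f p = \<pi>A p"
  by (simp add: \<pi>A_def)

text \<open>
  The Scheja--Storch functional is \<open>x \<mapsto> Tr(x / J)\<close>, so its form is isometric to \<open>(x, y) \<mapsto> Tr(J x y)\<close>.
\<close>

theorem local_degree_simple_zero:
  assumes \<epsilon>: "\<epsilon> * \<epsilon> = 1"
  shows "gw_unit \<epsilon> * local_degree N \<mm> f =
    trace_gw_unit (residue_field N \<mm>) (\<lambda>c. residue_class N \<mm> (Const c)) (residue_class N \<mm> (Const \<epsilon> * J))"
proof -
  let ?L = "residue_field N \<mm>"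
  let ?bL = "some_alg_basis ?L L.\<kappa>" and ?bA = "some_alg_basis A A.\<kappa>"
  let ?D = "bezoutian N f"
  \<comment> \<open>This first basis only certifies that the chosen bases of both algebras are
    bases; they replace it immediately.\<close>
  from L.coords_exist[OF sep_L] obtain n0 b0 c0 where Q0: "quotient_coords M n0 b0 c0" by (elim exE)
  obtain b c where Q: "quotient_coords M (length ?bL) b c" and b_in: "\<And>i. b i \<in> polys N"
    and b_eq: "\<And>i. i < length ?bL \<Longrightarrow> \<pi>L (b i) = ?bL ! i"
    and c_eq: "\<And>i p. i < length ?bL \<Longrightarrow> c i p = alg_coords ?L L.\<kappa> ?bL (\<pi>L p) $ i"
    by (rule L.coords_of_alg_basis[OF L.some_alg_basis[OF Q0]]) (rule that)
  obtain b' c' where Q': "quotient_coords M (length ?bA) b' c'" and b'_in: "\<And>i. b' i \<in> polys N"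
    and b'_eq: "\<And>i. i < length ?bA \<Longrightarrow> \<pi>A (b' i) = ?bA ! i"
    by (rule A.coords_of_alg_basis[OF A.some_alg_basis[OF Q0]]) (rule that)
  interpret Z: quotient_zero M "length ?bL" b c N f by (rule quotient_zero_axioms'[OF Q b_in])
  obtain y where y_in: "y \<in> polys N" and y: "y * J - 1 \<in> M" using J_inverse .

  \<comment> \<open>The trace kills \<open>M\<close>, so the chosen representative does not matter;
    the restriction meets the requirement that the functional be extensional.\<close>
  define \<eta> where "\<eta> = restrict (\<lambda>x. Z.tr ((SOME p. \<pi>A p = x) * y)) (carrier A)"
  have \<eta>: "\<eta> (\<pi>A p) = Z.tr (p * y)" for p
  proof -
    have "\<pi>A (SOME q. \<pi>A q = \<pi>A p) = \<pi>A p" by (rule someI) (rule refl)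
    hence "(SOME q. \<pi>A q = \<pi>A p) - p \<in> M" by (simp add: A.pi_eq_iff)
    from Z.M_mult'[OF this, of y] show ?thesis
      unfolding \<eta>_def by (simp add: Z.tr_cong left_diff_distrib)
  qed
  have D: "?D \<in> polys2 N" by (rule bezoutian_in[OF f_in])
  \<comment> \<open>Translates the normalization of the functional from the local algebra into a
    congruence modulo \<open>M\<close>. It is stated for arbitrary \<open>\<theta>\<close> to serve
    both existence and uniqueness.\<close>
  have unit: "finsum A (\<lambda>m. local_class N \<mm> f (Const (\<theta> (local_class N \<mm> f (Poly_Mapping.lookup ?D m))))
        \<otimes>\<^bsub>A\<^esub> local_class N \<mm> f (Poly_Mapping.single m 1)) (Poly_Mapping.keys ?D) = \<one>\<^bsub>A\<^esub> \<longleftrightarrow>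
      contract (\<lambda>a b. Const (\<theta> (\<pi>A a)) * b) ?D - 1 \<in> M" for \<theta>
  proof -
    have "finsum A (\<lambda>m. local_class N \<mm> f (Const (\<theta> (local_class N \<mm> f (Poly_Mapping.lookup ?D m))))
        \<otimes>\<^bsub>A\<^esub> local_class N \<mm> f (Poly_Mapping.single m 1)) (Poly_Mapping.keys ?D) =
      finsum A (\<lambda>m. \<pi>A (Const (\<theta> (\<pi>A (Poly_Mapping.lookup ?D m))) * Poly_Mapping.single m 1)) (Poly_Mapping.keys ?D)"
    proof (rule A.finsum_cong')
      fix m assume m: "m \<in> Poly_Mapping.keys ?D"
      have s: "Poly_Mapping.single m 1 \<in> polys N" using m D by (auto simp: polys2_def polys_iff)
      have l: "Poly_Mapping.lookup ?D m \<in> polys N" using D by (auto simp: polys2_def)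
      show "local_class N \<mm> f (Const (\<theta> (local_class N \<mm> f (Poly_Mapping.lookup ?D m))))
          \<otimes>\<^bsub>A\<^esub> local_class N \<mm> f (Poly_Mapping.single m 1) =
          \<pi>A (Const (\<theta> (\<pi>A (Poly_Mapping.lookup ?D m))) * Poly_Mapping.single m 1)"
        by (simp only: \<pi>A_eq[OF s] \<pi>A_eq[OF l] \<pi>A_eq[OF polys_Const] A.pi_mult)
    qed auto
    also have "\<dots> = \<pi>A (contract (\<lambda>a b. Const (\<theta> (\<pi>A a)) * b) ?D)"
      unfolding contract_def by (rule A.pi_sum[symmetric]) simp
    finally show ?thesis using A.pi_eq_iff[of _ 1] by (simp add: A.pi_1)
  qed
  have functional: "scheja_storch_functional N \<mm> f \<eta>"
    unfolding scheja_storch_functional_def Let_def unit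
  proof (intro conjI ballI allI)
    show "\<eta> \<in> extensional (carrier A)" by (simp add: \<eta>_def)
    show "\<eta> (x \<oplus>\<^bsub>A\<^esub> z) = \<eta> x + \<eta> z" if x: "x \<in> carrier A" and z: "z \<in> carrier A" for x z
    proof -
      from A.pi_surj[OF x] A.pi_surj[OF z] obtain p q where "x = \<pi>A p" "z = \<pi>A q" by metis
      thus ?thesis by (simp add: \<eta> distrib_right Z.tr_add flip: A.pi_add)
    qed
    show "\<eta> (local_class N \<mm> f (Const a) \<otimes>\<^bsub>A\<^esub> x) = a * \<eta> x" if x: "x \<in> carrier A" for a x
    proof -
      from A.pi_surj[OF x] obtain p where "x = \<pi>A p" by metis
      thus ?thesis by (simp add: \<pi>A_eq \<eta> mult.assoc Z.tr_Const flip: A.pi_mult)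
    qed
    show "contract (\<lambda>a b. Const (\<eta> (\<pi>A a)) * b) ?D - 1 \<in> M"
      unfolding \<eta> by (rule Z.trace_functional[OF y_in y])
  qed
  have unique: "\<theta> = \<eta>" if \<theta>: "scheja_storch_functional N \<mm> f \<theta>" for \<theta>
  proof (rule extensionalityI)
    note \<theta>' = \<theta>[unfolded scheja_storch_functional_def Let_def unit]
    have add: "\<theta> (x \<oplus>\<^bsub>A\<^esub> z) = \<theta> x + \<theta> z" if "x \<in> carrier A" "z \<in> carrier A" for x z
      using \<theta>' that by blast
    have smult: "\<theta> (local_class N \<mm> f (Const a) \<otimes>\<^bsub>A\<^esub> x) = a * \<theta> x" if "x \<in> carrier A" for a x
      using \<theta>' that by blast
    show "\<theta> \<in> extensional (carrier A)" using \<theta>' by blast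
    show "\<eta> \<in> extensional (carrier A)" by (simp add: \<eta>_def)
    fix x assume x: "x \<in> carrier A"
    then obtain p where p: "p \<in> polys N" "\<pi>A p = x" using A.pi_surj_polys by blast
    have "\<theta> (\<pi>A p) = Z.tr (p * y)"
    proof (rule Z.trace_functional_unique[OF y_in y, where \<eta> = "\<lambda>p. \<theta> (\<pi>A p)"])
      show "\<theta> (\<pi>A (p + q)) = \<theta> (\<pi>A p) + \<theta> (\<pi>A q)" for p q by (simp add: A.pi_add add)
      show "\<theta> (\<pi>A (Const c * p)) = c * \<theta> (\<pi>A p)" for c p
        using smult[of "\<pi>A p" c] by (simp add: \<pi>A_eq A.pi_mult)
      show "\<theta> (\<pi>A p) = 0" if "p \<in> M" for p
      proof -
        have "\<pi>A p = \<zero>\<^bsub>A\<^esub>" using that by (simp add: A.pi_eq_0_iff)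
        moreover have "\<theta> \<zero>\<^bsub>A\<^esub> + \<theta> \<zero>\<^bsub>A\<^esub> = \<theta> \<zero>\<^bsub>A\<^esub> + 0"
          unfolding add[OF A.zero_closed A.zero_closed, symmetric] by simp
        hence "\<theta> \<zero>\<^bsub>A\<^esub> = 0" by (rule add_left_imp_eq)
        ultimately show ?thesis by simp
      qed
      show "contract (\<lambda>a b. Const (\<theta> (\<pi>A a)) * b) ?D - 1 \<in> M" using \<theta>' by blast
    qed (rule p(1))
    thus "\<theta> x = \<eta> x" using p(2) \<eta>[of p] by simp
  qed
  have THE: "(THE \<eta>. scheja_storch_functional N \<mm> f \<eta>) = \<eta>"
    using functional unique by (rule the_equality)

  \<comment> \<open>The forms a Tr(x y / J) in the basis of the local algebra and Tr(a J x y) in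
    that of the residue field. The value a = 1 gives nondegeneracy of the local form, a =
    \<open>\<epsilon>\<close> the theorem.\<close>
  let ?GA = "\<lambda>a. mat (length ?bA) (length ?bA) (\<lambda>(i, j). a * Z.tr (b' i * b' j * y))"
  let ?GL = "\<lambda>a. mat (length ?bL) (length ?bL) (\<lambda>(i, j). Z.tr (Const a * J * b i * b j))"
  have iso: "isometric (?GL a) (?GA a)" if "a * a = 1" for a
    by (rule trace_gram_isometric[OF Z.quotient_zero_axioms Q' b'_in y_in y that])
  have nondeg: "nondeg_sym_form (?GA 1)"
    using isometric_nondeg[OF isometric_sym[OF iso[of 1]]] by simp
  have \<kappa>A: "(\<lambda>c. local_class N \<mm> f (Const c)) = A.\<kappa>" by (simp add: \<pi>A_eq)
  have \<kappa>L: "(\<lambda>c. residue_class N \<mm> (Const c)) = L.\<kappa>" by (simp add: \<pi>L_Const)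
  have "local_degree N \<mm> f = gw_of_gram (mat (length ?bA) (length ?bA) (\<lambda>(i, j). \<eta> (?bA ! i \<otimes>\<^bsub>A\<^esub> ?bA ! j)))"
    by (simp only: local_degree_def Let_def gw_of_form_def THE \<kappa>A)
  also have "mat (length ?bA) (length ?bA) (\<lambda>(i, j). \<eta> (?bA ! i \<otimes>\<^bsub>A\<^esub> ?bA ! j)) = ?GA 1"
    by (rule eq_matI) (auto simp: \<eta> simp flip: b'_eq A.pi_mult)
  finally have "gw_unit \<epsilon> * local_degree N \<mm> f = gw_unit \<epsilon> * gw_of_gram (?GA 1)" by simp
  also have "\<dots> = gw_of_gram (mat (length ?bA) (length ?bA) (\<lambda>(i, j). \<epsilon> * ?GA 1 $$ (i, j)))"
    by (rule gw_unit_mult_gram[OF _ nondeg]) (use \<epsilon> in auto)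
  also have "mat (length ?bA) (length ?bA) (\<lambda>(i, j). \<epsilon> * ?GA 1 $$ (i, j)) = ?GA \<epsilon>"
    by (rule eq_matI) auto
  also have "gw_of_gram (?GA \<epsilon>) = gw_of_gram (?GL \<epsilon>)"
    by (rule gw_of_gram_isometric[OF isometric_sym[OF iso[OF \<epsilon>]]])
  also have "?GL \<epsilon> = mat (length ?bL) (length ?bL) (\<lambda>(i, j).
      alg_trace ?L L.\<kappa> (residue_class N \<mm> (Const \<epsilon> * J) \<otimes>\<^bsub>?L\<^esub> ?bL ! i \<otimes>\<^bsub>?L\<^esub> ?bL ! j))"
  proof (rule eq_matI, goal_cases)
    case (1 i j)
    hence ij: "i < length ?bL" "j < length ?bL" by auto
    have J: "residue_class N \<mm> (Const \<epsilon> * J) = \<pi>L (Const \<epsilon> * J)"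
      unfolding \<pi>L_def by (simp add: J_in)
    have "alg_trace ?L L.\<kappa> (residue_class N \<mm> (Const \<epsilon> * J) \<otimes>\<^bsub>?L\<^esub> ?bL ! i \<otimes>\<^bsub>?L\<^esub> ?bL ! j) =
        alg_trace ?L L.\<kappa> (\<pi>L (Const \<epsilon> * J * b i * b j))"
      unfolding J b_eq[OF ij(1), symmetric] b_eq[OF ij(2), symmetric] L.pi_mult ..
    also have "\<dots> = Z.tr (Const \<epsilon> * J * b i * b j)"
      by (rule L.alg_trace_eq[OF Q b_eq c_eq refl])
    finally show ?case using ij by simp
  qed auto
  also have "gw_of_gram \<dots> = trace_gw_unit ?L L.\<kappa> (residue_class N \<mm> (Const \<epsilon> * J))"
    by (simp only: trace_gw_unit_def gw_of_form_def Let_def)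
  finally show ?thesis by (simp only: \<kappa>L)
qed

lemma simple_nonzero: "p \<in> polys N \<Longrightarrow> p \<notin> \<mm> \<Longrightarrow> residue_class N \<mm> p \<noteq> \<zero>\<^bsub>residue_field N \<mm>\<^esub>"
  using L.pi_eq_0_iff[of p] by (simp add: \<pi>L_def in_M_iff)

end

section \<open>Homogeneous primes and charts\<close>

definition mdeg :: "(nat \<Rightarrow>\<^sub>0 nat) \<Rightarrow> nat" where
  "mdeg m = (\<Sum>i \<in> Poly_Mapping.keys m. Poly_Mapping.lookup m i)"

lemma mdeg_superset:
  assumes "finite S" "Poly_Mapping.keys m \<subseteq> S" shows "mdeg m = (\<Sum>i \<in> S. Poly_Mapping.lookup m i)"
  unfolding mdeg_def by (rule sum.mono_neutral_left) (use assms in \<open>auto simp: in_keys_iff\<close>)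

lemma mdeg_add: "mdeg (a + b) = mdeg a + mdeg b"
proof -
  let ?S = "Poly_Mapping.keys a \<union> Poly_Mapping.keys b"
  have "Poly_Mapping.keys (a + b) \<subseteq> ?S" by (rule keys_add)
  thus ?thesis by (simp add: mdeg_superset[of ?S] lookup_add sum.distrib)
qed

definition homog :: "nat \<Rightarrow> 'k::comm_ring_1 mpoly \<Rightarrow> bool" where
  "homog d p \<longleftrightarrow> (\<forall>m \<in> Poly_Mapping.keys p. mdeg m = d)"

lemma homog_Const: "homog 0 (Const c)" and homog_Var: "homog 1 (Var i)"
  by (simp_all add: homog_def Const_def Var_def mdeg_def)

lemma homog_add: "homog d p \<Longrightarrow> homog d q \<Longrightarrow> homog d (p + q)"
  using keys_add[of p q] by (auto simp: homog_def)

lemma homog_uminus: "homog d p \<Longrightarrow> homog d (- p)"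
  by (simp add: homog_def in_keys_iff)

lemma homog_diff: "homog d p \<Longrightarrow> homog d q \<Longrightarrow> homog d (p - q)"
  using homog_add[of d p "- q"] homog_uminus[of d q] by simp

lemma homog_mult:
  assumes "homog d p" "homog e q" shows "homog (d + e) (p * q)"
  unfolding homog_def
proof
  fix m assume "m \<in> Poly_Mapping.keys (p * q)"
  then obtain a b where "a \<in> Poly_Mapping.keys p" "b \<in> Poly_Mapping.keys q" "m = a + b"
    using keys_mult[of p q] by blast
  thus "mdeg m = d + e" using assms by (simp add: homog_def mdeg_add)
qed

section \<open>Dehomogenization, its section and homogenization\<close>

lemma dehom_simps [simp]:
  "dehom j (p + q) = dehom j p + dehom j q" "dehom j (p * q) = dehom j p * dehom j q"
  "dehom j (p - q) = dehom j p - dehom j q" "dehom j 0 = 0" "dehom j 1 = 1"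
  "dehom j (Const c) = Const c" "dehom j (- p) = - dehom j p" "dehom j (p ^ e) = dehom j p ^ e"
  by (simp_all add: dehom_def Const_eval.subst_hom)

lemma dehom_Var: "dehom j (Var l) = (if l < j then Var l else if l = j then 1 else Var (l - 1))"
  by (simp add: dehom_def)

lemma dehom_sum: "dehom j (sum g S) = (\<Sum>i\<in>S. dehom j (g i))"
  by (simp add: dehom_def Const_eval.subst_hom)

lemma dehom_in: "p \<in> polys (Suc n) \<Longrightarrow> j \<le> n \<Longrightarrow> dehom j p \<in> polys n"
  by (induction p rule: polys_induct) (auto simp: dehom_Var)

text \<open>A section of \<open>dehom j\<close>: the variables are renumbered so as to skip the
  index \<open>j\<close>.\<close>

definition chart_lift :: "nat \<Rightarrow> 'k::field mpoly \<Rightarrow> 'k mpoly" where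
  "chart_lift j = mpoly_subst Const (\<lambda>l. if l < j then Var l else Var (Suc l))"

lemma dehom_chart_lift: "g \<in> polys n \<Longrightarrow> dehom j (chart_lift j g) = g"
  by (induction g rule: polys_induct)
     (auto simp: chart_lift_def Const_eval.subst_hom dehom_Var)

lemma chart_lift_in: "g \<in> polys n \<Longrightarrow> chart_lift j g \<in> polys (Suc n)"
  by (induction g rule: polys_induct) (auto simp: chart_lift_def Const_eval.subst_hom)

text \<open>The point \<open>[c\<^sub>0 / c\<^sub>j : \<dots> : c\<^sub>n / c\<^sub>j]\<close> over the function field.\<close>

definition generic_chart_value :: "nat \<Rightarrow> 'k::field mpoly \<Rightarrow> 'k mpoly fract" where
  "generic_chart_value j = mpoly_subst (\<lambda>c. Fract (Const c) 1) (\<lambda>i. Fract (Var i) (Var j))"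

lemma Var_nonzero [simp]: "(Var j :: 'k::field mpoly) \<noteq> 0"
  unfolding Var_def by (metis lookup_single_eq lookup_zero one_neq_zero)

interpretation generic: mpoly_eval "\<lambda>c :: 'k::field. Fract (Const c) (1 :: 'k mpoly)" \<sigma> for \<sigma>
  by unfold_locales (simp_all add: Zero_fract_def One_fract_def Const_add Const_mult)

text \<open>Both sides are multiplicative and agree on the variables because c_j / c_j = 1. Hence
  the value of p at the generic point of the chart depends only on \<open>dehom j p\<close>, which
  replaces a description of the kernel of \<open>dehom j\<close>.\<close>

lemma generic_chart_value_dehom:
  assumes "p \<in> polys (Suc n)"
  shows "generic_chart_value j (chart_lift j (dehom j p)) = generic_chart_value j p"
  using assms
proof (induction p rule: polys_induct)
  case (Var i)
  have "Fract (Var j) (Var j) = (1 :: 'a mpoly fract)" by (simp add: One_fract_def eq_fract)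
  thus ?case
    by (auto simp: dehom_Var generic_chart_value_def chart_lift_def)
qed (simp_all add: generic_chart_value_def chart_lift_def generic.subst_hom Const_eval.subst_hom)

lemma generic_chart_value_cong:
  assumes "p \<in> polys (Suc n)" "q \<in> polys (Suc n)" "dehom j p = dehom j q"
  shows "generic_chart_value j p = generic_chart_value j q"
  using generic_chart_value_dehom[OF assms(1), of j] generic_chart_value_dehom[OF assms(2), of j] assms(3) by simp

text \<open>Powers of c_j lift every monomial to degree \<open>K\<close>. The result is homogeneous
  when \<open>K\<close> bounds the degrees, as the subtraction is truncated.\<close>

definition homogenize :: "nat \<Rightarrow> nat \<Rightarrow> 'k::field mpoly \<Rightarrow> 'k mpoly" where
  "homogenize j K p = (\<Sum>m \<in> Poly_Mapping.keys p.
     Poly_Mapping.single m (Poly_Mapping.lookup p m) * Var j ^ (K - mdeg m))"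

lemma generic_chart_value_single:
  "generic_chart_value j (Poly_Mapping.single m c) = Fract (Poly_Mapping.single m c) (Var j ^ mdeg m)"
proof -
  have prod: "(\<Prod>i\<in>S. Fract (Var i) (Var j) ^ e i) =
      Fract (\<Prod>i\<in>S. Var i ^ e i) (Var j ^ (\<Sum>i\<in>S. e i) :: 'a mpoly)" if "finite S" for S and e :: "nat \<Rightarrow> nat"
    using that
  proof (induction S)
    case (insert x F)
    have "Fract a b ^ l = Fract (a ^ l) (b ^ l)" for a b :: "'a mpoly" and l
      by (induction l) (simp_all add: One_fract_def)
    thus ?case using insert by (simp add: power_add)
  qed (simp add: One_fract_def)
  show ?thesis
    unfolding generic_chart_value_def generic.subst_single prod[OF finite_keys] mdeg_def
    by (simp add: single_eq_Const_Var[of m c])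
qed

lemma Fract_sum: "b \<noteq> 0 \<Longrightarrow> Fract (sum h S) b = (\<Sum>i\<in>S. Fract (h i) b)"
proof (induction S rule: infinite_finite_induct)
  case (insert x S)
  have "Fract (h x) b + Fract (sum h S) b = Fract (h x * b + sum h S * b) (b * b)"
    using insert.prems by simp
  also have "\<dots> = Fract (h x + sum h S) b"
    using insert.prems by (subst eq_fract) (auto simp: algebra_simps)
  finally show ?case using insert by simp
qed (auto simp: Zero_fract_def eq_fract)

lemma generic_chart_value_homogenize:
  assumes "\<And>m. m \<in> Poly_Mapping.keys p \<Longrightarrow> mdeg m \<le> K"
  shows "generic_chart_value j p = Fract (homogenize j K p) (Var j ^ K)"
proof -
  have "generic_chart_value j p = (\<Sum>m \<in> Poly_Mapping.keys p.
      generic_chart_value j (Poly_Mapping.single m (Poly_Mapping.lookup p m)))"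
    by (subst poly_mapping_sum_single[of p]) (simp only: generic_chart_value_def generic.subst_sum)
  also have "\<dots> = (\<Sum>m \<in> Poly_Mapping.keys p.
      Fract (Poly_Mapping.single m (Poly_Mapping.lookup p m) * Var j ^ (K - mdeg m)) (Var j ^ K))"
  proof (rule sum.cong[OF refl])
    fix m assume "m \<in> Poly_Mapping.keys p"
    hence "mdeg m \<le> K" by (rule assms)
    hence "(Var j :: 'a mpoly) ^ K = Var j ^ (K - mdeg m) * Var j ^ mdeg m" by (simp flip: power_add)
    thus "generic_chart_value j (Poly_Mapping.single m (Poly_Mapping.lookup p m)) =
        Fract (Poly_Mapping.single m (Poly_Mapping.lookup p m) * Var j ^ (K - mdeg m)) (Var j ^ K)"
      by (simp add: generic_chart_value_single eq_fract mult_ac)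
  qed
  finally show ?thesis by (simp add: homogenize_def Fract_sum)
qed

lemma dehom_homogenize: "dehom j (homogenize j K p) = dehom j p"
proof -
  have "dehom j (homogenize j K p) =
      dehom j (\<Sum>m \<in> Poly_Mapping.keys p. Poly_Mapping.single m (Poly_Mapping.lookup p m))"
    by (simp add: homogenize_def dehom_sum dehom_Var)
  thus ?thesis by (simp flip: poly_mapping_sum_single)
qed

lemma homogenize_homog: "homog d p \<Longrightarrow> homogenize j d p = p"
  unfolding homogenize_def by (simp add: homog_def flip: poly_mapping_sum_single)

lemma homogenize_in: "p \<in> polys n \<Longrightarrow> j < n \<Longrightarrow> homogenize j K p \<in> polys n"
  unfolding homogenize_def
  by (intro polys_sum polys_mult polys_power polys_Var) (auto simp: polys_iff split: if_splits)

text \<open>Grouping monomials by degree exhibits the homogenization as a combination of homogeneous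
  components, which a homogeneous ideal contains.\<close>

lemma homogenize_hom_component:
  assumes "\<And>m. m \<in> Poly_Mapping.keys p \<Longrightarrow> mdeg m \<le> K"
  shows "homogenize j K p = (\<Sum>d\<le>K. hom_component d p * Var j ^ (K - d))"
proof -
  have "(\<Sum>d\<le>K. hom_component d p * Var j ^ (K - d)) =
      (\<Sum>d\<le>K. \<Sum>m \<in> {m \<in> Poly_Mapping.keys p. mdeg m = d}.
        Poly_Mapping.single m (Poly_Mapping.lookup p m) * Var j ^ (K - mdeg m))"
    unfolding hom_component_def mdeg_def[symmetric] by (intro sum.cong refl) (auto simp: sum_distrib_right)
  also have "\<dots> = homogenize j K p"
    unfolding homogenize_def by (rule sum.group) (use assms in auto)
  finally show ?thesis by simp
qed

lemma mdeg_bound: obtains K where "\<And>m. m \<in> Poly_Mapping.keys p \<Longrightarrow> mdeg m \<le> K"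
  using finite_imageI[OF finite_keys, of mdeg p] Max_ge by (metis image_eqI)

section \<open>The prime ideal of a projective point in a chart\<close>

locale chart_point =
  fixes s :: "'k::field mpoly set" and n j :: nat
  assumes point: "proj_point n s" and j: "j \<le> n" "Var j \<notin> s"
begin

interpretation S: primeideal s "mpoly_ring (Suc n)"
  using point by (simp add: proj_point_def)

lemma s_in: "p \<in> s \<Longrightarrow> p \<in> polys (Suc n)"
  using S.a_subset by blast

lemma s_add: "p \<in> s \<Longrightarrow> q \<in> s \<Longrightarrow> p + q \<in> s"
  using additive_subgroup.a_closed[OF S.is_additive_subgroup, of p q] by simp

lemma s_0: "0 \<in> s"
  using additive_subgroup.zero_closed[OF S.is_additive_subgroup] by simp

lemma s_sum: "(\<And>i. i \<in> T \<Longrightarrow> g i \<in> s) \<Longrightarrow> sum g T \<in> s"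
  by (induction T rule: infinite_finite_induct) (auto simp: s_0 s_add)

lemma s_mult: "p \<in> s \<Longrightarrow> q \<in> polys (Suc n) \<Longrightarrow> p * q \<in> s"
  using S.I_r_closed[of p q] by simp

lemma s_prime: "p \<in> polys (Suc n) \<Longrightarrow> q \<in> polys (Suc n) \<Longrightarrow> p * q \<in> s \<Longrightarrow> p \<in> s \<or> q \<in> s"
  using S.I_prime[of p q] by simp

lemma Var_in: "Var j \<in> polys (Suc n)"
  using j by simp

lemma s_1: "1 \<notin> s"
  using s_mult[OF _ Var_in, of 1] j(2) by auto

lemma s_power: "Var j ^ K \<notin> s"
  by (induction K) (use s_prime[OF Var_in polys_power[OF Var_in]] s_1 j(2) in auto)

lemma s_cancel: "p \<in> polys (Suc n) \<Longrightarrow> p * Var j ^ K \<in> s \<Longrightarrow> p \<in> s"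
  using s_prime[of p "Var j ^ K"] s_power Var_in by auto

lemma homogenize_in_s:
  assumes "p \<in> s" "\<And>m. m \<in> Poly_Mapping.keys p \<Longrightarrow> mdeg m \<le> K"
  shows "homogenize j K p \<in> s"
proof -
  have "homogenize j K p = (\<Sum>d\<le>K. hom_component d p * Var j ^ (K - d))"
    using assms(2) by (rule homogenize_hom_component)
  also have "\<dots> \<in> s"
    using point assms(1) by (intro s_sum s_mult polys_power Var_in) (auto simp: proj_point_def)
  finally show ?thesis .
qed

text \<open>An element of the chart ideal has many preimages under \<open>dehom j\<close>, not all
  of them in s. The homogenization P of one that lies in s determines the generic value of all
  others, which turns equations in the chart into equations between polynomials after clearing
  powers of c_j.\<close>

lemma chart_ideal_witness:
  assumes "g \<in> chart_ideal j s"
  obtains P K where "P \<in> s" "g = dehom j P"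
    "\<And>q. q \<in> polys (Suc n) \<Longrightarrow> dehom j q = g \<Longrightarrow> generic_chart_value j q = Fract P (Var j ^ K)"
proof -
  from assms obtain p where p: "p \<in> s" "g = dehom j p" by (auto simp: chart_ideal_def)
  obtain K where K: "\<And>m. m \<in> Poly_Mapping.keys p \<Longrightarrow> mdeg m \<le> K" using mdeg_bound[of p] by blast
  show thesis
  proof (rule that[of "homogenize j K p" K])
    show "homogenize j K p \<in> s" by (rule homogenize_in_s[OF p(1) K])
    show "g = dehom j (homogenize j K p)" by (simp add: p(2) dehom_homogenize)
    fix q assume "q \<in> polys (Suc n)" "dehom j q = g"
    hence "generic_chart_value j q = generic_chart_value j p"
      using generic_chart_value_cong[of q n p j] s_in[OF p(1)] p(2) by simp
    thus "generic_chart_value j q = Fract (homogenize j K p) (Var j ^ K)"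
      using generic_chart_value_homogenize[OF K] by simp
  qed
qed

text \<open>The generic value of p is p / c_j^d, and also P / c_j^K for some P in s. So p c_j^K lies
  in s, and c_j cancels because s is prime and does not contain it.\<close>

lemma chart_ideal_homog:
  assumes "homog d p" "p \<in> polys (Suc n)" "dehom j p \<in> chart_ideal j s"
  shows "p \<in> s"
proof -
  from chart_ideal_witness[OF assms(3)] obtain P K
    where P: "P \<in> s" "generic_chart_value j p = Fract P (Var j ^ K)" using assms(2) by metis
  have "generic_chart_value j p = Fract p (Var j ^ d)"
    using generic_chart_value_homogenize[of p d j] homogenize_homog[OF assms(1), of j] assms(1)
    by (simp add: homog_def)
  hence "p * Var j ^ K = P * Var j ^ d" using P(2) by (simp add: eq_fract)
  hence "p * Var j ^ K \<in> s" using s_mult[OF P(1) polys_power[OF Var_in]] by simp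
  thus ?thesis by (rule s_cancel[OF assms(2)])
qed

text \<open>For primality, a and b are replaced by homogenized lifts G and H. Comparing generic
  values shows that G H times a power of c_j lies in s, so that G or H does. Properness follows from
  the homogeneous case applied to 1.\<close>

theorem primeideal_chart_ideal: "primeideal (chart_ideal j s) (mpoly_ring n)"
proof (rule primeidealI)
  show "cring (mpoly_ring n)" by (rule cring_mpoly_ring)
  interpret R: cring "mpoly_ring n" by (rule cring_mpoly_ring)
  have sub: "chart_ideal j s \<subseteq> polys n"
    using dehom_in[OF s_in j(1)] by (auto simp: chart_ideal_def)
  have mult: "a * x \<in> chart_ideal j s" if "a \<in> chart_ideal j s" "x \<in> polys n" for a x
  proof -
    from that obtain p where "p \<in> s" "a = dehom j p" by (auto simp: chart_ideal_def)
    moreover from this(1) have "p * chart_lift j x \<in> s" by (rule s_mult[OF _ chart_lift_in[OF that(2)]])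
    moreover have "dehom j (p * chart_lift j x) = dehom j p * x" by (simp add: dehom_chart_lift[OF that(2)])
    ultimately show ?thesis unfolding chart_ideal_def by (metis image_eqI)
  qed
  show "ideal (chart_ideal j s) (mpoly_ring n)"
  proof (rule idealI)
    show "subgroup (chart_ideal j s) (add_monoid (mpoly_ring n))"
    proof (rule R.add.subgroupI, goal_cases)
      case 1 show ?case using sub by simp
    next
      case 2 show ?case using s_0 by (auto simp: chart_ideal_def)
    next
      case (3 a)
      have "\<ominus>\<^bsub>mpoly_ring n\<^esub> a = - a" by (rule R.minus_equality) (use 3 sub in auto)
      thus ?case using mult[OF 3, of "- 1"] by (simp add: a_inv_def)
    next
      case (4 a b)
      then obtain p q where "p \<in> s" "a = dehom j p" "q \<in> s" "b = dehom j q"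
        by (auto simp: chart_ideal_def)
      hence "a + b = dehom j (p + q)" "p + q \<in> s" by (auto simp: s_add)
      hence "a + b \<in> chart_ideal j s" unfolding chart_ideal_def by (rule image_eqI)
      thus ?case by simp
    qed
  qed (use mult in \<open>simp_all add: R.ring_axioms mult.commute\<close>)
  show "carrier (mpoly_ring n) \<noteq> chart_ideal j s"
  proof
    assume eq: "carrier (mpoly_ring n) = chart_ideal j s"
    have "1 \<in> chart_ideal j s" by (rule eq[THEN equalityD1, THEN subsetD, OF polys_1])
    moreover have "homog 0 (1 :: 'k mpoly)" using homog_Const[of 1] by simp
    ultimately have "1 \<in> s" using chart_ideal_homog[of 0 1] by simp
    thus False using s_1 by contradiction
  qed
  fix a b assume a: "a \<in> polys n" and b: "b \<in> polys n"
    and "a \<otimes>\<^bsub>mpoly_ring n\<^esub> b \<in> chart_ideal j s"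
  hence ab: "a * b \<in> chart_ideal j s" by simp
  have rep: "\<exists>G K. G \<in> polys (Suc n) \<and> dehom j G = x \<and> generic_chart_value j G = Fract G (Var j ^ K)"
    if x: "x \<in> polys n" for x
  proof -
    obtain K where K: "\<And>m. m \<in> Poly_Mapping.keys (chart_lift j x) \<Longrightarrow> mdeg m \<le> K"
      using mdeg_bound[of "chart_lift j x"] by blast
    let ?G = "homogenize j K (chart_lift j x)"
    have G: "?G \<in> polys (Suc n)" using chart_lift_in[OF x] j(1) by (intro homogenize_in) auto
    have d: "dehom j ?G = x" by (simp add: dehom_homogenize dehom_chart_lift[OF x])
    have "generic_chart_value j ?G = generic_chart_value j (chart_lift j x)"
      by (rule generic_chart_value_cong[OF G chart_lift_in[OF x]]) (simp add: dehom_homogenize)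
    thus ?thesis using G d generic_chart_value_homogenize[OF K] by metis
  qed
  obtain G K where G: "G \<in> polys (Suc n)" "dehom j G = a" "generic_chart_value j G = Fract G (Var j ^ K)"
    using rep[OF a] by blast
  obtain H L where H: "H \<in> polys (Suc n)" "dehom j H = b" "generic_chart_value j H = Fract H (Var j ^ L)"
    using rep[OF b] by blast
  have "G * H \<in> polys (Suc n)" "dehom j (G * H) = a * b" using G H by simp_all
  with chart_ideal_witness[OF ab] obtain P M
    where P: "P \<in> s" "generic_chart_value j (G * H) = Fract P (Var j ^ M)" by metis
  have "generic_chart_value j (G * H) = Fract (G * H) (Var j ^ K * Var j ^ L)"
    using G(3) H(3) by (simp add: generic_chart_value_def generic.subst_mult)
  hence "G * H * Var j ^ M = P * (Var j ^ K * Var j ^ L)" using P(2) by (simp add: eq_fract)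
  hence "G * H * Var j ^ M \<in> s" 
    using s_mult[OF P(1) polys_mult[OF polys_power[OF Var_in] polys_power[OF Var_in]]] by simp
  hence "G * H \<in> s" using s_cancel[of "G * H" M] G(1) H(1) by simp
  hence "G \<in> s \<or> H \<in> s" using s_prime[OF G(1) H(1)] by blast
  thus "a \<in> chart_ideal j s \<or> b \<in> chart_ideal j s" using G(2) H(2) by (auto simp: chart_ideal_def)
qed

end

section \<open>Independence of the gradients\<close>

text \<open>The determinant with columns \<open>x\<close>, \<open>y\<close>, \<open>z\<close>,
  written out so that the facts below become polynomial identities.\<close>

definition det3 :: "(nat \<Rightarrow> 'a::comm_ring_1) \<Rightarrow> (nat \<Rightarrow> 'a) \<Rightarrow> (nat \<Rightarrow> 'a) \<Rightarrow> 'a" where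
  "det3 x y z = x 0 * (y 1 * z 2 - z 1 * y 2) - y 0 * (x 1 * z 2 - z 1 * x 2) + z 0 * (x 1 * y 2 - y 1 * x 2)"

lemma det_mat_Suc:
  "det (mat (Suc n) (Suc n) (\<lambda>(i, l). F i l)) =
     (\<Sum>j<Suc n. F 0 j * ((- 1) ^ j * det (mat n n (\<lambda>(i, l). F (Suc i) (if l < j then l else Suc l)))))"
proof -
  let ?A = "mat (Suc n) (Suc n) (\<lambda>(i, l). F i l)"
  have "mat_delete ?A 0 j = mat n n (\<lambda>(i, l). F (Suc i) (if l < j then l else Suc l))" for j
    by (rule eq_matI) (auto simp: mat_delete_def)
  moreover have "det ?A = (\<Sum>j<Suc n. ?A $$ (0, j) * cofactor ?A 0 j)"
    by (rule laplace_expansion_row) auto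
  ultimately show ?thesis by (simp add: cofactor_def del: sum.lessThan_Suc)
qed

lemma det_mat_3:
  "det (mat 3 3 (\<lambda>(i, l). F i l)) = det3 (\<lambda>i. F i 0) (\<lambda>i. F i 1) (\<lambda>i. F i (2::nat))"
proof -
  have "det (mat 0 0 h) = 1" for h :: "nat \<times> nat \<Rightarrow> 'a" by (rule det_dim_zero) simp
  thus ?thesis
    unfolding det3_def numeral_3_eq_3 det_mat_Suc numeral_2_eq_2
    by (simp add: algebra_simps)
qed

lemma skew_det3: "det3 y x z = - det3 x y z" "det3 x z y = - det3 x y z"
  by (simp_all add: det3_def algebra_simps)

text \<open>This is Cauchy-Binet for G B G^T, where G has the gradients as rows and B, with entries
  2, 2 and -1, -1, is twice the inverse Gram matrix of D. The nonzero 3 x 3 minors of B are -2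
  (columns 0, 2, 3), -2 (columns 0, 1, 3) and -4, which pairs 1, 2, 3 with 0, 1, 2 in both
  orders.\<close>

lemma gram_det_minors:
  fixes g :: "nat \<Rightarrow> nat \<Rightarrow> 'a::comm_ring_1"
  defines "Q i i' \<equiv> 2 * g i 1 * g i' 1 + 2 * g i 2 * g i' 2 - g i 0 * g i' 3 - g i 3 * g i' 0"
  defines "c l i \<equiv> g i l"
  shows "det3 (\<lambda>i. Q i 0) (\<lambda>i. Q i 1) (\<lambda>i. Q i 2) =
    - 2 * (det3 (c 0) (c 2) (c 3))\<^sup>2 - 2 * (det3 (c 0) (c 1) (c 3))\<^sup>2 - 8 * det3 (c 1) (c 2) (c 3) * det3 (c 0) (c 1) (c 2)"
  unfolding Q_def c_def det3_def
  by (simp add: algebra_simps power2_eq_square)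

text \<open>
  In terms of \<open>D = c\<^sub>1\<^sup>2 + c\<^sub>2\<^sup>2 - 4 c\<^sub>0 c\<^sub>3\<close> and the linear forms \<open>ell\<^sub>i = c\<^sub>3 + a\<^sub>i c\<^sub>1 + b\<^sub>i c\<^sub>2 + e\<^sub>i c\<^sub>0\<close>, where
  \<open>e\<^sub>i = a\<^sub>i\<^sup>2 + b\<^sub>i\<^sup>2 - r\<^sub>i\<close>, the tangency cones are \<open>ell\<^sub>i\<^sup>2 = r\<^sub>i D\<close>. At a common point, the Gram matrix of their
  gradients with respect to the form dual to \<open>D\<close> has zero diagonal, and its off-diagonal entries
  vanish exactly if two of the circles are tangent. As the point lies on all cones, Euler's relation
  makes all maximal minors of the gradients multiples of one of them.
\<close>

lemma gradients_independent:
  fixes P :: "'a::comm_ring_1 set" and \<gamma> a b r :: "nat \<Rightarrow> 'a" and j :: nat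
  defines "e i \<equiv> (a i)\<^sup>2 + (b i)\<^sup>2 - r i"
  defines "ell i \<equiv> \<gamma> 3 + a i * \<gamma> 1 + b i * \<gamma> 2 + e i * \<gamma> 0"
    and "D \<equiv> (\<gamma> 1)\<^sup>2 + (\<gamma> 2)\<^sup>2 - 4 * \<gamma> 0 * \<gamma> 3"
    and "\<beta> i i' \<equiv> 2 * a i * a i' + 2 * b i * b i' - e i - e i'"
  defines "g i l \<equiv> (if l = (0::nat) then 2 * ell i * e i + 4 * r i * \<gamma> 3
      else if l = 1 then 2 * ell i * a i - 2 * r i * \<gamma> 1
      else if l = 2 then 2 * ell i * b i - 2 * r i * \<gamma> 2 else 2 * ell i + 4 * r i * \<gamma> 0)"
  assumes P: "0 \<in> P" "\<And>x y. x \<in> P \<Longrightarrow> y \<in> P \<Longrightarrow> x + y \<in> P" "\<And>x y. y \<in> P \<Longrightarrow> x * y \<in> P" "1 \<notin> P"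
    and prime: "\<And>x y. x * y \<in> P \<Longrightarrow> x \<in> P \<or> y \<in> P"
    and two: "2 \<notin> P" and r: "\<And>i. i < 3 \<Longrightarrow> r i \<notin> P"
    and centers: "a 0 * (b 1 - b 2) + a 1 * (b 2 - b 0) + a 2 * (b 0 - b 1) \<notin> P"
    and not_tangent: "\<And>i i'. i < 3 \<Longrightarrow> i' < 3 \<Longrightarrow> i \<noteq> i' \<Longrightarrow> (\<beta> i i')\<^sup>2 - 4 * r i * r i' \<notin> P"
    and zero: "\<And>i. i < 3 \<Longrightarrow> (ell i)\<^sup>2 - r i * D \<in> P"
    and not_point: "D \<in> P \<Longrightarrow> \<gamma> 0 \<in> P"
    and j: "j < 4" "\<gamma> j = 1"
  shows "det3 (\<lambda>i. g i (if 0 < j then 0 else 1)) (\<lambda>i. g i (if 1 < j then 1 else 2)) (\<lambda>i. g i (if 2 < j then 2 else 3)) \<notin> P"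
proof
  assume minor: "det3 (\<lambda>i. g i (if 0 < j then 0 else 1)) (\<lambda>i. g i (if 1 < j then 1 else 2))
    (\<lambda>i. g i (if 2 < j then 2 else 3)) \<in> P"
  have P_mult': "x * y \<in> P" if "x \<in> P" for x y using P(3)[OF that, of y] by (simp add: mult.commute)
  have P_uminus: "- x \<in> P" if "x \<in> P" for x using P(3)[OF that, of "- 1"] by simp
  have P_diff: "x - y \<in> P" if "x \<in> P" "y \<in> P" for x y using P(2)[OF that(1) P_uminus[OF that(2)]] by simp
  have P_sq: "x \<in> P" if "x\<^sup>2 \<in> P" for x using prime[of x x] that by (auto simp: power2_eq_square)
  have P_cong: "x \<in> P \<longleftrightarrow> y \<in> P" if "x - y \<in> P" for x y
    using P(2)[OF that, of y] P_diff[OF _ that, of x] by auto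
  have i012: "(0::nat) < 3" "(1::nat) < 3" "(2::nat) < 3" by simp_all

  \<comment> \<open>If D vanished, so would \<open>\<gamma> 0\<close> and all \<open>ell i\<close>.
    What remains is a linear system in \<open>\<gamma> 3\<close>, \<open>\<gamma> 1\<close>,
    \<open>\<gamma> 2\<close> with rows (1, a_i, b_i), invertible as the centers are not collinear;
    but \<open>\<gamma> j = 1\<close>.\<close>
  have D: "D \<notin> P"
  proof
    assume D: "D \<in> P"
    have \<gamma>0: "\<gamma> 0 \<in> P" by (rule not_point[OF D])
    have ell: "ell i \<in> P" if "i < 3" for i
      using P_sq P(2)[OF zero[OF that] P(3)[OF D, of "r i"]] by simp
    have lin: "\<gamma> 3 + a i * \<gamma> 1 + b i * \<gamma> 2 \<in> P" if "i < 3" for i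
      using P_diff[OF ell[OF that] P(3)[OF \<gamma>0, of "e i"]] by (simp add: ell_def)
    let ?\<delta> = "a 0 * (b 1 - b 2) + a 1 * (b 2 - b 0) + a 2 * (b 0 - b 1)"
    let ?L = "\<lambda>i. \<gamma> 3 + a i * \<gamma> 1 + b i * \<gamma> 2"
    have comb: "x * ?L 0 + y * ?L 1 + z * ?L 2 \<in> P" for x y z
      by (intro P(2) P(3) lin i012)
    \<comment> \<open>The multipliers are the cofactors of the column of the a_i; below, those of
      the column of the b_i.\<close>
    have "(b 1 - b 2) * ?L 0 + (b 2 - b 0) * ?L 1 + (b 0 - b 1) * ?L 2 = ?\<delta> * \<gamma> 1"
      by (simp add: algebra_simps)
    hence \<gamma>1: "\<gamma> 1 \<in> P" using comb prime centers by metis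
    have "(a 2 - a 1) * ?L 0 + (a 0 - a 2) * ?L 1 + (a 1 - a 0) * ?L 2 = ?\<delta> * \<gamma> 2"
      by (simp add: algebra_simps)
    hence \<gamma>2: "\<gamma> 2 \<in> P" using comb prime centers by metis
    have "?L 0 - (a 0 * \<gamma> 1 + b 0 * \<gamma> 2) \<in> P"
      by (intro P_diff lin P(2) P(3) \<gamma>1 \<gamma>2 i012)
    hence "\<gamma> 3 \<in> P" by simp
    moreover have "j = 0 \<or> j = 1 \<or> j = 2 \<or> j = 3" using j(1) by auto
    ultimately have "\<gamma> j \<in> P" using \<gamma>0 \<gamma>1 \<gamma>2 by auto
    thus False using j(2) P(4) by simp
  qed

  have euler: "\<gamma> 0 * g i 0 + \<gamma> 1 * g i 1 + \<gamma> 2 * g i 2 + \<gamma> 3 * g i 3 \<in> P" if "i < 3" for i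
  proof -
    have "\<gamma> 0 * g i 0 + \<gamma> 1 * g i 1 + \<gamma> 2 * g i 2 + \<gamma> 3 * g i 3 = 2 * ((ell i)\<^sup>2 - r i * D)"
      by (simp add: g_def ell_def D_def algebra_simps power2_eq_square)
    thus ?thesis by (simp only: P(3)[OF zero[OF that]])
  qed
  \<comment> \<open>Modulo \<open>P\<close>, column w is a combination of x, y, z, so the two
    determinants differ by the factor -s. The coefficients in the proof are the cofactors of the
    first column.\<close>
  have exchange: "det3 w y z \<in> P"
    if w: "\<And>i. i < 3 \<Longrightarrow> w i + s * x i + t * y i + u * z i \<in> P" and x: "det3 x y z \<in> P" for w x y z s t u
  proof -
    let ?E = "\<lambda>i. w i + s * x i + t * y i + u * z i"
    have "det3 w y z = (y 1 * z 2 - z 1 * y 2) * ?E 0 + (z 0 * y 2 - y 0 * z 2) * ?E 1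
        + (y 0 * z 1 - z 0 * y 1) * ?E 2 - s * det3 x y z"
      by (simp add: det3_def algebra_simps)
    also have "\<dots> \<in> P" by (intro P_diff P(2) P(3) w x i012)
    finally show ?thesis .
  qed
  let ?c = "\<lambda>l i. g i l"
  have skew: "det3 y x z \<in> P" "det3 x z y \<in> P" if "det3 x y z \<in> P" for x y z
    using P_uminus[OF that] by (simp_all add: skew_det3(1)[of y x] skew_det3(2)[of x z])
  \<comment> \<open>Here \<open>A\<close> is j. By Euler's relation and
    \<open>\<gamma> j = 1\<close>, column \<open>A\<close> is a combination of the other three, so
    it may replace any column \<open>B\<close> of the minor that omits it.\<close>
  have ex: "det3 (?c A) (?c C) (?c E) \<in> P"
    if "\<gamma> A = 1" "det3 (?c B) (?c C) (?c E) \<in> P" "{A, B, C, E} = {0, 1, 2, 3}" "distinct [A, B, C, E]" for A B C E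
  proof (rule exchange[OF _ that(2)])
    fix i :: nat assume i: "i < 3"
    have "(\<Sum>l\<in>{A, B, C, E}. \<gamma> l * g i l) = \<gamma> 0 * g i 0 + \<gamma> 1 * g i 1 + \<gamma> 2 * g i 2 + \<gamma> 3 * g i 3"
      unfolding that(3) by (simp add: add_ac)
    thus "g i A + \<gamma> B * g i B + \<gamma> C * g i C + \<gamma> E * g i E \<in> P"
      using euler[OF i] that(1,4) by (simp add: add_ac)
  qed
  \<comment> \<open>The fourth minor, of columns 0, 1, 2, occurs in \<open>gram_det_minors\<close>
    only multiplied by that of columns 1, 2, 3.\<close>
  have minors: "det3 (?c 0) (?c 2) (?c 3) \<in> P" "det3 (?c 0) (?c 1) (?c 3) \<in> P" "det3 (?c 1) (?c 2) (?c 3) \<in> P"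
  proof -
    consider "j = 0" | "j = 1" | "j = 2" | "j = 3" using j(1) by linarith
    hence "det3 (?c 0) (?c 2) (?c 3) \<in> P \<and> det3 (?c 0) (?c 1) (?c 3) \<in> P \<and> det3 (?c 1) (?c 2) (?c 3) \<in> P"
    proof cases
      case 1
      hence \<gamma>: "\<gamma> 0 = 1" and m: "det3 (?c 1) (?c 2) (?c 3) \<in> P" using j minor by simp_all
      have "det3 (?c 0) (?c 2) (?c 3) \<in> P" by (rule ex[OF \<gamma> m]) auto
      moreover have "det3 (?c 0) (?c 1) (?c 3) \<in> P" by (rule ex[OF \<gamma> skew(1)[OF m]]) auto
      ultimately show ?thesis using m by blast
    next
      case 2
      hence \<gamma>: "\<gamma> 1 = 1" and m: "det3 (?c 0) (?c 2) (?c 3) \<in> P" using j minor by simp_all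
      have "det3 (?c 1) (?c 2) (?c 3) \<in> P" by (rule ex[OF \<gamma> m]) auto
      moreover have "det3 (?c 1) (?c 0) (?c 3) \<in> P" by (rule ex[OF \<gamma> skew(1)[OF m]]) auto
      ultimately show ?thesis using m skew(1) by blast
    next
      case 3
      hence \<gamma>: "\<gamma> 2 = 1" and m: "det3 (?c 0) (?c 1) (?c 3) \<in> P" using j minor by simp_all
      have "det3 (?c 2) (?c 1) (?c 3) \<in> P" by (rule ex[OF \<gamma> m]) auto
      moreover have "det3 (?c 2) (?c 0) (?c 3) \<in> P" by (rule ex[OF \<gamma> skew(1)[OF m]]) auto
      ultimately show ?thesis using m skew(1) by blast
    next
      case 4
      hence \<gamma>: "\<gamma> 3 = 1" and m: "det3 (?c 0) (?c 1) (?c 2) \<in> P" using j minor by simp_all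
      have m': "det3 (?c 2) (?c 0) (?c 1) \<in> P" by (rule skew(1)[OF skew(2)[OF m]])
      have "det3 (?c 3) (?c 1) (?c 2) \<in> P" by (rule ex[OF \<gamma> m]) auto
      moreover have "det3 (?c 3) (?c 0) (?c 2) \<in> P" by (rule ex[OF \<gamma> skew(1)[OF m]]) auto
      moreover have "det3 (?c 3) (?c 0) (?c 1) \<in> P" by (rule ex[OF \<gamma> m']) auto
      ultimately show ?thesis using skew by blast
    qed
    thus "det3 (?c 0) (?c 2) (?c 3) \<in> P" "det3 (?c 0) (?c 1) (?c 3) \<in> P" "det3 (?c 1) (?c 2) (?c 3) \<in> P"
      by blast+
  qed

  define Q where "Q i i' = 2 * g i 1 * g i' 1 + 2 * g i 2 * g i' 2 - g i 0 * g i' 3 - g i 3 * g i' 0" for i i'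
  have Q_sym: "Q i i' = Q i' i" for i i' by (simp add: Q_def mult_ac)
  have Q_eq: "Q i i' = 4 * (ell i * ell i' * \<beta> i i' - 2 * r i * r i' * D)
      - 8 * r i' * ((ell i)\<^sup>2 - r i * D) - 8 * r i * ((ell i')\<^sup>2 - r i' * D)" for i i'
    by (simp add: Q_def g_def \<beta>_def D_def ell_def algebra_simps power2_eq_square)
  have Q_diag: "Q i i \<in> P" if "i < 3" for i
  proof -
    have "Q i i = - 8 * r i * ((ell i)\<^sup>2 - r i * D)"
      unfolding Q_eq by (simp add: \<beta>_def e_def algebra_simps power2_eq_square)
    thus ?thesis by (simp only: P(3)[OF zero[OF that]])
  qed
  have four: "4 \<notin> P" using prime[of 2 2] two by auto
  have Q_off: "Q i i' \<notin> P" if i: "i < 3" "i' < 3" "i \<noteq> i'" for i i'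
  proof
    let ?x = "ell i * ell i' * \<beta> i i'" and ?y = "2 * r i * r i' * D"
    assume "Q i i' \<in> P"
    moreover have "Q i i' - 4 * (?x - ?y) \<in> P"
      unfolding Q_eq using P_uminus[OF P(2)[OF P(3)[OF zero[OF i(1)], of "8 * r i'"] P(3)[OF zero[OF i(2)], of "8 * r i"]]]
      by (simp add: algebra_simps)
    ultimately have "4 * (?x - ?y) \<in> P" using P_cong by blast
    hence "?x - ?y \<in> P" using prime four by blast
    \<comment> \<open>Squaring removes the sign ambiguity of the \<open>ell i\<close>: as
      \<open>ell i\<close> squared is r_i D on the cones, the difference of squares becomes r_i r_i'
      D^2 (\<open>\<beta>\<close>^2 - 4 r_i r_i'), a product of factors outside
      \<open>P\<close>.\<close>
    hence 1: "?x\<^sup>2 - ?y\<^sup>2 \<in> P" using P_mult'[of "?x - ?y" "?x + ?y"] by (simp add: algebra_simps power2_eq_square)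
    have "(ell i)\<^sup>2 * (ell i')\<^sup>2 - r i * D * (r i' * D) \<in> P"
      using P(2)[OF P_mult'[OF zero[OF i(1)], of "(ell i')\<^sup>2"] P(3)[OF zero[OF i(2)], of "r i * D"]]
      by (simp add: algebra_simps)
    from P_diff[OF 1 P(3)[OF this, of "(\<beta> i i')\<^sup>2"]]
    have "r i * (r i' * (D * (D * ((\<beta> i i')\<^sup>2 - 4 * r i * r i')))) \<in> P"
      by (simp add: algebra_simps power2_eq_square)
    thus False using prime r[OF i(1)] r[OF i(2)] D not_tangent[OF i] by blast
  qed
  have "det3 (\<lambda>i. Q i 0) (\<lambda>i. Q i 1) (\<lambda>i. Q i 2) \<in> P"
    unfolding Q_def gram_det_minors power2_eq_square
    by (rule P_diff[OF P_diff[OF P(3)[OF P(3)[OF minors(1)]] P(3)[OF P(3)[OF minors(2)]]]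
        P_mult'[OF P(3)[OF minors(3)]]])
  \<comment> \<open>A symmetric 3 x 3 matrix with zero diagonal has determinant twice the product of
    its off-diagonal entries; the right-hand side collects the diagonal terms.\<close>
  moreover have "det3 (\<lambda>i. Q i 0) (\<lambda>i. Q i 1) (\<lambda>i. Q i 2) - 2 * (Q 0 1 * (Q 0 2 * Q 1 2)) =
      (Q 1 1 * Q 2 2 - (Q 1 2)\<^sup>2) * Q 0 0 + (- ((Q 0 2)\<^sup>2)) * Q 1 1 + (- ((Q 0 1)\<^sup>2)) * Q 2 2"
    unfolding det3_def Q_sym[of 1 0] Q_sym[of 2 0] Q_sym[of 2 1] power2_eq_square
    by (simp add: algebra_simps)
  moreover have "\<dots> \<in> P" by (intro P(2) P(3) Q_diag i012)
  ultimately have "2 * (Q 0 1 * (Q 0 2 * Q 1 2)) \<in> P" using P_cong by metis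
  hence "Q 0 1 \<in> P \<or> Q 0 2 \<in> P \<or> Q 1 2 \<in> P" using prime two by blast
  thus False using Q_off[of 0 1] Q_off[of 0 2] Q_off[of 1 2] by simp
qed

section \<open>Tangency cones\<close>

lemma Const_2: "Const 2 = 2" and Const_4: "Const 4 = 4"
  by (rule Const_numeral)+

lemma tangency_cone_eq:
  "tangency_cone p =
     (Var 3 + Const (center_x p) * Var 1 + Const (center_y p) * Var 2
       + ((Const (center_x p))\<^sup>2 + (Const (center_y p))\<^sup>2 - Const (radius_sq p)) * Var 0)\<^sup>2
     - Const (radius_sq p) * ((Var 1)\<^sup>2 + (Var 2)\<^sup>2 - 4 * Var 0 * Var 3)"
  unfolding tangency_cone_def Let_def Const_diff Const_add Const_mult Const_power Const_2
  by (simp add: algebra_simps power2_eq_square)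

lemma tangency_cone_in: "tangency_cone p \<in> polys 4"
  unfolding tangency_cone_eq by simp

text \<open>The squared term is r + r' - d^2, with d^2 the squared distance of the centers, so the
  condition is the classical one that d is a sum or difference of the radii. Substituting p into the
  cone of p' gives the same expression times the square of \<open>p 0\<close>.\<close>

lemma tangent_circlesI:
  fixes p p' :: "nat \<Rightarrow> 'k::field"
  assumes two: "(2 :: 'k) \<noteq> 0" and p: "p 0 \<noteq> 0"
    and eq: "(2 * center_x p * center_x p' + 2 * center_y p * center_y p'
        - ((center_x p)\<^sup>2 + (center_y p)\<^sup>2 - radius_sq p) - ((center_x p')\<^sup>2 + (center_y p')\<^sup>2 - radius_sq p'))\<^sup>2
      - 4 * radius_sq p * radius_sq p' = 0"
  shows "tangent_circles p p'"
proof -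
  define a b r a' b' r' where defs: "a = center_x p" "b = center_y p" "r = radius_sq p"
    "a' = center_x p'" "b' = center_y p'" "r' = radius_sq p'"
  have p1: "p 1 = - 2 * a * p 0" and p2: "p 2 = - 2 * b * p 0"
    using two p by (simp_all add: defs center_x_def center_y_def)
  have p3: "p 3 = (a\<^sup>2 + b\<^sup>2 - r) * p 0"
    using p by (simp add: defs radius_sq_def)
  have num: "mpoly_subst (\<lambda>c. c) p 4 = 4"
    using id_eval.subst_Const[of p 4] by (simp add: Const_4)
  have "mpoly_subst (\<lambda>c. c) p (tangency_cone p') =
      (p 3 + a' * p 1 + b' * p 2 + (a'\<^sup>2 + b'\<^sup>2 - r') * p 0)\<^sup>2 - r' * ((p 1)\<^sup>2 + (p 2)\<^sup>2 - 4 * p 0 * p 3)"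
    by (simp add: tangency_cone_eq id_eval.subst_hom num defs)
  also have "\<dots> = (p 0)\<^sup>2 * ((2 * a * a' + 2 * b * b' - (a\<^sup>2 + b\<^sup>2 - r) - (a'\<^sup>2 + b'\<^sup>2 - r'))\<^sup>2 - 4 * r * r')"
    unfolding p1 p2 p3 by (simp add: algebra_simps power2_eq_square)
  also have "\<dots> = 0" using eq by (simp add: defs)
  finally show ?thesis by (simp add: tangent_circles_def)
qed

text \<open>If two of the points differ, take the line through them; the determinant condition
  places the third on it. If all coincide, the vertical line through the common point
  serves.\<close>

lemma collinearI:
  fixes x y :: "nat \<Rightarrow> 'k::field"
  assumes "x 0 * (y 1 - y 2) + x 1 * (y 2 - y 0) + x 2 * (y 0 - y 1) = 0"
  shows "\<exists>u v w. (u, v, w) \<noteq> (0, 0, 0) \<and> (\<forall>i<3. u * x i + v * y i + w = 0)"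
proof -
  have all3: "(\<forall>i<3. Q i) \<longleftrightarrow> Q 0 \<and> Q 1 \<and> Q (2::nat)" for Q
    by (auto simp: numeral_3_eq_3 numeral_2_eq_2 less_Suc_eq)
  show ?thesis
  proof (cases "x 0 = x 1 \<and> y 0 = y 1")
    case False
    have "(y 0 - y 1) * x 2 + (x 1 - x 0) * y 2 - ((y 0 - y 1) * x 0 + (x 1 - x 0) * y 0) = 0"
      using assms by (simp add: algebra_simps)
    thus ?thesis
      using False
      by (intro exI[of _ "y 0 - y 1"] exI[of _ "x 1 - x 0"] exI[of _ "- ((y 0 - y 1) * x 0 + (x 1 - x 0) * y 0)"])
         (auto simp: all3 algebra_simps)
  next
    case True
    show ?thesis
    proof (cases "x 0 = x 2 \<and> y 0 = y 2")
      case False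
      thus ?thesis
        using True
        by (intro exI[of _ "y 0 - y 2"] exI[of _ "x 2 - x 0"] exI[of _ "- ((y 0 - y 2) * x 0 + (x 2 - x 0) * y 0)"])
           (auto simp: all3 algebra_simps)
    next
      case True2: True
      show ?thesis
        using True True2 by (intro exI[of _ 1] exI[of _ 0] exI[of _ "- x 0"]) (auto simp: all3)
    qed
  qed
qed

lemma jacobian_simple:
  fixes C :: "nat \<Rightarrow> nat \<Rightarrow> 'k::field" and s :: "'k mpoly set" and j :: nat
  assumes two: "(2 :: 'k) \<noteq> 0"
    and nondegenerate: "\<forall>i<3. C i 0 \<noteq> 0"
    and genuine_cones: "\<forall>i<3. radius_sq (C i) \<noteq> 0"
    and centers: "\<not> (\<exists>u v w. (u, v, w) \<noteq> (0, 0, 0) \<and>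
        (\<forall>i<3. u * center_x (C i) + v * center_y (C i) + w = 0))"
    and not_tangent: "\<forall>i<3. \<forall>i'<3. i \<noteq> i' \<longrightarrow> \<not> tangent_circles (C i) (C i')"
    and s: "proj_point 3 s" "\<forall>i<3. tangency_cone (C i) \<in> s"
    and not_point: "\<not> point_circle s"
    and j: "j < 4" "Var j \<notin> s"
  shows "jacobian_det 3 (circle_chart_map C j) \<notin> chart_ideal j s"
proof -
  let ?f = "circle_chart_map C j" and ?m = "chart_ideal j s"
  interpret S: chart_point s 3 j by unfold_locales (use s j in auto)
  interpret m: primeideal ?m "mpoly_ring 3" by (rule S.primeideal_chart_ideal)
  define P where "P = {p. retract 3 p \<in> ?m}"
  \<comment> \<open>The function c_l / c_j on the chart, indexed by the homogeneous coordinate, so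
    that the value at j is 1.\<close>
  define \<gamma> where "\<gamma> l = dehom j (Var l :: 'k mpoly)" for l
  define a b r where abr: "a i = Const (center_x (C i))" "b i = Const (center_y (C i))" "r i = Const (radius_sq (C i))" for i
  define e where "e i = (a i)\<^sup>2 + (b i)\<^sup>2 - r i" for i
  define ell where "ell i = \<gamma> 3 + a i * \<gamma> 1 + b i * \<gamma> 2 + e i * \<gamma> 0" for i
  define D where "D = (\<gamma> 1)\<^sup>2 + (\<gamma> 2)\<^sup>2 - 4 * \<gamma> 0 * \<gamma> 3"
  define g where "g i l = (if l = (0::nat) then 2 * ell i * e i + 4 * r i * \<gamma> 3
      else if l = 1 then 2 * ell i * a i - 2 * r i * \<gamma> 1
      else if l = 2 then 2 * ell i * b i - 2 * r i * \<gamma> 2 else 2 * ell i + 4 * r i * \<gamma> 0)" for i l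
  \<comment> \<open>The homogeneous index of the l-th chart coordinate.\<close>
  define sk where "sk l = (if l < j then l else Suc l)" for l

  have dnum: "dehom j (4 :: 'k mpoly) = 4" using dehom_simps(6)[of j 4] by (simp only: Const_4)
  have f: "?f i = (ell i)\<^sup>2 - r i * D" for i
    by (simp add: circle_chart_map_def tangency_cone_eq \<gamma>_def ell_def D_def e_def abr dnum)
  have d4: "partial_deriv l (4 :: 'k mpoly) = 0" for l using partial_deriv_Const[of l 4] by (simp only: Const_4)
  have d\<gamma>: "partial_deriv l (\<gamma> k) = (if k = sk l then 1 else 0)" for l k
    by (auto simp: \<gamma>_def dehom_Var partial_deriv_Var sk_def)
  have dc: "partial_deriv l (a i) = 0" "partial_deriv l (b i) = 0" "partial_deriv l (r i) = 0" "partial_deriv l (e i) = 0"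
    for l i by (simp_all add: abr e_def partial_deriv_add partial_deriv_diff partial_deriv_mult power2_eq_square)
  \<comment> \<open>A partial derivative in the chart is the corresponding homogeneous one at c_j =
    1; only the derivative with respect to c_j itself is missing.\<close>
  have grad: "partial_deriv l (?f i) = g i (sk l)" if "l < 3" for i l
  proof -
    have "partial_deriv l (?f i) =
        2 * ell i * (partial_deriv l (\<gamma> 3) + a i * partial_deriv l (\<gamma> 1) + b i * partial_deriv l (\<gamma> 2) + e i * partial_deriv l (\<gamma> 0))
        - r i * (2 * \<gamma> 1 * partial_deriv l (\<gamma> 1) + 2 * \<gamma> 2 * partial_deriv l (\<gamma> 2)
          - 4 * (partial_deriv l (\<gamma> 0) * \<gamma> 3 + \<gamma> 0 * partial_deriv l (\<gamma> 3)))"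
      unfolding f ell_def D_def power2_eq_square partial_deriv_add partial_deriv_diff partial_deriv_mult dc d4
      by (simp add: algebra_simps)
    moreover have "sk l = 0 \<or> sk l = 1 \<or> sk l = 2 \<or> sk l = 3" using that by (auto simp: sk_def)
    ultimately show ?thesis
      unfolding d\<gamma> g_def by (elim disjE) (simp_all add: algebra_simps)
  qed
  have jac: "jacobian_det 3 ?f = det3 (\<lambda>i. g i (sk 0)) (\<lambda>i. g i (sk 1)) (\<lambda>i. g i (sk 2))"
    unfolding jacobian_det_def det_mat_3 by (simp add: grad)

  have m_mult: "p * q \<in> ?m" if "p \<in> polys 3" "q \<in> ?m" for p q
    using m.I_l_closed[of q p] that by simp
  have one: "1 \<notin> ?m"
  proof
    assume 1: "1 \<in> ?m"
    have "p \<in> ?m" if "p \<in> polys 3" for p using m_mult[OF that 1] by simp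
    thus False using m.I_notcarr m.a_subset by blast
  qed
  have Const: "Const c \<notin> P" if "c \<noteq> 0" for c
  proof
    assume "Const c \<in> P"
    hence "Const c \<in> ?m" by (simp add: P_def)
    from m_mult[OF polys_Const this, of "inverse c"] show False
      using that one by (simp flip: Const_mult)
  qed
  have P_iff: "p \<in> P \<longleftrightarrow> p \<in> ?m" if "p \<in> polys 3" for p using that by (simp add: P_def)
  have \<gamma>_in: "\<gamma> l \<in> polys 3" if "l < 4" for l
    unfolding \<gamma>_def by (rule dehom_in) (use that j in auto)
  have f_m: "?f i \<in> ?m" if "i < 3" for i
    unfolding circle_chart_map_def chart_ideal_def using s(2) that by blast
  have f_in: "?f i \<in> polys 3" for i
    unfolding circle_chart_map_def by (rule dehom_in) (use tangency_cone_in j in auto)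

  have "det3 (\<lambda>i. g i (if 0 < j then 0 else 1)) (\<lambda>i. g i (if 1 < j then 1 else 2)) (\<lambda>i. g i (if 2 < j then 2 else 3)) \<notin> P"
    unfolding g_def ell_def e_def
  proof (rule gradients_independent)
    show "0 \<in> P" using additive_subgroup.zero_closed[OF m.is_additive_subgroup] by (simp add: P_def)
    show "x + y \<in> P" if "x \<in> P" "y \<in> P" for x y
      using additive_subgroup.a_closed[OF m.is_additive_subgroup, of "retract 3 x" "retract 3 y"] that by (simp add: P_def)
    show "x * y \<in> P" if "y \<in> P" for x y
      using m_mult[OF retract_in, of "retract 3 y"] that by (simp add: P_def)
    show "1 \<notin> P" using one by (simp add: P_def)
    show "x \<in> P \<or> y \<in> P" if "x * y \<in> P" for x y
      using m.I_prime[of "retract 3 x" "retract 3 y"] that by (simp add: P_def)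
    show "2 \<notin> P" using Const[OF two] unfolding Const_2 .
    show "r i \<notin> P" if "i < 3" for i using Const genuine_cones that by (simp add: abr)
    show "a 0 * (b 1 - b 2) + a 1 * (b 2 - b 0) + a 2 * (b 0 - b 1) \<notin> P"
    proof -
      let ?x = "\<lambda>i. center_x (C i)" and ?y = "\<lambda>i. center_y (C i)"
      have "?x 0 * (?y 1 - ?y 2) + ?x 1 * (?y 2 - ?y 0) + ?x 2 * (?y 0 - ?y 1) \<noteq> 0"
        using collinearI[of ?x ?y] centers by blast
      from Const[OF this] show ?thesis by (simp add: abr Const_add Const_diff Const_mult)
    qed
    show "(2 * a i * a i' + 2 * b i * b i' - ((a i)\<^sup>2 + (b i)\<^sup>2 - r i) - ((a i')\<^sup>2 + (b i')\<^sup>2 - r i'))\<^sup>2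
        - 4 * r i * r i' \<notin> P" if i: "i < 3" "i' < 3" "i \<noteq> i'" for i i'
    proof -
      have "\<not> tangent_circles (C i) (C i')" using not_tangent i by blast
      hence "(2 * center_x (C i) * center_x (C i') + 2 * center_y (C i) * center_y (C i')
        - ((center_x (C i))\<^sup>2 + (center_y (C i))\<^sup>2 - radius_sq (C i))
        - ((center_x (C i'))\<^sup>2 + (center_y (C i'))\<^sup>2 - radius_sq (C i')))\<^sup>2
        - 4 * radius_sq (C i) * radius_sq (C i') \<noteq> 0"
        using tangent_circlesI[OF two] nondegenerate i(1) by blast
      from Const[OF this] show ?thesis
        by (simp only: abr Const_add Const_diff Const_mult Const_power Const_2 Const_4 not_False_eq_True)
    qed
    show "(\<gamma> 3 + a i * \<gamma> 1 + b i * \<gamma> 2 + ((a i)\<^sup>2 + (b i)\<^sup>2 - r i) * \<gamma> 0)\<^sup>2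
        - r i * ((\<gamma> 1)\<^sup>2 + (\<gamma> 2)\<^sup>2 - 4 * \<gamma> 0 * \<gamma> 3) \<in> P" if "i < 3" for i
      using f_m[OF that] P_iff[OF f_in[of i]] unfolding f ell_def e_def D_def by blast
    \<comment> \<open>The assumption \<open>not_point\<close> concerns s and not its chart ideal; D
      can be taken back to s because it is homogeneous.\<close>
    show "\<gamma> 0 \<in> P" if "(\<gamma> 1)\<^sup>2 + (\<gamma> 2)\<^sup>2 - 4 * \<gamma> 0 * \<gamma> 3 \<in> P"
    proof -
      let ?q = "(Var 1)\<^sup>2 + (Var 2)\<^sup>2 - Const 4 * Var 0 * Var 3 :: 'k mpoly"
      have "dehom j ?q = (\<gamma> 1)\<^sup>2 + (\<gamma> 2)\<^sup>2 - 4 * \<gamma> 0 * \<gamma> 3"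
        by (simp add: \<gamma>_def Const_4 dnum)
      moreover have "(\<gamma> 1)\<^sup>2 + (\<gamma> 2)\<^sup>2 - 4 * \<gamma> 0 * \<gamma> 3 \<in> polys 3" by (simp add: \<gamma>_in)
      ultimately have "dehom j ?q \<in> ?m" using that P_iff by simp
      moreover have "homog (1 + 1) ((Var l :: 'k mpoly)\<^sup>2)" for l
        unfolding power2_eq_square by (intro homog_mult homog_Var)
      moreover have "homog (0 + 1 + 1) (Const 4 * Var 0 * Var 3 :: 'k mpoly)"
        by (intro homog_mult homog_Var homog_Const)
      ultimately have "?q \<in> s"
        by (intro S.chart_ideal_homog[of "1 + 1"] homog_diff homog_add) simp_all
      hence "Var 0 \<in> s" using not_point by (auto simp: point_circle_def)
      hence "\<gamma> 0 \<in> ?m" unfolding \<gamma>_def chart_ideal_def by (rule imageI)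
      thus ?thesis using P_iff \<gamma>_in by simp
    qed
    show "j < 4" by (rule j)
    show "\<gamma> j = 1" by (simp add: \<gamma>_def dehom_Var)
  qed
  moreover have "jacobian_det 3 ?f \<in> polys 3" by (rule jacobian_det_in) (rule f_in)
  moreover have "sk 0 = (if 0 < j then 0 else 1)" "sk 1 = (if 1 < j then 1 else 2)" "sk 2 = (if 2 < j then 2 else 3)"
    by (auto simp: sk_def)
  ultimately show ?thesis using P_iff by (simp only: jac not_False_eq_True)
qed

theorem theorem1p2:
  fixes C :: "nat \<Rightarrow> nat \<Rightarrow> 'k::field" and s :: "'k mpoly set" and j :: nat
  assumes char_not_2: "(2 :: 'k) \<noteq> 0"
    and nondegenerate: "\<forall>i<3. C i 0 \<noteq> 0"
    and genuine_cones: "\<forall>i<3. radius_sq (C i) \<noteq> 0"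
    and centers: "\<not> (\<exists>u v w. (u, v, w) \<noteq> (0, 0, 0) \<and>
        (\<forall>i<3. u * center_x (C i) + v * center_y (C i) + w = 0))"
    and not_tangent: "\<forall>i<3. \<forall>i'<3. i \<noteq> i' \<longrightarrow> \<not> tangent_circles (C i) (C i')"
    and S: "s \<in> common_tangent_circles C"
    and not_point: "\<not> point_circle s"
    and chart: "j < 4" "Var j \<notin> s"
    and separable: "separable_extension (point_field s j) (point_field_map s j)"
  shows "Vol C s j \<noteq> \<zero>\<^bsub>point_field s j\<^esub> \<and>
    local_index C s j = trace_gw_unit (point_field s j) (point_field_map s j) (Vol C s j)"
proof -
  let ?f = "circle_chart_map C j" and ?m = "chart_ideal j s"
  have s: "proj_point 3 s" "\<forall>i<3. tangency_cone (C i) \<in> s"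
    using S by (simp_all add: common_tangent_circles_def proj_closed_point_def)
  interpret S: chart_point s 3 j by unfold_locales (use s chart in auto)
  have J: "jacobian_det 3 ?f \<notin> ?m"
    by (rule jacobian_simple[OF char_not_2 nondegenerate genuine_cones centers not_tangent s not_point chart])
  have map: "point_field_map s j = (\<lambda>c. residue_class 3 ?m (Const c))"
    by (rule ext) (simp add: point_field_map_def)
  interpret Z: simple_zero ?m 3 ?f
  proof (unfold simple_zero_def, intro conjI allI impI)
    show "primeideal ?m (mpoly_ring 3)" by (rule S.primeideal_chart_ideal)
    show "?f i \<in> polys 3" if "i < 3" for i
      unfolding circle_chart_map_def by (rule dehom_in) (use tangency_cone_in chart in auto)
    show "?f i \<in> ?m" if "i < 3" for i
      unfolding circle_chart_map_def chart_ideal_def using s(2) that by blast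
    show "separable_extension (residue_field 3 ?m) (\<lambda>c. residue_class 3 ?m (Const c))"
      using separable unfolding map point_field_def .
  qed (rule J)
  \<comment> \<open>The sign in the index and the sign in the volume are both the unit
    \<open>\<epsilon>\<close> of the local computation, which requires its square to be 1.\<close>
  have sign: "(- 1) ^ j = Const ((- 1) ^ j :: 'k)" by (simp add: Const_power Const_uminus)
  have unit: "(- 1) ^ j * (- 1) ^ j = (1 :: 'k)" by (simp flip: power_add)
  \<comment> \<open>Multiplying by the sign once more would put J itself into the ideal. This
    nonvanishing makes the class of the volume meaningful.\<close>
  have "Const ((- 1) ^ j) * Z.J \<notin> ?m"
  proof
    assume "Const ((- 1) ^ j) * Z.J \<in> ?m"
    from Z.mm_mult[OF polys_Const this, of "(- 1) ^ j"]
    have "Const ((- 1) ^ j * (- 1) ^ j) * Z.J \<in> ?m" by (simp only: Const_mult mult.assoc)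
    thus False using J by (simp only: unit Const_1 mult_1)
  qed
  hence "Vol C s j \<noteq> \<zero>\<^bsub>point_field s j\<^esub>"
    unfolding Vol_def point_field_def sign by (intro Z.simple_nonzero polys_mult polys_Const Z.J_in)
  moreover have "local_index C s j = trace_gw_unit (point_field s j) (point_field_map s j) (Vol C s j)"
    unfolding local_index_def Vol_def point_field_def map sign by (rule Z.local_degree_simple_zero[OF unit])
  ultimately show ?thesis by blast
qed

end
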